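(* There exists a universal constant $C>1$ such that the following holds. Let $N\ge2$, let $\mathcal X_1,\ldots,\mathcal X_L$ be subspaces of $\mathbb R^N$ of dimensions $d_1,\ldots,d_L\ge1$ and let $d_*=\max\{d_1,\ldots,d_L\}$. Let $\mathbf A\in\mathbb C^{n\times N}$ be the random sampling matrix associated to a bounded orthonormal system with constant $K\ge1$, let $\mathbf D_\epsilon$ be an $N\times N$ diagonal matrix with i.i.d. Rademacher random variables on its diagonal, independent of $\mathbf A$, and let $\mathbf\Phi=\frac1{\sqrt n}\mathbf A\mathbf D_\epsilon$. Let $\mathcal Y_i$ be the image of $\mathcal X_i$ under $\mathbf\Phi$. Then for any $\varepsilon\in(0,1)$ and any $n>CK^3\varepsilon^{-3}\max\{d_*(\log^3d_*+\log L),\log^2L,\log^3N\}$, we have $$\left|\operatorname{aff}^2(\mathcal Y_i,\mathcal Y_j)-\operatorname{aff}^2(\mathcal X_i,\mathcal X_j)\right|\le\varepsilon\left(\min\{d_i,d_j\}-\operatorname{aff}^2(\mathcal X_i,\mathcal X_j)\right)\quad\text{for all }1\le i<j\le L$$ with probability at least $$1-\exp\left(-C^{-1}\big(\sqrt{d_*^2+K^{-2}\varepsilon^2n}-d_*\big)\right).$$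
   Context: A bounded orthonormal system (BOS) with constant $K$ consists of functions $\phi_1,\ldots,\phi_N:\mathcal D\to\mathbb C$ on a probability space $(\mathcal D,\nu)$ with $\int\phi_j\overline{\phi_k}\,d\nu=\delta_{jk}$ and $\sup_{t\in\mathcal D}|\phi_j(t)|\le K$ for all $j$. The associated random sampling matrix is $\mathbf A\in\mathbb C^{n\times N}$ with $A_{l,k}=\phi_k(t_l)$, where $t_1,\ldots,t_n$ are independent with law $\nu$. For subspaces $\mathcal A,\mathcal B$ of a finite-dimensional (real or complex) inner product space, $\operatorname{aff}(\mathcal A,\mathcal B)=\sqrt{\operatorname{tr}(\mathcal P_{\mathcal A}\mathcal P_{\mathcal B})}$, where $\mathcal P_{\mathcal A},\mathcal P_{\mathcal B}$ are the orthogonal projections onto $\mathcal A,\mathcal B$. Since $\mathbf\Phi$ may be complex, the image $\mathcal Y_i$ is understood as the complex linear span of $\mathbf\Phi\mathcal X_i$ in $\mathbb C^n$ and its affinities are computed with complex orthogonal projections. *)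

theory Defs
  imports "HOL-Probability.Probability" "Jordan_Normal_Form.VS_Connect"
begin

definition bounded_orthonormal_system ::
    "'d measure \<Rightarrow> nat \<Rightarrow> real \<Rightarrow> (nat \<Rightarrow> 'd \<Rightarrow> complex) \<Rightarrow> bool" where
  "bounded_orthonormal_system \<nu> N K \<phi> \<longleftrightarrow>
     prob_space \<nu> \<and>
     (\<forall>k<N. \<phi> k \<in> borel_measurable \<nu>) \<and>
     (\<forall>j<N. \<forall>k<N. (\<integral>x. \<phi> j x * cnj (\<phi> k x) \<partial>\<nu>) = (if j = k then 1 else 0)) \<and>
     (\<forall>k<N. \<forall>x\<in>space \<nu>. cmod (\<phi> k x) \<le> K)"

definition sampling_matrix ::
    "nat \<Rightarrow> nat \<Rightarrow> (nat \<Rightarrow> 'd \<Rightarrow> complex) \<Rightarrow> (nat \<Rightarrow> 'd) \<Rightarrow> complex mat" where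
  "sampling_matrix n N \<phi> t = Matrix.mat n N (\<lambda>(l, k). \<phi> k (t l))"

definition iid_sample :: "'w measure \<Rightarrow> 'd measure \<Rightarrow> nat \<Rightarrow> (nat \<Rightarrow> 'w \<Rightarrow> 'd) \<Rightarrow> bool" where
  "iid_sample P \<nu> n t \<longleftrightarrow>
     prob_space.indep_vars P (\<lambda>_. \<nu>) t {..<n} \<and> (\<forall>l<n. distr P \<nu> (t l) = \<nu>)"

definition iid_rademacher :: "'w measure \<Rightarrow> nat \<Rightarrow> (nat \<Rightarrow> 'w \<Rightarrow> real) \<Rightarrow> bool" where
  "iid_rademacher P N \<sigma> \<longleftrightarrow>
     prob_space.indep_vars P (\<lambda>_. borel) \<sigma> {..<N} \<and>
     (\<forall>k<N. measure P {\<omega> \<in> space P. \<sigma> k \<omega> = 1} = 1 / 2 \<and>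
            measure P {\<omega> \<in> space P. \<sigma> k \<omega> = -1} = 1 / 2)"

text \<open>Random matrices and vectors enter the independence requirement as families of entries,
  since matrices and vectors with explicit carriers bear no sigma-algebra.\<close>

definition indep_of_matrix ::
    "'w measure \<Rightarrow> nat \<Rightarrow> nat \<Rightarrow> (nat \<Rightarrow> 'w \<Rightarrow> real) \<Rightarrow> ('w \<Rightarrow> complex mat) \<Rightarrow> bool" where
  "indep_of_matrix P n N \<sigma> A \<longleftrightarrow>
     prob_space.indep_set P
       {(\<lambda>\<omega>. \<lambda>p\<in>{..<n} \<times> {..<N}. A \<omega> $$ p) -` B \<inter> space P | B.
          B \<in> sets (PiM ({..<n} \<times> {..<N}) (\<lambda>_. borel))}
       {(\<lambda>\<omega>. \<lambda>k\<in>{..<N}. \<sigma> k \<omega>) -` B \<inter> space P | B. B \<in> sets (PiM {..<N} (\<lambda>_. borel))}"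

definition embedding_matrix :: "nat \<Rightarrow> nat \<Rightarrow> complex mat \<Rightarrow> (nat \<Rightarrow> real) \<Rightarrow> complex mat" where
  "embedding_matrix n N A \<sigma> =
     complex_of_real (1 / sqrt (real n)) \<cdot>\<^sub>m (A * mat_diag N (\<lambda>k. complex_of_real (\<sigma> k)))"

definition is_subspace :: "nat \<Rightarrow> 'a::field vec set \<Rightarrow> bool" where
  "is_subspace m W \<longleftrightarrow> VectorSpace.subspace class_ring W (module_vec TYPE('a) m)"

definition subspace_dim :: "nat \<Rightarrow> 'a::field vec set \<Rightarrow> nat" where
  "subspace_dim m W = vectorspace.dim class_ring (module_vec TYPE('a) m \<lparr>carrier := W\<rparr>)"

definition image_span :: "nat \<Rightarrow> complex mat \<Rightarrow> real vec set \<Rightarrow> complex vec set" where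
  "image_span n \<Phi> X =
     LinearCombinations.module.span class_ring (module_vec TYPE(complex) n)
       ((\<lambda>x. \<Phi> *\<^sub>v map_vec complex_of_real x) ` X)"

definition orth_proj :: "nat \<Rightarrow> 'a::conjugatable_field vec set \<Rightarrow> 'a mat" where
  "orth_proj m W = (THE P. P \<in> carrier_mat m m \<and>
     (\<forall>x\<in>carrier_vec m. P *\<^sub>v x \<in> W \<and> (\<forall>w\<in>W. (x - P *\<^sub>v x) \<bullet>c w = 0)))"

definition mat_trace :: "'a::comm_monoid_add mat \<Rightarrow> 'a" where
  "mat_trace M = (\<Sum>i<dim_row M. M $$ (i, i))"

definition aff_real :: "nat \<Rightarrow> real vec set \<Rightarrow> real vec set \<Rightarrow> real" where
  "aff_real m U V = sqrt (mat_trace (orth_proj m U * orth_proj m V))"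

text \<open>The trace of a product of two orthogonal projections is a nonnegative real number,
  so taking its real part only changes the type.\<close>

definition aff_complex :: "nat \<Rightarrow> complex vec set \<Rightarrow> complex vec set \<Rightarrow> real" where
  "aff_complex m U V = sqrt (Re (mat_trace (orth_proj m U * orth_proj m V)))"

text \<open>\<open>affinity_preservation TYPE('d) TYPE('w) C\<close> is the assertion that the constant \<open>C\<close> works for
  all bounded orthonormal systems on measure spaces over \<open>'d\<close> and all random choices made on
  probability spaces over \<open>'w\<close>. The type arguments are explicit because the constant has to be
  independent of them, and HOL cannot quantify over types below an existential quantifier.\<close>

definition affinity_preservation :: "'d itself \<Rightarrow> 'w itself \<Rightarrow> real \<Rightarrow> bool" where
  "affinity_preservation _ _ C \<longleftrightarrow>
    (\<forall>(N::nat) (L::nat) (X :: nat \<Rightarrow> real vec set) (d :: nat \<Rightarrow> nat) (dmax :: nat)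
       (n::nat) (K::real) (\<nu> :: 'd measure) (\<phi> :: nat \<Rightarrow> 'd \<Rightarrow> complex)
       (P :: 'w measure) (t :: nat \<Rightarrow> 'w \<Rightarrow> 'd) (\<sigma> :: nat \<Rightarrow> 'w \<Rightarrow> real)
       (A :: 'w \<Rightarrow> complex mat) (Y :: 'w \<Rightarrow> nat \<Rightarrow> complex vec set) (\<epsilon>::real).
      N \<ge> 2 \<longrightarrow> L \<ge> 1 \<longrightarrow>
      (\<forall>i\<in>{1..L}. is_subspace N (X i) \<and> d i = subspace_dim N (X i) \<and> d i \<ge> 1) \<longrightarrow>
      dmax = Max (d ` {1..L}) \<longrightarrow>
      K \<ge> 1 \<longrightarrow> bounded_orthonormal_system \<nu> N K \<phi> \<longrightarrow>
      prob_space P \<longrightarrow> iid_sample P \<nu> n t \<longrightarrow>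
      A = (\<lambda>\<omega>. sampling_matrix n N \<phi> (\<lambda>l. t l \<omega>)) \<longrightarrow>
      iid_rademacher P N \<sigma> \<longrightarrow> indep_of_matrix P n N \<sigma> A \<longrightarrow>
      Y = (\<lambda>\<omega> i. image_span n (embedding_matrix n N (A \<omega>) (\<lambda>k. \<sigma> k \<omega>)) (X i)) \<longrightarrow>
      0 < \<epsilon> \<longrightarrow> \<epsilon> < 1 \<longrightarrow>
      real n > C * K ^ 3 / \<epsilon> ^ 3 *
        Max {real dmax * (ln (real dmax) ^ 3 + ln (real L)), ln (real L) ^ 2, ln (real N) ^ 3} \<longrightarrow>
      measure P {\<omega> \<in> space P. \<forall>i j. 1 \<le> i \<longrightarrow> i < j \<longrightarrow> j \<le> L \<longrightarrow>
          \<bar>(aff_complex n (Y \<omega> i) (Y \<omega> j))\<^sup>2 - (aff_real N (X i) (X j))\<^sup>2\<bar>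
            \<le> \<epsilon> * (real (min (d i) (d j)) - (aff_real N (X i) (X j))\<^sup>2)}
        \<ge> 1 - exp (- (1 / C) * (sqrt (real dmax ^ 2 + \<epsilon>\<^sup>2 * real n / K\<^sup>2) - real dmax)))"

text \<open>These types are large enough to carry a copy of the joint law of the sampling matrix and the
  signs for every choice of spaces, so a constant that works for them works for all types.\<close>

type_synonym sample_point = "nat \<Rightarrow> complex"
type_synonym sample_space = "(nat \<Rightarrow> sample_point) \<times> (nat \<Rightarrow> real)"

end

theory Submission
  imports Defs
begin

text \<open>
  The squared affinity is \<open>d\<^sub>i\<close> minus the sum of the squared distances of an orthonormal basis of the
  first space from the second one, and a linear map that is nearly isometric on the sum of both spaces
  nearly preserves these distances. So it suffices that \<open>\<Phi>\<close> is nearly isometric on each of the at most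
  \<open>L\<^sup>2\<close> sums \<open>\<X>\<^sub>i + \<X>\<^sub>j\<close>, whose dimension \<open>D\<close> is at most \<open>2 d\<^sub>*\<close>.

  Let \<open>p\<close> be the orthogonal projection onto such a sum. For fixed signs the Gram matrix of \<open>\<Phi>\<close> on it
  is an average of independent rank-one matrices \<open>w\<^sub>l w\<^sub>l\<^sup>*\<close> with mean \<open>p\<close>. Truncated at
  \<open>\<bar>w\<^sub>l\<bar>\<^sup>2 \<le> R\<close>, the centred sum \<open>X\<close> is controlled by Markov's inequality for \<open>tr (X\<^sup>2\<^sup>q)\<close>, and
  resampling one summand at a time gives a recursion in \<open>q\<close> for this moment in which \<open>p\<close>, not the ambient
  identity, appears, so that only the factor \<open>D\<close> is lost instead of \<open>N\<close>. The truncation is harmless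
  for most signs: \<open>\<bar>w\<^sub>l\<bar>\<^sup>2\<close> is a Rademacher chaos of order two whose \<open>q\<close>-th moment is at most
  \<open>(2 K\<^sup>2 (D + 8 q))\<^sup>q\<close>. The choice of \<open>R\<close> proportional to \<open>K\<^sup>2 (D + q)\<close> and of \<open>q\<close> proportional to the
  exponent in the probability bound beats all prefactors.

  A constant that works on the canonical sample spaces works everywhere because the assertion only
  depends on the joint law of the sampling matrix and the signs.
\<close>

section \<open>Powers of Hermitian matrices\<close>

text \<open>The recursion is the method of exchangeable pairs. If \<open>Y\<close> is
  \<open>X\<close> with one summand resampled, then \<open>X^q - Y^q\<close> telescopes into mixed
  products \<open>X^j (X - Y) Y^(q-1-j)\<close>. As \<open>X\<close> and \<open>Y\<close> do not
  commute, these are not compared one by one; only their sum is dominated by the two extreme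
  products, through a convexity in \<open>j\<close>. Squaring a rank-one summand merely multiplies
  it by its trace, at most \<open>R\<close>, and this closes the recursion. The same scheme, with
  one sign flipped in place of one sample exchanged, bounds the chaos. For unfavourable signs the
  squared norm of a projected row is only bounded by \<open>K^2 N\<close>; averaging over the signs
  is what brings it down to the order \<open>K^2 (D + q)\<close>. The comparison of distances is not
  symmetric in the two spaces and yields one dimension at a time; exchanging the spaces gives the
  minimum. A set that is not measurable has measure 0, so a lower bound for a probability includes a
  measurability claim. This is why projections are written as explicit functions of the
  vectors.\<close>

lemma midpoint_convex_sum:
  fixes f :: "nat \<Rightarrow> real"
  assumes mid: "\<And>a b. a \<le> s \<Longrightarrow> b \<le> s \<Longrightarrow> 2 * f (a + b) \<le> f (2 * a) + f (2 * b)"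
  shows "2 * (\<Sum>j\<le>2 * s. f j) \<le> (2 * real s + 1) * (f 0 + f (2 * s))"
proof -
  \<comment> \<open>A discrete maximum principle for the symmetrised values at even points. The
    hypothesis bounds by values at even points only, since in the application only those are squared
    norms.\<close>
  define G where "G c = f (2 * c) + f (2 * (s - c))" for c
  have G_le: "G c \<le> G 0" if "c \<le> s" for c
  proof -
    define m where "m = Max (G ` {..s})"
    have m: "G c \<le> m" if "c \<le> s" for c using that by (auto simp: m_def)
    have "m \<in> G ` {..s}" unfolding m_def by (rule Max_in) auto
    then have ex: "\<exists>c. c \<le> s \<and> G c = m" by auto
    \<comment> \<open>The leftmost maximiser. If it were interior, its left neighbour would have a
      strictly smaller value, against the midpoint inequality.\<close>
    define c where "c = (LEAST c. c \<le> s \<and> G c = m)"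
    have c: "c \<le> s" "G c = m" using LeastI_ex[OF ex] by (auto simp: c_def)
    have min: "G b \<noteq> m" if "b < c" for b
      using not_less_Least[of b "\<lambda>c. c \<le> s \<and> G c = m"] that c(1) by (auto simp: c_def)
    have "G 0 = m"
    proof (cases "c = 0 \<or> c = s")
      case True
      then show ?thesis using c by (auto simp: G_def)
    next
      case False
      then obtain b where b: "c = Suc b" "Suc c \<le> s" using c(1) by (cases c) auto
      have e: "s - b = Suc (s - c)" "s - Suc c = s - c - 1" using b by auto
      have "b + Suc c = 2 * c" using b by simp
      then have "2 * f (2 * c) \<le> f (2 * b) + f (2 * Suc c)"
        using mid[of b "Suc c"] b(2) \<open>c \<le> s\<close> b(1) by (metis Suc_leD)
      moreover have "2 * f (2 * (s - c)) \<le> f (2 * (s - b)) + f (2 * (s - Suc c))"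
      proof -
        have "s - b + (s - Suc c) = 2 * (s - c)" using b by auto
        then show ?thesis using mid[of "s - b" "s - Suc c"] by simp
      qed
      ultimately have "2 * G c \<le> G b + G (Suc c)" by (auto simp: G_def)
      moreover have "G b < m" using m[of b] min[of b] b by auto
      moreover have "G (Suc c) \<le> m" using m b by auto
      ultimately show ?thesis using c by auto
    qed
    then show ?thesis using m that by auto
  qed
  have pair: "f j + f (2 * s - j) \<le> G 0" if "j \<le> 2 * s" for j
  proof (cases "even j")
    case True
    then obtain c where "j = 2 * c" by blast
    then show ?thesis using G_le[of c] that by (auto simp: G_def right_diff_distrib')
  next
    case False
    then obtain c where j: "j = 2 * c + 1" by (elim oddE)
    have c: "Suc c \<le> s" using j that by auto
    have "c + Suc c = j" using j by simp
    then have "2 * f j \<le> f (2 * c) + f (2 * Suc c)"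
      using mid[of c "Suc c"] c by simp
    moreover have "2 * f (2 * s - j) \<le> f (2 * (s - c)) + f (2 * (s - Suc c))"
    proof -
      have "s - c + (s - Suc c) = 2 * s - j" using c j by auto
      then show ?thesis using mid[of "s - c" "s - Suc c"] by simp
    qed
    ultimately show ?thesis using G_le[of c] G_le[of "Suc c"] c by (auto simp: G_def)
  qed
  have "(\<Sum>j\<le>2 * s. f j) = (\<Sum>j\<le>2 * s. f (2 * s - j))"
    by (rule sum.reindex_bij_witness[of _ "\<lambda>j. 2 * s - j" "\<lambda>j. 2 * s - j"]) auto
  then have "2 * (\<Sum>j\<le>2 * s. f j) = (\<Sum>j\<le>2 * s. f j + f (2 * s - j))"
    by (simp add: sum.distrib)
  also have "\<dots> \<le> (\<Sum>j\<le>2 * s. G 0)" by (intro sum_mono pair) auto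
  also have "\<dots> = (2 * real s + 1) * (f 0 + f (2 * s))" by (simp add: G_def)
  finally show ?thesis .
qed

text \<open>Meant for \<open>L\<close> = left multiplication by \<open>A\<close> and
  \<open>T\<close> = right multiplication by \<open>B\<close>, which commute even when
  \<open>A\<close> and \<open>B\<close> do not. For Hermitian \<open>H\<close> the summand is then
  the trace of \<open>H A^j H B^(2s-j)\<close>. It is the inner product of
  \<open>L^a T^(s-a) H\<close> and \<open>L^b T^(s-b) H\<close> for every splitting
  \<open>j = a + b\<close> with \<open>a, b \<le> s\<close>, and hence midpoint convex.\<close>

lemma selfadjoint_commuting_sum:
  fixes ip :: "'h \<Rightarrow> 'h \<Rightarrow> real" and L T :: "'h \<Rightarrow> 'h"
  assumes am: "\<And>x y. 2 * ip x y \<le> ip x x + ip y y"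
    and L: "\<And>x y. ip (L x) y = ip x (L y)" and T: "\<And>x y. ip (T x) y = ip x (T y)"
    and comm: "\<And>x. L (T x) = T (L x)"
  shows "2 * (\<Sum>j\<le>2 * s. ip H ((L ^^ j) ((T ^^ (2 * s - j)) H)))
    \<le> (2 * real s + 1) * (ip ((L ^^ s) H) ((L ^^ s) H) + ip ((T ^^ s) H) ((T ^^ s) H))"
proof -
  have La: "ip ((L ^^ a) x) y = ip x ((L ^^ a) y)" for a x y
    proof (induction a arbitrary: x)
    case (Suc a)
    have "ip ((L ^^ Suc a) x) y = ip ((L ^^ a) (L x)) y" by (simp only: funpow_Suc_right o_apply)
    also have "\<dots> = ip (L x) ((L ^^ a) y)" by (rule Suc)
    also have "\<dots> = ip x ((L ^^ Suc a) y)" by (simp add: L)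
    finally show ?case .
  qed simp
  have Ta: "ip ((T ^^ a) x) y = ip x ((T ^^ a) y)" for a x y
    proof (induction a arbitrary: x)
    case (Suc a)
    have "ip ((T ^^ Suc a) x) y = ip ((T ^^ a) (T x)) y" by (simp only: funpow_Suc_right o_apply)
    also have "\<dots> = ip (T x) ((T ^^ a) y)" by (rule Suc)
    also have "\<dots> = ip x ((T ^^ Suc a) y)" by (simp add: T)
    finally show ?case .
  qed simp
  have c1: "(L ^^ a) (T x) = T ((L ^^ a) x)" for a x
    by (induction a) (simp_all add: comm)
  have LT: "(L ^^ a) ((T ^^ b) x) = (T ^^ b) ((L ^^ a) x)" for a b x
    by (induction b) (simp_all add: c1)
  define f where "f j = ip H ((L ^^ j) ((T ^^ (2 * s - j)) H))" for j
  have fab: "ip ((L ^^ a) ((T ^^ (s - a)) H)) ((L ^^ b) ((T ^^ (s - b)) H)) = f (a + b)"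
    if "a \<le> s" "b \<le> s" for a b
  proof -
    have "ip ((L ^^ a) ((T ^^ (s - a)) H)) ((L ^^ b) ((T ^^ (s - b)) H))
        = ip H ((T ^^ (s - a)) ((L ^^ a) ((L ^^ b) ((T ^^ (s - b)) H))))"
      by (simp add: La Ta)
    also have "\<dots> = ip H ((L ^^ (a + b)) ((T ^^ ((s - a) + (s - b))) H))"
      by (simp add: funpow_add LT[symmetric])
    also have "(s - a) + (s - b) = 2 * s - (a + b)" using that by auto
    finally show ?thesis by (simp add: f_def)
  qed
  have "2 * (\<Sum>j\<le>2 * s. f j) \<le> (2 * real s + 1) * (f 0 + f (2 * s))"
  proof (rule midpoint_convex_sum)
    fix a b assume "a \<le> s" "b \<le> s"
    then show "2 * f (a + b) \<le> f (2 * a) + f (2 * b)"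
      using am[of "(L ^^ a) ((T ^^ (s - a)) H)" "(L ^^ b) ((T ^^ (s - b)) H)"]
        fab[of a b] fab[of a a, folded mult_2] fab[of b b, folded mult_2] by simp
  qed
  moreover have "f 0 = ip ((T ^^ s) H) ((T ^^ s) H)" using fab[of 0 0] by simp
  moreover have "f (2 * s) = ip ((L ^^ s) H) ((L ^^ s) H)" using fab[of s s, folded mult_2] by simp
  ultimately show ?thesis by (simp add: f_def add.commute)
qed

text \<open>Matrices are functions of two indices. \<open>mone N\<close> is the identity truncated to \<open>N \<times> N\<close>, so it is
  neutral only for matrices with \<open>msupp\<close>.\<close>

definition mm :: "nat \<Rightarrow> (nat \<Rightarrow> nat \<Rightarrow> complex) \<Rightarrow> (nat \<Rightarrow> nat \<Rightarrow> complex) \<Rightarrow> nat \<Rightarrow> nat \<Rightarrow> complex"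
  where "mm N A B = (\<lambda>i j. \<Sum>k<N. A i k * B k j)"

definition hs :: "nat \<Rightarrow> (nat \<Rightarrow> nat \<Rightarrow> complex) \<Rightarrow> (nat \<Rightarrow> nat \<Rightarrow> complex) \<Rightarrow> real"
  where "hs N A B = (\<Sum>i<N. \<Sum>j<N. Re (cnj (A i j) * B i j))"

definition madj :: "(nat \<Rightarrow> nat \<Rightarrow> complex) \<Rightarrow> nat \<Rightarrow> nat \<Rightarrow> complex"
  where "madj A = (\<lambda>i j. cnj (A j i))"

definition mone :: "nat \<Rightarrow> nat \<Rightarrow> nat \<Rightarrow> complex"
  where "mone N = (\<lambda>i j. if i = j \<and> i < N then 1 else 0)"

definition msupp :: "nat \<Rightarrow> (nat \<Rightarrow> nat \<Rightarrow> complex) \<Rightarrow> bool"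
  where "msupp N A \<longleftrightarrow> (\<forall>i j. N \<le> i \<or> N \<le> j \<longrightarrow> A i j = 0)"

definition mpow :: "nat \<Rightarrow> (nat \<Rightarrow> nat \<Rightarrow> complex) \<Rightarrow> nat \<Rightarrow> nat \<Rightarrow> nat \<Rightarrow> complex"
  where "mpow N A k = (mm N A ^^ k) (mone N)"

section \<open>Matrix algebra and the Hilbert-Schmidt inner product\<close>

lemma mm_assoc: "mm N (mm N A B) C = mm N A (mm N B C)"
proof (intro ext)
  fix i j
  have "mm N (mm N A B) C i j = (\<Sum>k<N. \<Sum>l<N. A i l * B l k * C k j)"
    by (simp add: mm_def sum_distrib_right)
  also have "\<dots> = (\<Sum>l<N. \<Sum>k<N. A i l * B l k * C k j)" by (rule sum.swap)
  also have "\<dots> = mm N A (mm N B C) i j"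
    by (simp add: mm_def sum_distrib_left mult.assoc)
  finally show "mm N (mm N A B) C i j = mm N A (mm N B C) i j" .
qed

lemma mm_diff_left: "mm N (A - B) C = mm N A C - mm N B C"
  by (intro ext) (simp add: mm_def sum_subtractf left_diff_distrib)

lemma mm_diff_right: "mm N A (B - C) = mm N A B - mm N A C"
  by (intro ext) (simp add: mm_def sum_subtractf right_diff_distrib)

lemma mm_one_right: "msupp N A \<Longrightarrow> mm N A (mone N) = A"
  by (intro ext) (auto simp: mm_def mone_def msupp_def if_distrib[of "\<lambda>x. _ * x"] cong: if_cong)

lemma mm_one_left: "msupp N A \<Longrightarrow> mm N (mone N) A = A"
proof (intro ext)
  fix i j assume "msupp N A"
  then show "mm N (mone N) A i j = A i j"
    by (cases "i < N") (auto simp: mm_def mone_def msupp_def if_distrib[of "\<lambda>x. x * _"] cong: if_cong)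
qed

lemma msupp_mm: "msupp N A \<Longrightarrow> msupp N B \<Longrightarrow> msupp N (mm N A B)"
  by (auto simp: msupp_def mm_def)

lemma msupp_one: "msupp N (mone N)"
  by (auto simp: msupp_def mone_def)

lemma msupp_diff: "msupp N A \<Longrightarrow> msupp N B \<Longrightarrow> msupp N (A - B)"
  by (auto simp: msupp_def)

lemma msupp_pow: "msupp N A \<Longrightarrow> msupp N (mpow N A k)"
  unfolding mpow_def by (induction k) (auto simp: msupp_one msupp_mm)

lemma madj_mm: "madj (mm N A B) = mm N (madj B) (madj A)"
  by (intro ext) (simp add: madj_def mm_def mult.commute)

lemma madj_one: "madj (mone N) = mone N"
  by (intro ext) (auto simp: madj_def mone_def)

lemma madj_diff: "madj (A - B) = madj A - madj B"
  by (intro ext) (auto simp: madj_def)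

lemma madj_madj [simp]: "madj (madj A) = A"
  by (intro ext) (auto simp: madj_def)

lemma hs_sym: "hs N A B = hs N B A"
  unfolding hs_def by (intro sum.cong) auto

lemma hs_self_nonneg: "0 \<le> hs N A A"
  unfolding hs_def by (intro sum_nonneg) (auto simp: complex_mult_cnj)

lemma hs_diff_left: "hs N (A - B) C = hs N A C - hs N B C"
  by (simp only: hs_def minus_apply complex_cnj_diff left_diff_distrib minus_complex.sel sum_subtractf)

lemma hs_diff_right: "hs N A (B - C) = hs N A B - hs N A C"
  by (metis hs_sym hs_diff_left)

lemma hs_scale_right: "hs N A (\<lambda>i j. complex_of_real c * B i j) = c * hs N A B"
  by (simp add: hs_def sum_distrib_left algebra_simps)

lemma hs_scale_left: "hs N (\<lambda>i j. complex_of_real c * A i j) B = c * hs N A B"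
  by (metis hs_sym hs_scale_right)

lemma hs_sum_left: "hs N (\<lambda>i j. \<Sum>l\<in>S. A l i j) B = (\<Sum>l\<in>S. hs N (A l) B)"
proof -
  have "(\<Sum>l\<in>S. hs N (A l) B) = (\<Sum>i<N. \<Sum>l\<in>S. \<Sum>j<N. Re (cnj (A l i j) * B i j))"
    unfolding hs_def by (rule sum.swap)
  also have "\<dots> = (\<Sum>i<N. \<Sum>j<N. \<Sum>l\<in>S. Re (cnj (A l i j) * B i j))"
    by (intro sum.cong sum.swap refl)
  also have "\<dots> = hs N (\<lambda>i j. \<Sum>l\<in>S. A l i j) B"
    by (simp only: hs_def cnj_sum sum_distrib_right Re_sum)
  finally show ?thesis by simp
qed

lemma hs_am: "2 * hs N A B \<le> hs N A A + hs N B B"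
  using hs_self_nonneg[of N "A - B"] hs_sym[of N A B]
  by (simp add: hs_diff_left hs_diff_right)

lemma hs_diff_square: "hs N (A - B) (A - B) \<le> 2 * (hs N A A + hs N B B)"
  using hs_am[of N A "\<lambda>i j. complex_of_real (-1) * B i j"]
  unfolding hs_scale_left hs_scale_right
  by (simp add: hs_diff_left hs_diff_right hs_sym[of N B A])

lemma hs_mm_left: "hs N (mm N A P) Q = hs N P (mm N (madj A) Q)"
proof -
  have "hs N (mm N A P) Q = (\<Sum>i<N. \<Sum>j<N. \<Sum>k<N. Re (cnj (A i k) * cnj (P k j) * Q i j))"
    by (simp add: hs_def mm_def sum_distrib_right)
  also have "\<dots> = (\<Sum>k<N. \<Sum>j<N. \<Sum>i<N. Re (cnj (A i k) * cnj (P k j) * Q i j))"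
  proof -
    have "(\<Sum>i<N. \<Sum>j<N. \<Sum>k<N. g i j k) = (\<Sum>k<N. \<Sum>j<N. \<Sum>i<N. g i j k)"
      for g :: "nat \<Rightarrow> nat \<Rightarrow> nat \<Rightarrow> real"
    proof -
      have "(\<Sum>i<N. \<Sum>j<N. \<Sum>k<N. g i j k) = (\<Sum>i<N. \<Sum>k<N. \<Sum>j<N. g i j k)"
        by (intro sum.cong sum.swap refl)
      also have "\<dots> = (\<Sum>k<N. \<Sum>i<N. \<Sum>j<N. g i j k)" by (rule sum.swap)
      also have "\<dots> = (\<Sum>k<N. \<Sum>j<N. \<Sum>i<N. g i j k)" by (intro sum.cong sum.swap refl)
      finally show ?thesis .
    qed
    then show ?thesis .
  qed
  also have "\<dots> = hs N P (mm N (madj A) Q)"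
    by (simp add: hs_def mm_def madj_def sum_distrib_left algebra_simps)
  finally show ?thesis .
qed

lemma hs_madj: "hs N (madj A) (madj B) = hs N A B"
  unfolding hs_def madj_def
  by (subst sum.swap) (simp add: algebra_simps)

lemma hs_mm_right: "hs N (mm N P A) Q = hs N P (mm N Q (madj A))"
  by (metis hs_madj hs_mm_left madj_madj madj_mm)

lemma mpow_Suc: "mpow N A (Suc k) = mm N A (mpow N A k)"
  by (simp add: mpow_def)

lemma mpow_add: "msupp N A \<Longrightarrow> mm N (mpow N A j) (mpow N A k) = mpow N A (j + k)"
  by (induction j) (auto simp: mpow_Suc mm_assoc mpow_def mm_one_left msupp_pow[unfolded mpow_def])

lemma madj_pow:
  assumes "msupp N A" "madj A = A"
  shows "madj (mpow N A k) = mpow N A k"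
proof (induction k)
  case (Suc k)
  have "madj (mpow N A (Suc k)) = mm N (mpow N A k) A"
    by (simp add: mpow_Suc madj_mm Suc assms)
  also have "\<dots> = mm N (mpow N A k) (mpow N A 1)"
    using assms by (simp add: mpow_def mm_one_right)
  also have "\<dots> = mpow N A (Suc k)" by (simp add: mpow_add assms)
  finally show ?case .
qed (simp add: mpow_def madj_one)

lemma mpow_mm: "msupp N H \<Longrightarrow> (mm N A ^^ k) H = mm N (mpow N A k) H"
  by (induction k) (auto simp: mpow_def mm_one_left mm_assoc)

lemma mm_pow_right: "msupp N H \<Longrightarrow> msupp N B \<Longrightarrow> ((\<lambda>M. mm N M B) ^^ q) H = mm N H (mpow N B q)"
proof (induction q arbitrary: H)
  case 0
  then show ?case by (simp add: mpow_def mm_one_right)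
next
  case (Suc q)
  have "((\<lambda>M. mm N M B) ^^ Suc q) H = ((\<lambda>M. mm N M B) ^^ q) (mm N H B)"
    using funpow_swap1[of "\<lambda>M. mm N M B" q H] by simp
  then show ?case using Suc by (simp add: msupp_mm mm_assoc mpow_Suc)
qed

lemma hs_pow_split:
  assumes "msupp N A" "madj A = A"
  shows "hs N (mpow N A a) (mpow N A b) = hs N (mone N) (mpow N A (a + b))"
  using hs_mm_left[of N "mpow N A a" "mone N" "mpow N A b"] assms
  by (simp add: mm_one_right msupp_pow madj_pow mpow_add)

text \<open>The factors \<open>A\<close> are changed into \<open>B\<close> one at a time.\<close>

lemma hs_pow_telescope:
  assumes A: "msupp N A" "madj A = A" and B: "msupp N B" "madj B = B"
  shows "hs N G (mpow N A q - mpow N B q)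
    = (\<Sum>j<q. hs N G ((mm N A ^^ j) (((\<lambda>M. mm N M B) ^^ (q - 1 - j)) (A - B))))"
proof (induction q arbitrary: G)
  case 0
  then show ?case by (simp add: mpow_def hs_def)
next
  case (Suc q)
  have "mpow N A (Suc q) - mpow N B (Suc q)
      = mm N A (mpow N A q - mpow N B q) - (mm N (B - A) (mpow N B q))"
    by (intro ext) (simp add: mpow_Suc mm_diff_right mm_diff_left)
  then have "hs N G (mpow N A (Suc q) - mpow N B (Suc q))
      = hs N (mm N A G) (mpow N A q - mpow N B q) + hs N G (mm N (A - B) (mpow N B q))"
    unfolding hs_mm_left[of N A] A(2) by (simp only: hs_diff_right mm_diff_left mm_diff_right)
  also have "\<dots> = (\<Sum>j<q. hs N G ((mm N A ^^ Suc j) (((\<lambda>M. mm N M B) ^^ (q - 1 - j)) (A - B))))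
      + hs N G (((\<lambda>M. mm N M B) ^^ q) (A - B))"
    unfolding Suc using A B by (simp add: hs_mm_left mm_pow_right msupp_diff)
  also have "\<dots> = (\<Sum>j<Suc q. hs N G ((mm N A ^^ j) (((\<lambda>M. mm N M B) ^^ (Suc q - 1 - j)) (A - B))))"
    unfolding sum.lessThan_Suc_shift by simp
  finally show ?case .
qed

text \<open>A noncommutative substitute for the mean value estimate of
  \<open>(a - b) (a^q - b^q)\<close>. For an odd power the \<open>2 * s\<close> remaining factors
  split evenly, so both extreme terms are squared norms.\<close>

lemma hs_odd_pow_diff:
  assumes A: "msupp N A" "madj A = A" and B: "msupp N B" "madj B = B"
  shows "2 * hs N (A - B) (mpow N A (2 * s + 1) - mpow N B (2 * s + 1))
    \<le> (2 * real s + 1) * (hs N (mm N (mpow N A s) (A - B)) (mm N (mpow N A s) (A - B))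
        + hs N (mm N (mpow N B s) (A - B)) (mm N (mpow N B s) (A - B)))"
proof -
  have H: "msupp N (A - B)" "madj (A - B) = A - B" using A B by (auto simp: msupp_diff madj_diff)
  have "2 * hs N (A - B) (mpow N A (2 * s + 1) - mpow N B (2 * s + 1))
      = 2 * (\<Sum>j\<le>2 * s. hs N (A - B) ((mm N A ^^ j) (((\<lambda>M. mm N M B) ^^ (2 * s - j)) (A - B))))"
    using hs_pow_telescope[OF A B, of "A - B" "2 * s + 1"] by (simp add: lessThan_Suc_atMost)
  also have "\<dots> \<le> (2 * real s + 1) * (hs N ((mm N A ^^ s) (A - B)) ((mm N A ^^ s) (A - B))
      + hs N (((\<lambda>M. mm N M B) ^^ s) (A - B)) (((\<lambda>M. mm N M B) ^^ s) (A - B)))"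
    by (rule selfadjoint_commuting_sum[where ip = "hs N" and L = "mm N A" and T = "\<lambda>M. mm N M B"])
      (simp_all add: hs_am hs_mm_left[of N A] hs_mm_right[of N _ B] A B mm_assoc)
  also have "hs N (((\<lambda>M. mm N M B) ^^ s) (A - B)) (((\<lambda>M. mm N M B) ^^ s) (A - B))
      = hs N (mm N (mpow N B s) (A - B)) (mm N (mpow N B s) (A - B))"
    using hs_madj[of N "mm N (A - B) (mpow N B s)" "mm N (A - B) (mpow N B s)"] B H
    by (simp add: mm_pow_right madj_mm madj_pow)
  finally show ?thesis unfolding mpow_mm[OF H(1)] .
qed

section \<open>Trace moments of sums of independent rank-one matrices\<close>

text \<open>Boundedness at every point is stable under sums and products, so all polynomial
  expressions below are integrable over a finite measure without further estimates.\<close>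

definition bmeas :: "'a measure \<Rightarrow> ('a \<Rightarrow> 'b :: {real_normed_field, second_countable_topology}) \<Rightarrow> bool"
  where "bmeas M f \<longleftrightarrow> f \<in> borel_measurable M \<and> (\<exists>B. \<forall>x\<in>space M. norm (f x) \<le> B)"

lemma bmeas_const: "bmeas M (\<lambda>_. c)"
  by (auto simp: bmeas_def)

lemma bmeas_add: 
  assumes "bmeas M f" "bmeas M g"
  shows "bmeas M (\<lambda>x. f x + g x)"
proof -
  from assms obtain B C where "\<And>x. x \<in> space M \<Longrightarrow> norm (f x) \<le> B" "\<And>x. x \<in> space M \<Longrightarrow> norm (g x) \<le> C"
    unfolding bmeas_def by blast
  then have "norm (f x + g x) \<le> B + C" if "x \<in> space M" for x
    using that norm_triangle_le add_mono by blast
  then show ?thesis using assms unfolding bmeas_def by (blast intro: borel_measurable_add)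
qed

lemma bmeas_mult: 
  assumes "bmeas M f" "bmeas M g"
  shows "bmeas M (\<lambda>x. f x * g x)"
proof -
  from assms obtain B C where "\<And>x. x \<in> space M \<Longrightarrow> norm (f x) \<le> B" "\<And>x. x \<in> space M \<Longrightarrow> norm (g x) \<le> C"
    unfolding bmeas_def by blast
  then have "norm (f x * g x) \<le> B * C" if "x \<in> space M" for x
    unfolding norm_mult using that order_trans[OF norm_ge_zero] by (intro mult_mono) auto
  then show ?thesis using assms unfolding bmeas_def by (blast intro: borel_measurable_times)
qed

lemma bmeas_uminus: "bmeas M f \<Longrightarrow> bmeas M (\<lambda>x. - f x)"
  using bmeas_mult[of M "\<lambda>_. -1" f] bmeas_const[of M "-1"] by simp

lemma bmeas_diff: "bmeas M f \<Longrightarrow> bmeas M g \<Longrightarrow> bmeas M (\<lambda>x. f x - g x)"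
  using bmeas_add[of M f "\<lambda>x. - g x"] bmeas_uminus[of M g] by simp

lemma bmeas_sum: "(\<And>i. i \<in> S \<Longrightarrow> bmeas M (f i)) \<Longrightarrow> bmeas M (\<lambda>x. \<Sum>i\<in>S. f i x)"
  by (induction S rule: infinite_finite_induct) (auto intro: bmeas_const bmeas_add)

lemma bmeas_cnj: "bmeas M f \<Longrightarrow> bmeas M (\<lambda>x. cnj (f x))"
  unfolding bmeas_def 
  using borel_measurable_continuous_on[of cnj f M] by (auto intro: continuous_on_cnj continuous_on_id)

lemma bmeas_Re: 
  assumes "bmeas M f" shows "bmeas M (\<lambda>x. Re (f x))"
proof -
  from assms obtain B where "\<And>x. x \<in> space M \<Longrightarrow> norm (f x) \<le> B"
    unfolding bmeas_def by blast
  then have "norm (Re (f x)) \<le> B" if "x \<in> space M" for x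
    using that abs_Re_le_cmod[of "f x"] by fastforce
  then show ?thesis using assms measurable_compose[OF _ borel_measurable_Re, of f M]
    unfolding bmeas_def by blast
qed

lemma (in finite_measure) bmeas_integrable:
  fixes f :: "'a \<Rightarrow> 'b :: {real_normed_field, banach, second_countable_topology}"
  assumes "bmeas M f"
  shows "integrable M f"
proof -
  from assms obtain B where B: "f \<in> borel_measurable M" "\<And>x. x \<in> space M \<Longrightarrow> norm (f x) \<le> B"
    unfolding bmeas_def by blast
  then have "AE x in M. norm (f x) \<le> B" by (intro AE_I2) auto
  then show ?thesis using B(1) by (rule integrable_const_bound)
qed

lemma integral_hs:
  assumes "\<And>i j. integrable M (\<lambda>x. cnj (A x i j) * B x i j)"
  shows "(\<integral>x. hs N (A x) (B x) \<partial>M) = (\<Sum>i<N. \<Sum>j<N. Re (\<integral>x. cnj (A x i j) * B x i j \<partial>M))"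
  unfolding hs_def
  by (simp only: Bochner_Integration.integral_sum Bochner_Integration.integrable_sum
      integral_Re integrable_Re assms)

lemma bmeas_hs:
  assumes "\<And>i j. bmeas M (\<lambda>x. A x i j)" "\<And>i j. bmeas M (\<lambda>x. B x i j)"
  shows "bmeas M (\<lambda>x. hs N (A x) (B x))"
  unfolding hs_def by (intro bmeas_sum bmeas_Re bmeas_mult bmeas_cnj assms)

lemma bmeas_mm:
  assumes "\<And>i j. bmeas M (\<lambda>x. A x i j)" "\<And>i j. bmeas M (\<lambda>x. B x i j)"
  shows "bmeas M (\<lambda>x. mm N (A x) (B x) i j)"
  unfolding mm_def by (intro bmeas_sum bmeas_mult assms)

lemma bmeas_mpow:
  assumes "\<And>i j. bmeas M (\<lambda>x. A x i j)"
  shows "bmeas M (\<lambda>x. mpow N (A x) k i j)"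
proof (induction k arbitrary: i j)
  case 0
  then show ?case by (simp add: mpow_def bmeas_const)
next
  case (Suc k)
  then show ?case unfolding mpow_Suc by (intro bmeas_mm assms)
qed

text \<open>An abstraction of a truncated rank-one matrix, with \<open>\<rho>\<close> the squared
  norm of its vector; \<open>Z_square\<close> is the form in which rank one is used. The mean enters
  through inequalities because truncation can make it smaller than the projection:
  \<open>mean_le\<close> says that it is at most the identity, tested against squares.\<close>

locale rank_one_sample = prob_space M
  for M :: "'a measure" +
  fixes N n :: nat and Z :: "'a \<Rightarrow> nat \<Rightarrow> nat \<Rightarrow> complex" and \<rho> :: "'a \<Rightarrow> real" and R D :: real
  assumes Z_bmeas: "\<And>i j. bmeas M (\<lambda>x. Z x i j)"
    and Z_supp: "\<And>x. msupp N (Z x)" and Z_adj: "\<And>x. madj (Z x) = Z x"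
    and Z_square: "\<And>x. mm N (Z x) (Z x) = (\<lambda>i j. complex_of_real (\<rho> x) * Z x i j)"
    and Z_zero: "\<And>x. \<rho> x = 0 \<Longrightarrow> Z x = (\<lambda>i j. 0)"
    and \<rho>_range: "\<And>x. 0 \<le> \<rho> x" "\<And>x. \<rho> x \<le> R"
    and mean_le: "\<And>A. msupp N A \<Longrightarrow> madj A = A \<Longrightarrow> hs N (\<lambda>i j. \<integral>x. Z x i j \<partial>M) (mm N A A) \<le> hs N A A"
    and mean_trace: "hs N (\<lambda>i j. \<integral>x. Z x i j \<partial>M) (mone N) \<le> D"
begin

definition mean_Z :: "nat \<Rightarrow> nat \<Rightarrow> complex"
  where "mean_Z = (\<lambda>i j. \<integral>x. Z x i j \<partial>M)"

definition X :: "(nat \<Rightarrow> 'a) \<Rightarrow> nat \<Rightarrow> nat \<Rightarrow> complex"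
  where "X t = (\<lambda>i j. (\<Sum>l<n. Z (t l) i j) - of_nat n * mean_Z i j)"

text \<open>Coordinate \<open>n\<close> is a spare sample; \<open>sw l\<close> resamples coordinate \<open>l\<close> by exchanging it with the spare.\<close>

abbreviation Q :: "(nat \<Rightarrow> 'a) measure"
  where "Q \<equiv> Pi\<^sub>M {..n} (\<lambda>_. M)"

definition resample :: "nat \<Rightarrow> (nat \<Rightarrow> 'a) \<Rightarrow> nat \<Rightarrow> 'a"
  where "resample l t = (\<lambda>i\<in>{..n}. t (Transposition.transpose l n i))"

lemma prob_space_Q: "prob_space Q"
  by (intro prob_space_PiM prob_space_axioms)

lemma bmeas_Z: "l \<le> n \<Longrightarrow> bmeas Q (\<lambda>t. Z (t l) i j)"
  using Z_bmeas[of i j] unfolding bmeas_def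
  by (auto simp: space_PiM PiE_def Pi_def intro!: measurable_compose[OF measurable_component_singleton])

lemma bmeas_X: "bmeas Q (\<lambda>t. X t i j)"
  unfolding X_def by (intro bmeas_diff bmeas_sum bmeas_Z bmeas_const) auto

lemma resample_measurable: "resample l \<in> measurable Q Q" if "l < n"
  unfolding resample_def using that
  by (intro measurable_restrict measurable_component_singleton) (auto simp: Transposition.transpose_def)

lemma resample_space: "l < n \<Longrightarrow> t \<in> space Q \<Longrightarrow> resample l t \<in> space Q"
  using measurable_space[OF resample_measurable] .

lemma bmeas_resample:
  assumes "l < n" "bmeas Q f"
  shows "bmeas Q (\<lambda>t. f (resample l t))"
  using assms measurable_compose[OF resample_measurable[OF assms(1)], of f borel]
  unfolding bmeas_def by (auto intro: resample_space)

lemma integral_resample: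
  fixes f :: "(nat \<Rightarrow> 'a) \<Rightarrow> real"
  assumes "l < n" "bmeas Q f"
  shows "(\<integral>t. f (resample l t) \<partial>Q) = (\<integral>t. f t \<partial>Q)"
proof -
  have "distr Q Q (resample l) = Q"
    unfolding resample_def
  proof (rule distr_PiM_reindex)
    show "inj_on (Transposition.transpose l n) {..n}"
      by (rule inj_on_inverseI[of _ "Transposition.transpose l n"]) simp
    show "Transposition.transpose l n \<in> {..n} \<rightarrow> {..n}"
      using assms(1) by (simp add: Transposition.transpose_def)
  qed (rule prob_space_axioms)
  then show ?thesis
    using integral_distr[OF resample_measurable[OF assms(1)], of f] assms(2) by (auto simp: bmeas_def)
qed

lemma resample_simps:
  assumes "l < n"
  shows "resample l t l = t n" "resample l t n = t l"
  using assms by (auto simp: resample_def)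

lemma X_resample:
  assumes "l < n"
  shows "X t - X (resample l t) = Z (t l) - Z (t n)"
proof (intro ext)
  fix i j
  have "(\<Sum>k<n. Z (resample l t k) i j) = Z (t n) i j + (\<Sum>k\<in>{..<n} - {l}. Z (resample l t k) i j)"
    using assms by (subst sum.remove[of _ l]) (simp_all add: resample_simps)
  also have "(\<Sum>k\<in>{..<n} - {l}. Z (resample l t k) i j) = (\<Sum>k\<in>{..<n} - {l}. Z (t k) i j)"
    by (intro sum.cong) (auto simp: resample_def Transposition.transpose_def)
  finally have resample_sum: "(\<Sum>k<n. Z (resample l t k) i j) = Z (t n) i j + (\<Sum>k\<in>{..<n} - {l}. Z (t k) i j)" .
  have t_sum: "(\<Sum>k<n. Z (t k) i j) = Z (t l) i j + (\<Sum>k\<in>{..<n} - {l}. Z (t k) i j)"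
    using assms by (subst sum.remove[of _ l]) simp_all
  show "(X t - X (resample l t)) i j = (Z (t l) - Z (t n)) i j"
    unfolding X_def minus_apply resample_sum t_sum by simp
qed

lemma mean_Z_supp: "msupp N mean_Z"
  using Z_supp by (auto simp: mean_Z_def msupp_def)

lemma mean_Z_adj: "madj mean_Z = mean_Z"
proof (intro ext)
  fix i j
  have "cnj (Z x j i) = Z x i j" for x
    using Z_adj[of x] by (metis madj_def)
  then have "(\<integral>x. cnj (Z x j i) \<partial>M) = mean_Z i j" by (simp add: mean_Z_def)
  then show "madj mean_Z i j = mean_Z i j"
    unfolding mean_Z_def madj_def by simp
qed

lemma X_supp: "msupp N (X t)"
  using Z_supp mean_Z_supp by (auto simp: X_def msupp_def)

lemma X_adj: "madj (X t) = X t"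
proof (intro ext)
  fix i j
  have "cnj (Z x j i) = Z x i j" for x using Z_adj[of x] by (metis madj_def)
  moreover have "cnj (mean_Z j i) = mean_Z i j" using mean_Z_adj by (metis madj_def)
  ultimately show "madj (X t) i j = X t i j"
    by (simp add: X_def madj_def)
qed

section \<open>The exchangeable pair\<close>

lemma integral_indep:
  fixes f :: "'a \<Rightarrow> complex" and g :: "(nat \<Rightarrow> 'a) \<Rightarrow> complex"
  assumes f: "bmeas M f" and g: "bmeas Q g" and g_upd: "\<And>t y. g (t(n := y)) = g t"
  shows "(\<integral>t. f (t n) * g t \<partial>Q) = (\<integral>x. f x \<partial>M) * (\<integral>t. g t \<partial>Q)"
proof -
  interpret Q: prob_space Q by (rule prob_space_Q)
  interpret P: product_sigma_finite "\<lambda>_::nat. M" by standard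
  have fn: "bmeas Q (\<lambda>t. f (t n))"
    using f unfolding bmeas_def
    by (auto simp: space_PiM PiE_def Pi_def intro!: measurable_compose[OF measurable_component_singleton])
  have ins: "{..n} = insert n {..<n}" by auto
  have "(\<integral>t. h (t n) * g t \<partial>Q) = (\<integral>x. h x \<partial>M) * (\<integral>t. g t \<partial>Pi\<^sub>M {..<n} (\<lambda>_. M))"
    if "bmeas Q (\<lambda>t. h (t n))" for h :: "'a \<Rightarrow> complex"
  proof -
    have "integrable Q (\<lambda>t. h (t n) * g t)"
      by (intro Q.bmeas_integrable bmeas_mult that g)
    then have "(\<integral>t. h (t n) * g t \<partial>Q) = (\<integral>t. (\<integral>y. h y * g t \<partial>M) \<partial>Pi\<^sub>M {..<n} (\<lambda>_. M))"
      unfolding ins by (subst P.product_integral_insert) (auto simp: g_upd)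
    also have "\<dots> = (\<integral>t. (\<integral>y. h y \<partial>M) * g t \<partial>Pi\<^sub>M {..<n} (\<lambda>_. M))" by simp
    also have "\<dots> = (\<integral>x. h x \<partial>M) * (\<integral>t. g t \<partial>Pi\<^sub>M {..<n} (\<lambda>_. M))"
      by (rule integral_mult_right_zero)
    finally show ?thesis .
  qed
  \<comment> \<open>The instance with the constant 1 identifies the integral of \<open>g\<close>
    over the first \<open>n\<close> coordinates with its integral over \<open>Q\<close>.\<close>
  from this[OF fn] this[of "\<lambda>_. 1"] show ?thesis by (simp add: bmeas_const prob_space)
qed

text \<open>Applied to powers of \<open>X\<close>, which do not involve the spare sample: the spare
  acts as an independent copy and may be averaged out.\<close>

lemma integral_hs_spare:
  assumes "\<And>i j. bmeas Q (\<lambda>t. G t i j)" "\<And>t y. G (t(n := y)) = G t"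
  shows "(\<integral>t. hs N (Z (t n)) (G t) \<partial>Q) = (\<integral>t. hs N mean_Z (G t) \<partial>Q)"
proof -
  interpret Q: prob_space Q by (rule prob_space_Q)
  have int: "integrable Q (\<lambda>t. cnj (Z (t n) i j) * G t i j)" for i j
    by (rule Q.bmeas_integrable[OF bmeas_mult[OF bmeas_cnj[OF bmeas_Z] assms(1)]]) simp
  have int2: "integrable Q (\<lambda>t. cnj (mean_Z i j) * G t i j)" for i j
    by (rule Q.bmeas_integrable[OF bmeas_mult[OF bmeas_cnj[OF bmeas_const] assms(1)]])
  have "(\<integral>t. cnj (Z (t n) i j) * G t i j \<partial>Q) = (\<integral>t. cnj (mean_Z i j) * G t i j \<partial>Q)" for i j
    using integral_indep[of "\<lambda>x. cnj (Z x i j)" "\<lambda>t. G t i j", OF bmeas_cnj[OF Z_bmeas] assms(1)]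
    by (simp add: assms(2) mean_Z_def)
  then show ?thesis by (simp only: integral_hs int int2)
qed

lemma mpow_X_bmeas: "bmeas Q (\<lambda>t. mpow N (X t) q i j)"
  by (rule bmeas_mpow[OF bmeas_X])

lemma X_upd: "X (t(n := y)) = X t"
  by (simp add: X_def)

text \<open>The exchange preserves the law and reverses the sign of
  \<open>Z (t l) - Z (t n)\<close>. It turns one summand of an even trace moment into a difference
  of powers, to which \<open>hs_odd_pow_diff\<close> applies.\<close>

lemma resample_identity:
  assumes l: "l < n"
  shows "2 * (\<integral>t. hs N (Z (t l) - mean_Z) (mpow N (X t) q) \<partial>Q)
    = (\<integral>t. hs N (Z (t l) - Z (t n)) (mpow N (X t) q - mpow N (X (resample l t)) q) \<partial>Q)"
proof -
  interpret Q: prob_space Q by (rule prob_space_Q)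
  define g where "g k t = hs N (Z (t k)) (mpow N (X t) q)" for k t
  define e where "e t = hs N mean_Z (mpow N (X t) q)" for t
  have g: "bmeas Q (g k)" if "k \<le> n" for k
    unfolding g_def by (rule bmeas_hs[OF bmeas_Z[OF that] mpow_X_bmeas])
  have e: "bmeas Q e" unfolding e_def by (rule bmeas_hs[OF bmeas_const mpow_X_bmeas])
  have ln: "l \<le> n" using l by simp
  note bm = g[OF ln] g[OF order_refl] e bmeas_resample[OF l g[OF ln]] bmeas_resample[OF l g[OF order_refl]]
  note int = bm[THEN Q.bmeas_integrable]
  have spare: "(\<integral>t. g n t \<partial>Q) = (\<integral>t. e t \<partial>Q)"
    unfolding g_def e_def by (rule integral_hs_spare[OF mpow_X_bmeas]) (simp add: X_upd)
  have "hs N (Z (t l) - Z (t n)) (mpow N (X t) q - mpow N (X (resample l t)) q)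
      = g l t - g n (resample l t) - g n t + g l (resample l t)" for t
    unfolding g_def resample_simps[OF l] by (simp only: hs_diff_left hs_diff_right)
  then have "(\<integral>t. hs N (Z (t l) - Z (t n)) (mpow N (X t) q - mpow N (X (resample l t)) q) \<partial>Q)
      = (\<integral>t. g l t - g n (resample l t) - g n t + g l (resample l t) \<partial>Q)" by (simp only:)
  also have "\<dots> = (\<integral>t. g l t \<partial>Q) - (\<integral>t. g n (resample l t) \<partial>Q) - (\<integral>t. g n t \<partial>Q) + (\<integral>t. g l (resample l t) \<partial>Q)"
    using int by simp
  \<comment> \<open>Invariance under the exchange pairs the four integrals; the two with the spare
    sample equal the integral against \<open>mean_Z\<close>.\<close>
  also have "\<dots> = 2 * ((\<integral>t. g l t \<partial>Q) - (\<integral>t. e t \<partial>Q))"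
    using integral_resample[OF l g[OF ln]] integral_resample[OF l g[OF order_refl]] spare by simp
  also have "(\<integral>t. g l t \<partial>Q) - (\<integral>t. e t \<partial>Q) = (\<integral>t. g l t - e t \<partial>Q)"
    using int by simp
  also have "\<dots> = (\<integral>t. hs N (Z (t l) - mean_Z) (mpow N (X t) q) \<partial>Q)"
    by (simp only: g_def e_def hs_diff_left)
  finally show ?thesis by (rule sym)
qed

lemma hs_pow_Z:
  assumes "msupp N A" "madj A = A"
  shows "hs N (mm N (mpow N A s) (Z x)) (mm N (mpow N A s) (Z x)) = \<rho> x * hs N (Z x) (mpow N A (2 * s))"
proof -
  have "hs N (mm N (mpow N A s) (Z x)) (mm N (mpow N A s) (Z x))
      = hs N (Z x) (mm N (mpow N A (s + s)) (Z x))"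
    by (simp add: hs_mm_left madj_pow[OF assms] mpow_add[OF assms(1)] flip: mm_assoc)
  also have "\<dots> = hs N (mm N (Z x) (Z x)) (mpow N A (s + s))"
    by (simp add: hs_mm_right Z_adj)
  also have "\<dots> = \<rho> x * hs N (Z x) (mpow N A (2 * s))"
    unfolding Z_square hs_scale_left mult_2 ..
  finally show ?thesis .
qed

text \<open>The squared norm is \<open>\<rho> x\<close> times a trace, so this trace is nonnegative
  once \<open>\<rho> x\<close> is positive, and \<open>\<rho> x\<close> may be raised to
  \<open>R\<close>. For \<open>\<rho> x = 0\<close> the sign of the trace is not visible this way
  and \<open>Z_zero\<close> takes over.\<close>

lemma hs_pow_Z_le:
  assumes "msupp N A" "madj A = A"
  shows "hs N (mm N (mpow N A s) (Z x)) (mm N (mpow N A s) (Z x)) \<le> R * hs N (Z x) (mpow N A (2 * s))"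
proof (cases "\<rho> x = 0")
  case True
  then show ?thesis using hs_pow_Z[OF assms, of s x] Z_zero[of x] by (simp add: hs_def)
next
  case False
  have "0 \<le> \<rho> x * hs N (Z x) (mpow N A (2 * s))"
    using hs_self_nonneg hs_pow_Z[OF assms, of s x] by metis
  then have "0 \<le> hs N (Z x) (mpow N A (2 * s))"
    using False \<rho>_range(1)[of x] by (simp add: zero_le_mult_iff)
  then show ?thesis
    unfolding hs_pow_Z[OF assms] using \<rho>_range(2) by (rule mult_right_mono[rotated])
qed

lemma hs_pow_Z_diff_le:
  assumes "msupp N A" "madj A = A"
  shows "hs N (mm N (mpow N A s) (Z x - Z y)) (mm N (mpow N A s) (Z x - Z y))
    \<le> 2 * R * (hs N (Z x) (mpow N A (2 * s)) + hs N (Z y) (mpow N A (2 * s)))"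
proof -
  have "hs N (mm N (mpow N A s) (Z x - Z y)) (mm N (mpow N A s) (Z x - Z y))
      \<le> 2 * (hs N (mm N (mpow N A s) (Z x)) (mm N (mpow N A s) (Z x))
        + hs N (mm N (mpow N A s) (Z y)) (mm N (mpow N A s) (Z y)))"
    unfolding mm_diff_right by (rule hs_diff_square)
  also have "\<dots> \<le> 2 * (R * hs N (Z x) (mpow N A (2 * s)) + R * hs N (Z y) (mpow N A (2 * s)))"
    by (intro mult_left_mono add_mono hs_pow_Z_le assms) simp
  finally show ?thesis by (simp only: distrib_left mult.assoc)
qed

text \<open>Both extreme terms of \<open>hs_odd_pow_diff\<close> contain the increment
  \<open>Z (t l) - Z (t n)\<close> twice; \<open>hs_pow_Z_diff_le\<close> trades one of the two for
  a factor \<open>R\<close>. The four resulting traces reduce to two after integration, again by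
  invariance.\<close>

lemma resample_bound:
  assumes l: "l < n"
  shows "(\<integral>t. hs N (Z (t l) - mean_Z) (mpow N (X t) (2 * s + 1)) \<partial>Q)
    \<le> (2 * real s + 1) * R * (\<integral>t. hs N (Z (t l)) (mpow N (X t) (2 * s)) + hs N mean_Z (mpow N (X t) (2 * s)) \<partial>Q)"
proof -
  interpret Q: prob_space Q by (rule prob_space_Q)
  define g where "g k t = hs N (Z (t k)) (mpow N (X t) (2 * s))" for k t
  define e where "e t = hs N mean_Z (mpow N (X t) (2 * s))" for t
  have g: "bmeas Q (g k)" if "k \<le> n" for k
    unfolding g_def by (rule bmeas_hs[OF bmeas_Z[OF that] mpow_X_bmeas])
  have e: "bmeas Q e" unfolding e_def by (rule bmeas_hs[OF bmeas_const mpow_X_bmeas])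
  have ln: "l \<le> n" using l by simp
  note bm = g[OF ln] g[OF order_refl] e bmeas_resample[OF l g[OF ln]] bmeas_resample[OF l g[OF order_refl]]
  note int = bm[THEN Q.bmeas_integrable]
  have spare: "(\<integral>t. g n t \<partial>Q) = (\<integral>t. e t \<partial>Q)"
    unfolding g_def e_def by (rule integral_hs_spare[OF mpow_X_bmeas]) (simp add: X_upd)
  define h where "h t = hs N (Z (t l) - Z (t n)) (mpow N (X t) (2 * s + 1) - mpow N (X (resample l t)) (2 * s + 1))" for t
  define G where "G t = g l t + g n t + g n (resample l t) + g l (resample l t)" for t
  have hG: "h t \<le> (2 * real s + 1) * R * G t" for t
  proof -
    have "2 * h t \<le> (2 * real s + 1) * (hs N (mm N (mpow N (X t) s) (Z (t l) - Z (t n))) (mm N (mpow N (X t) s) (Z (t l) - Z (t n)))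
        + hs N (mm N (mpow N (X (resample l t)) s) (Z (t l) - Z (t n))) (mm N (mpow N (X (resample l t)) s) (Z (t l) - Z (t n))))"
      unfolding h_def using hs_odd_pow_diff[OF X_supp X_adj X_supp X_adj, of t "resample l t" s]
      unfolding X_resample[OF l] .
    also have "\<dots> \<le> (2 * real s + 1) * (2 * R * (g l t + g n t) + 2 * R * (g n (resample l t) + g l (resample l t)))"
      unfolding g_def resample_simps[OF l]
      by (intro mult_left_mono add_mono hs_pow_Z_diff_le X_supp X_adj) simp
    finally show ?thesis by (simp add: G_def algebra_simps)
  qed
  have h: "bmeas Q h"
  proof -
    have "h t = hs N (Z (t l)) (mpow N (X t) (2 * s + 1)) - hs N (Z (t n)) (mpow N (X t) (2 * s + 1))
       - hs N (Z (resample l t n)) (mpow N (X (resample l t)) (2 * s + 1)) + hs N (Z (resample l t l)) (mpow N (X (resample l t)) (2 * s + 1))" for t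
      unfolding h_def resample_simps[OF l] by (simp only: hs_diff_left hs_diff_right)
    then have "h = (\<lambda>t. hs N (Z (t l)) (mpow N (X t) (2 * s + 1)) - hs N (Z (t n)) (mpow N (X t) (2 * s + 1))
       - hs N (Z (resample l t n)) (mpow N (X (resample l t)) (2 * s + 1)) + hs N (Z (resample l t l)) (mpow N (X (resample l t)) (2 * s + 1)))"
      by (rule ext)
    moreover have "bmeas Q (\<lambda>t. hs N (Z (t k)) (mpow N (X t) (2 * s + 1)))" if "k \<le> n" for k
      by (rule bmeas_hs[OF bmeas_Z[OF that] mpow_X_bmeas])
    note b = this
    ultimately show ?thesis
      using b[OF ln] b[OF order_refl] bmeas_resample[OF l b[OF ln]] bmeas_resample[OF l b[OF order_refl]]
      by (simp only: bmeas_add bmeas_diff)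
  qed
  have Gm: "bmeas Q G" unfolding G_def using bm by (simp only: bmeas_add)
  define I where "I = (\<integral>t. hs N (Z (t l) - mean_Z) (mpow N (X t) (2 * s + 1)) \<partial>Q)"
  have "2 * I = (\<integral>t. h t \<partial>Q)"
    unfolding h_def I_def by (rule resample_identity[OF l])
  also have "\<dots> \<le> (\<integral>t. (2 * real s + 1) * R * G t \<partial>Q)"
    using h Gm hG by (intro integral_mono Q.bmeas_integrable bmeas_mult bmeas_const) auto
  also have "\<dots> = (2 * real s + 1) * R * (\<integral>t. G t \<partial>Q)" by simp
  also have "(\<integral>t. G t \<partial>Q) = (\<integral>t. g l t \<partial>Q) + (\<integral>t. g n t \<partial>Q) + (\<integral>t. g n (resample l t) \<partial>Q) + (\<integral>t. g l (resample l t) \<partial>Q)"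
    unfolding G_def using int by simp
  also have "\<dots> = 2 * ((\<integral>t. g l t \<partial>Q) + (\<integral>t. e t \<partial>Q))"
    using integral_resample[OF l g[OF ln]] integral_resample[OF l g[OF order_refl]] spare by simp
  also have "(\<integral>t. g l t \<partial>Q) + (\<integral>t. e t \<partial>Q) = (\<integral>t. g l t + e t \<partial>Q)"
    using int by simp
  finally have "I \<le> (2 * real s + 1) * R * (\<integral>t. g l t + e t \<partial>Q)" by simp
  then show ?thesis by (simp only: I_def g_def e_def)
qed

text \<open>The expected trace of the \<open>2 * k\<close>-th power of the Hermitian matrix
  \<open>X t\<close>.\<close>

definition moment :: "nat \<Rightarrow> real"
  where "moment k = (\<integral>t. hs N (mpow N (X t) k) (mpow N (X t) k) \<partial>Q)"

text \<open>Since \<open>X\<close> is the centred sum, summing the traces against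
  \<open>Z (t l)\<close> over \<open>l\<close> gives the trace against \<open>X\<close> plus
  \<open>n\<close> times the trace against the mean.\<close>

lemma moment_Suc_le:
  "moment (Suc s) \<le> (2 * real s + 1) * R *
     ((\<integral>t. hs N (X t) (mpow N (X t) (2 * s)) \<partial>Q) + 2 * real n * (\<integral>t. hs N mean_Z (mpow N (X t) (2 * s)) \<partial>Q))"
proof -
  interpret Q: prob_space Q by (rule prob_space_Q)
  have X_sum: "hs N (X t) B = (\<Sum>l<n. hs N (Z (t l) - mean_Z) B)" for t B
  proof -
    have "X t = (\<lambda>i j. \<Sum>l<n. (Z (t l) - mean_Z) i j)" by (intro ext) (simp add: X_def sum_subtractf)
    then show ?thesis by (simp only: hs_sum_left)
  qed
  have bZ: "integrable Q (\<lambda>t. hs N (Z (t l)) (mpow N (X t) q))" if "l < n" for l q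
    using that by (intro Q.bmeas_integrable bmeas_hs[OF bmeas_Z mpow_X_bmeas]) simp
  have bE: "integrable Q (\<lambda>t. hs N mean_Z (mpow N (X t) q))" for q
    by (intro Q.bmeas_integrable bmeas_hs[OF bmeas_const mpow_X_bmeas])
  have "hs N (mpow N (X t) (Suc s)) (mpow N (X t) (Suc s)) = hs N (X t) (mpow N (X t) (2 * s + 1))" for t
  proof -
    have "X t = mpow N (X t) 1" by (simp add: mpow_def mm_one_right X_supp)
    then have "hs N (X t) (mpow N (X t) (2 * s + 1)) = hs N (mone N) (mpow N (X t) (1 + (2 * s + 1)))"
      using hs_pow_split[OF X_supp X_adj, of t 1 "2 * s + 1"] by simp
    then show ?thesis
      using hs_pow_split[OF X_supp X_adj, of t "Suc s" "Suc s"] by (simp add: mult_2)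
  qed
  then have "moment (Suc s) = (\<integral>t. (\<Sum>l<n. hs N (Z (t l) - mean_Z) (mpow N (X t) (2 * s + 1))) \<partial>Q)"
    unfolding moment_def by (simp only: X_sum)
  also have "\<dots> = (\<Sum>l<n. \<integral>t. hs N (Z (t l) - mean_Z) (mpow N (X t) (2 * s + 1)) \<partial>Q)"
    by (intro Bochner_Integration.integral_sum) (auto simp: hs_diff_left bE bZ simp del: minus_apply)
  also have "\<dots> \<le> (\<Sum>l<n. (2 * real s + 1) * R * (\<integral>t. hs N (Z (t l)) (mpow N (X t) (2 * s)) + hs N mean_Z (mpow N (X t) (2 * s)) \<partial>Q))"
    by (intro sum_mono resample_bound) simp
  also have "\<dots> = (2 * real s + 1) * R * (\<Sum>l<n. (\<integral>t. hs N (Z (t l)) (mpow N (X t) (2 * s)) + hs N mean_Z (mpow N (X t) (2 * s)) \<partial>Q))"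
    by (rule sum_distrib_left[symmetric])
  also have "(\<Sum>l<n. (\<integral>t. hs N (Z (t l)) (mpow N (X t) (2 * s)) + hs N mean_Z (mpow N (X t) (2 * s)) \<partial>Q))
      = (\<integral>t. (\<Sum>l<n. hs N (Z (t l)) (mpow N (X t) (2 * s)) + hs N mean_Z (mpow N (X t) (2 * s))) \<partial>Q)"
    by (intro Bochner_Integration.integral_sum[symmetric] Bochner_Integration.integrable_add bE bZ) simp
  also have "\<dots> = (\<integral>t. hs N (X t) (mpow N (X t) (2 * s)) + 2 * real n * hs N mean_Z (mpow N (X t) (2 * s)) \<partial>Q)"
    unfolding X_sum by (simp add: hs_diff_left sum.distrib sum_subtractf algebra_simps del: minus_apply)
  also have "\<dots> = (\<integral>t. hs N (X t) (mpow N (X t) (2 * s)) \<partial>Q) + 2 * real n * (\<integral>t. hs N mean_Z (mpow N (X t) (2 * s)) \<partial>Q)"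
    by (subst Bochner_Integration.integral_add)
      (auto intro!: bE Q.bmeas_integrable bmeas_hs[OF bmeas_X mpow_X_bmeas])
  finally show ?thesis .
qed

lemma R_nonneg: "0 \<le> R"
proof -
  obtain x where "x \<in> space M" using not_empty by blast
  then show ?thesis using \<rho>_range[of x] by linarith
qed

text \<open>Here \<open>mean_trace\<close> enters, so the recursion starts from the dimension of the
  subspace instead of \<open>N\<close>.\<close>

lemma moment_1: "moment 1 \<le> 2 * R * real n * D"
proof -
  interpret Q: prob_space Q by (rule prob_space_Q)
  have one: "mpow N (X t) (2 * 0) = mone N" for t by (simp add: mpow_def)
  \<comment> \<open>For exponent 0 the two powers in the exchange identity coincide.\<close>
  have Z1: "(\<integral>t. hs N (Z (t l) - mean_Z) (mone N) \<partial>Q) = 0" if "l < n" for l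
    using resample_identity[OF that, of 0] by (simp add: mpow_def hs_def)
  have X_sum: "hs N (X t) (mone N) = (\<Sum>l<n. hs N (Z (t l) - mean_Z) (mone N))" for t
  proof -
    have "X t = (\<lambda>i j. \<Sum>l<n. (Z (t l) - mean_Z) i j)" by (intro ext) (simp add: X_def sum_subtractf)
    then show ?thesis by (simp only: hs_sum_left)
  qed
  have "integrable Q (\<lambda>t. hs N (Z (t l)) (mone N) - hs N mean_Z (mone N))" if "l < n" for l
    using that by (intro Q.bmeas_integrable bmeas_diff bmeas_const bmeas_hs[OF bmeas_Z bmeas_const]) simp
  then have "(\<integral>t. hs N (X t) (mone N) \<partial>Q) = (\<Sum>l<n. \<integral>t. hs N (Z (t l) - mean_Z) (mone N) \<partial>Q)"
    unfolding X_sum by (intro Bochner_Integration.integral_sum) (simp only: hs_diff_left lessThan_iff)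
  also have "\<dots> = 0" using Z1 by simp
  finally have X0: "(\<integral>t. hs N (X t) (mone N) \<partial>Q) = 0" .
  have "moment 1 \<le> R * (2 * real n * hs N mean_Z (mone N))"
    using moment_Suc_le[of 0] unfolding one X0 by (simp add: Q.prob_space)
  also have "\<dots> \<le> R * (2 * real n * D)"
    using mean_trace R_nonneg unfolding mean_Z_def by (intro mult_left_mono) auto
  finally show ?thesis by (simp add: algebra_simps)
qed

lemma moment_nonneg: "0 \<le> moment k"
  unfolding moment_def by (intro integral_nonneg_AE AE_I2 hs_self_nonneg)

text \<open>The trace of the odd power \<open>X^(2s+1)\<close> is shared between its two even
  neighbours with weight \<open>n\<close>. The higher one is absorbed on the left because
  \<open>(2 * s + 1) * R \<le> n\<close>. The factor 5 is 1 from this splitting and 4 from the mean,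
  which is at most the identity.\<close>

lemma moment_step:
  assumes "s \<ge> 1" "(2 * real s + 1) * R \<le> real n"
  shows "moment (Suc s) \<le> 5 * (2 * real s + 1) * R * real n * moment s"
proof (cases "n = 0")
  case True
  then have "R = 0" using assms(2) R_nonneg by (simp add: mult_le_0_iff)
  then show ?thesis using moment_Suc_le[of s] by simp
next
  case False
  then have n: "0 < real n" by simp
  interpret Q: prob_space Q by (rule prob_space_Q)
  define u where "u t = hs N (mpow N (X t) s) (mpow N (X t) s)" for t
  define v where "v t = hs N (mpow N (X t) (Suc s)) (mpow N (X t) (Suc s))" for t
  have bu: "integrable Q u" and bv: "integrable Q v" unfolding u_def v_def
    by (intro Q.bmeas_integrable bmeas_hs[OF mpow_X_bmeas mpow_X_bmeas])+
  have mid: "2 * hs N (X t) (mpow N (X t) (2 * s)) \<le> real n * u t + v t / real n" for t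
  proof -
    \<comment> \<open>The arithmetic-geometric inequality is used for the powers \<open>s\<close>
      and \<open>s + 1\<close> scaled by \<open>c\<close> and \<open>1 / c\<close>.\<close>
    define c where "c = sqrt (real n)"
    have c: "0 < c" "c * c = real n" using n by (auto simp: c_def)
    have "X t = mpow N (X t) 1" by (simp add: mpow_def mm_one_right X_supp)
    then have eq: "hs N (X t) (mpow N (X t) (2 * s)) = hs N (mpow N (X t) s) (mpow N (X t) (Suc s))"
      using hs_pow_split[OF X_supp X_adj, of t 1 "2 * s"] hs_pow_split[OF X_supp X_adj, of t s "Suc s"]
      by (simp add: mult_2)
    have "2 * (c * ((1 / c) * hs N (mpow N (X t) s) (mpow N (X t) (Suc s))))
        \<le> c * (c * u t) + (1 / c) * ((1 / c) * v t)"
      using hs_am[of N "\<lambda>i j. complex_of_real c * mpow N (X t) s i j"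
          "\<lambda>i j. complex_of_real (1 / c) * mpow N (X t) (Suc s) i j"]
      unfolding hs_scale_left hs_scale_right u_def v_def .
    also have "c * (c * u t) = real n * u t" by (simp only: c(2) flip: mult.assoc)
    also have "(1 / c) * ((1 / c) * v t) = v t / real n" by (simp flip: c(2))
    finally show ?thesis using c(1) eq by simp
  qed
  have mom: "moment s = (\<integral>t. u t \<partial>Q)" "moment (Suc s) = (\<integral>t. v t \<partial>Q)"
    by (simp_all add: moment_def u_def v_def)
  have bX: "integrable Q (\<lambda>t. hs N (X t) (mpow N (X t) (2 * s)))"
    by (rule Q.bmeas_integrable[OF bmeas_hs[OF bmeas_X mpow_X_bmeas]])
  have "(\<integral>t. 2 * hs N (X t) (mpow N (X t) (2 * s)) \<partial>Q) \<le> (\<integral>t. real n * u t + v t / real n \<partial>Q)"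
  proof (rule integral_mono)
    show "integrable Q (\<lambda>t. 2 * hs N (X t) (mpow N (X t) (2 * s)))"
      using bX by (rule integrable_mult_right)
    show "integrable Q (\<lambda>t. real n * u t + v t / real n)" using bu bv by simp
  qed (rule mid)
  also have "\<dots> = real n * moment s + moment (Suc s) / real n"
    unfolding mom using bu bv by simp
  finally have 1: "2 * (\<integral>t. hs N (X t) (mpow N (X t) (2 * s)) \<partial>Q) \<le> real n * moment s + moment (Suc s) / real n"
    by simp
  have "hs N mean_Z (mpow N (X t) (2 * s)) \<le> u t" for t
    using mean_le[OF msupp_pow[OF X_supp] madj_pow[OF X_supp X_adj], of t s]
    by (simp add: u_def mean_Z_def mpow_add X_supp mult_2)
  then have 2: "(\<integral>t. hs N mean_Z (mpow N (X t) (2 * s)) \<partial>Q) \<le> moment s"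
    unfolding mom using bu
    by (intro integral_mono Q.bmeas_integrable[OF bmeas_hs[OF bmeas_const mpow_X_bmeas]]) auto
  define a where "a = (2 * real s + 1) * R"
  have a: "0 \<le> a" "a \<le> real n" using assms R_nonneg by (auto simp: a_def)
  define I1 where "I1 = (\<integral>t. hs N (X t) (mpow N (X t) (2 * s)) \<partial>Q)"
  define I2 where "I2 = (\<integral>t. hs N mean_Z (mpow N (X t) (2 * s)) \<partial>Q)"
  have "moment (Suc s) \<le> a * (I1 + 2 * real n * I2)"
    using moment_Suc_le[of s] unfolding a_def I1_def I2_def .
  then have "2 * moment (Suc s) \<le> a * (2 * I1 + 4 * real n * I2)" by (simp add: algebra_simps)
  also have "\<dots> \<le> a * (real n * moment s + moment (Suc s) / real n + 4 * real n * moment s)"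
    using 1 2 a(1) unfolding I1_def I2_def by (intro mult_left_mono add_mono) auto
  also have "\<dots> = 5 * a * real n * moment s + (a / real n) * moment (Suc s)" by (simp add: algebra_simps)
  also have "(a / real n) * moment (Suc s) \<le> 1 * moment (Suc s)"
    using a n moment_nonneg[of "Suc s"] by (intro mult_right_mono) (auto simp: divide_simps)
  finally have "moment (Suc s) \<le> 5 * a * real n * moment s" by simp
  then show ?thesis by (simp only: a_def mult.assoc)
qed

text \<open>With \<open>p\<close> fixed, one factor serves for all steps up to \<open>p\<close>:
  there \<open>2 * s + 1 \<le> 2 * p\<close>, so \<open>5 * (2 * s + 1)\<close> is at most
  \<open>10 * p\<close>.\<close>

theorem moment_bound:
  assumes "p \<ge> 1" "2 * real p * R \<le> real n" "0 \<le> D"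
  shows "moment p \<le> D * (10 * real p * R * real n) ^ p"
proof -
  define b where "b = 10 * real p * R * real n"
  have b: "0 \<le> b" using R_nonneg by (simp add: b_def)
  have "moment (Suc k) \<le> D * b ^ Suc k" if "Suc k \<le> p" for k
    using that
  proof (induction k)
    case 0
    have "R * real n * 2 \<le> R * real n * (10 * real p)"
      using assms(1) R_nonneg by (intro mult_left_mono) auto
    then have "2 * (R * real n) * D \<le> b * D"
      unfolding b_def using assms(3) by (intro mult_right_mono) (simp_all add: mult_ac)
    then show ?case using moment_1 by (simp add: algebra_simps)
  next
    case (Suc k)
    have le: "2 * real (Suc k) + 1 \<le> 2 * real p" using Suc.prems by simp
    have "moment (Suc (Suc k)) \<le> 5 * (2 * real (Suc k) + 1) * R * real n * moment (Suc k)"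
      using mult_right_mono[OF le R_nonneg] assms(2) by (intro moment_step) auto
    also have "\<dots> \<le> b * moment (Suc k)"
      unfolding b_def using le R_nonneg moment_nonneg by (intro mult_right_mono) auto
    also have "\<dots> \<le> b * (D * b ^ Suc k)" using Suc b by (intro mult_left_mono) auto
    finally show ?case by (simp add: algebra_simps)
  qed
  from this[of "p - 1"] assms(1) show ?thesis by (simp add: b_def)
qed

end

section \<open>Gram--Schmidt projections\<close>

definition mvec :: "nat \<Rightarrow> (nat \<Rightarrow> nat \<Rightarrow> 'a :: comm_ring_1) \<Rightarrow> (nat \<Rightarrow> 'a) \<Rightarrow> nat \<Rightarrow> 'a"
  where "mvec m A x = (\<lambda>i. \<Sum>j<m. A i j * x j)"

definition ip :: "nat \<Rightarrow> (nat \<Rightarrow> 'a :: conjugatable_field) \<Rightarrow> (nat \<Rightarrow> 'a) \<Rightarrow> 'a"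
  where "ip m x y = (\<Sum>i<m. x i * conjugate (y i))"

definition fspan :: "nat \<Rightarrow> (nat \<Rightarrow> nat \<Rightarrow> 'a :: comm_ring_1) \<Rightarrow> (nat \<Rightarrow> 'a) set"
  where "fspan d c = {\<lambda>i. \<Sum>k<d. a k * c k i | a. True}"

text \<open>\<open>gsp m c d\<close> is the matrix of the orthogonal projection onto the span of \<open>c 0, \<dots>, c (d - 1)\<close>.
  Dependent vectors are allowed: they produce a zero residual, and division by its squared norm
  \<open>0\<close> yields \<open>0\<close>. The explicit recursion makes the projection a Borel function of the vectors.\<close>

definition residual :: "nat \<Rightarrow> (nat \<Rightarrow> nat \<Rightarrow> 'a :: conjugatable_field) \<Rightarrow> (nat \<Rightarrow> 'a) \<Rightarrow> nat \<Rightarrow> 'a"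
  where "residual m P x = (\<lambda>i. x i - mvec m P x i)"

primrec gsp :: "nat \<Rightarrow> (nat \<Rightarrow> nat \<Rightarrow> 'a :: conjugatable_field) \<Rightarrow> nat \<Rightarrow> nat \<Rightarrow> nat \<Rightarrow> 'a" where
  "gsp m c 0 = (\<lambda>i j. 0)"
| "gsp m c (Suc k) = (\<lambda>i j. gsp m c k i j + residual m (gsp m c k) (c k) i *
      conjugate (residual m (gsp m c k) (c k) j) /
      ip m (residual m (gsp m c k) (c k)) (residual m (gsp m c k) (c k)))"

lemma conjugate_diff: "conjugate (a - b) = conjugate a - conjugate (b :: 'a :: conjugatable_ring)"
  using conjugate_dist_add[of a "- b"] by (simp add: conjugate_neg)

lemma conjugate_one: "conjugate (1 :: 'a :: conjugatable_field) = 1"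
proof -
  have "conjugate (1 :: 'a) * conjugate 1 = conjugate 1" by (simp flip: conjugate_dist_mul)
  then show ?thesis by (metis conjugate_zero_iff mult_cancel_left1 zero_neq_one)
qed

lemma conjugate_inverse: "conjugate (inverse a) = inverse (conjugate (a :: 'a :: conjugatable_field))"
proof (cases "a = 0")
  case False
  then have "conjugate (inverse a) * conjugate a = 1"
    by (simp add: conjugate_one flip: conjugate_dist_mul)
  then show ?thesis by (metis inverse_unique mult.commute)
qed simp

lemma conjugate_divide: "conjugate (a / b) = conjugate a / conjugate (b :: 'a :: conjugatable_field)"
  by (simp add: divide_inverse conjugate_dist_mul conjugate_inverse)

lemma ip_conjugate: "conjugate (ip m x y) = ip m y x"
  by (simp add: ip_def sum_conjugate conjugate_dist_mul mult.commute)

lemma ip_diff_left: "ip m (\<lambda>i. x i - y i) z = ip m x z - ip m y z"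
  by (simp add: ip_def left_diff_distrib sum_subtractf)

lemma ip_add_left: "ip m (\<lambda>i. x i + y i) z = ip m x z + ip m y z"
  by (simp add: ip_def distrib_right sum.distrib)

lemma ip_scale_left: "ip m (\<lambda>i. a * x i) z = a * ip m x z"
  by (simp add: ip_def sum_distrib_left mult.assoc)

lemma ip_sum_left: "ip m (\<lambda>i. \<Sum>k\<in>S. x k i) z = (\<Sum>k\<in>S. ip m (x k) z)"
  unfolding ip_def by (simp add: sum_distrib_right sum.swap[of _ S])

lemma ip_diff_right: "ip m z (\<lambda>i. x i - y i) = ip m z x - ip m z y"
  by (simp add: ip_def conjugate_diff right_diff_distrib sum_subtractf)

lemma ip_sum_right: "ip m z (\<lambda>i. \<Sum>k\<in>S. x k i) = (\<Sum>k\<in>S. ip m z (x k))" if "finite S"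
  using that unfolding ip_def by (simp add: sum_conjugate sum_distrib_left sum.swap[of _ S])

lemma ip_scale_right: "ip m z (\<lambda>i. a * x i) = conjugate a * ip m z x"
  by (simp add: ip_def sum_distrib_left conjugate_dist_mul algebra_simps)

lemma ip_self_eq_0_iff:
  fixes x :: "nat \<Rightarrow> 'a :: conjugatable_ordered_field"
  shows "ip m x x = 0 \<longleftrightarrow> (\<forall>i<m. x i = 0)"
  unfolding ip_def using conjugate_square_positive by (subst sum_nonneg_eq_0_iff) auto

lemma mvec_diff: "mvec m A (\<lambda>i. x i - y i) = (\<lambda>i. mvec m A x i - mvec m A y i)"
  by (intro ext) (simp add: mvec_def right_diff_distrib sum_subtractf)

lemma mvec_scale: "mvec m A (\<lambda>i. a * x i) = (\<lambda>i. a * mvec m A x i)"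
  by (intro ext) (simp add: mvec_def sum_distrib_left algebra_simps)

lemma mvec_sum: "mvec m A (\<lambda>i. \<Sum>k\<in>S. x k i) = (\<lambda>i. \<Sum>k\<in>S. mvec m A (x k) i)"
  by (intro ext) (simp add: mvec_def sum_distrib_left sum.swap[of _ S])

lemma mvec_cong: "(\<And>i. i < m \<Longrightarrow> x i = y i) \<Longrightarrow> mvec m A x = mvec m A y"
  by (simp add: mvec_def)

lemma fspan_zero: "(\<lambda>i. 0) \<in> fspan d c"
  by (auto simp: fspan_def intro!: exI[of _ "\<lambda>_. 0"])

lemma fspan_add: "x \<in> fspan d c \<Longrightarrow> y \<in> fspan d c \<Longrightarrow> (\<lambda>i. x i + y i) \<in> fspan d c"
proof -
  assume "x \<in> fspan d c" "y \<in> fspan d c"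
  then obtain a b where "x = (\<lambda>i. \<Sum>k<d. a k * c k i)" "y = (\<lambda>i. \<Sum>k<d. b k * c k i)"
    by (auto simp: fspan_def)
  then show ?thesis
    by (auto simp: fspan_def distrib_right sum.distrib intro!: exI[of _ "\<lambda>k. a k + b k"])
qed

lemma fspan_scale: "x \<in> fspan d c \<Longrightarrow> (\<lambda>i. b * x i) \<in> fspan d c"
proof -
  assume "x \<in> fspan d c"
  then obtain a where "x = (\<lambda>i. \<Sum>k<d. a k * c k i)" by (auto simp: fspan_def)
  then have "(\<lambda>i. b * x i) = (\<lambda>i. \<Sum>k<d. (b * a k) * c k i)"
    by (simp add: sum_distrib_left mult.assoc)
  then show ?thesis unfolding fspan_def mem_Collect_eq by (intro exI[of _ "\<lambda>k. b * a k"]) simp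
qed

lemma fspan_diff: "x \<in> fspan d c \<Longrightarrow> y \<in> fspan d c \<Longrightarrow> (\<lambda>i. x i - y i) \<in> fspan d c"
  using fspan_add[of x d c "\<lambda>i. -1 * y i"] fspan_scale[of y d c "-1"] by simp

lemma fspan_sum: "(\<And>k. k \<in> S \<Longrightarrow> x k \<in> fspan d c) \<Longrightarrow> (\<lambda>i. \<Sum>k\<in>S. x k i) \<in> fspan d c"
  by (induction S rule: infinite_finite_induct) (auto intro: fspan_zero fspan_add)

lemma fspan_mono: "d \<le> e \<Longrightarrow> fspan d c \<subseteq> fspan e c"
proof
  fix x assume "x \<in> fspan d c" and de: "d \<le> e"
  then obtain a where x: "x = (\<lambda>i. \<Sum>k<d. a k * c k i)" by (auto simp: fspan_def)
  have "(\<Sum>k<d. a k * c k i) = (\<Sum>k<e. (if k < d then a k else 0) * c k i)" for i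
    using de by (intro sum.mono_neutral_cong_left) auto
  then show "x \<in> fspan e c" unfolding x fspan_def mem_Collect_eq
    by (intro exI[of _ "\<lambda>k. if k < d then a k else 0"]) simp
qed

lemma fspan_member: "k < d \<Longrightarrow> c k \<in> fspan d c"
  by (auto simp: fspan_def fun_eq_iff if_distrib[of "\<lambda>x. x * _"] intro!: exI[of _ "\<lambda>j. if j = k then 1 else 0"] cong: if_cong)

lemma gsp_hermitian: "conjugate (gsp m c d j i) = gsp m c d i j"
  by (induction d) (auto simp: conjugate_dist_add conjugate_divide conjugate_dist_mul ip_conjugate mult.commute)

lemma ip_mvec:
  assumes "\<And>i j. conjugate (A j i) = A i j"
  shows "ip m (mvec m A x) y = ip m x (mvec m A y)"
proof -
  have "ip m (mvec m A x) y = (\<Sum>i<m. \<Sum>j<m. A i j * x j * conjugate (y i))"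
    by (simp add: ip_def mvec_def sum_distrib_right)
  also have "\<dots> = (\<Sum>j<m. \<Sum>i<m. A i j * x j * conjugate (y i))" by (rule sum.swap)
  also have "\<dots> = ip m x (mvec m A y)"
    by (simp add: ip_def mvec_def sum_conjugate sum_distrib_left conjugate_dist_mul assms algebra_simps)
  finally show ?thesis .
qed

lemma mvec_gsp_Suc:
  "mvec m (gsp m c (Suc k)) x = (\<lambda>i. mvec m (gsp m c k) x i +
    (ip m x (residual m (gsp m c k) (c k)) / ip m (residual m (gsp m c k) (c k)) (residual m (gsp m c k) (c k)))
    * residual m (gsp m c k) (c k) i)"
  by (intro ext)
    (simp add: mvec_def[of m "\<lambda>i j. _ i j + _ i j"] mvec_def[of m "gsp m c k" x] distrib_right sum.distrib ip_def[of m x]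
      sum_distrib_left sum_distrib_right sum_divide_distrib algebra_simps)

lemma mvec_gsp_in_span: "mvec m (gsp m c d) x \<in> fspan d c"
proof (induction d arbitrary: x)
  case 0
  then show ?case by (simp add: mvec_def fspan_zero)
next
  case (Suc d)
  have 1: "mvec m (gsp m c d) y \<in> fspan (Suc d) c" for y
    using Suc fspan_mono[of d "Suc d" c] by auto
  have "residual m (gsp m c d) (c d) \<in> fspan (Suc d) c"
    unfolding residual_def by (intro fspan_diff 1 fspan_member) simp
  then show ?case unfolding mvec_gsp_Suc by (intro fspan_add 1 fspan_scale)
qed

text \<open>The new residual is orthogonal to the earlier span. Adding the projection onto it
  therefore leaves the earlier vectors fixed and supplies exactly the missing part of the new
  one.\<close>

lemma gsp_fixes:
  fixes c :: "nat \<Rightarrow> nat \<Rightarrow> 'a :: conjugatable_ordered_field"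
  assumes "k < d" "i < m"
  shows "mvec m (gsp m c d) (c k) i = c k i"
  using assms
proof (induction d arbitrary: k i)
  case (Suc d)
  define w where "w = residual m (gsp m c d) (c d)"
  have span_fix: "mvec m (gsp m c d) x i = x i" if x: "x \<in> fspan d c" and i: "i < m" for x i
  proof -
    obtain a where "x = (\<lambda>i. \<Sum>k<d. a k * c k i)" using x by (auto simp: fspan_def)
    then show ?thesis using Suc.IH i by (simp add: mvec_sum mvec_scale)
  qed
  have orth: "ip m x w = 0" if x: "x \<in> fspan d c" for x
  proof -
    have "ip m x w = ip m x (c d) - ip m (mvec m (gsp m c d) x) (c d)"
      unfolding w_def residual_def ip_diff_right by (simp add: ip_mvec gsp_hermitian)
    also have "ip m (mvec m (gsp m c d) x) (c d) = ip m x (c d)"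
      unfolding ip_def using span_fix[OF x] by (intro sum.cong) auto
    finally show ?thesis by simp
  qed
  show ?case
  proof (cases "k < d")
    case True
    then show ?thesis
      using Suc orth[OF fspan_member[OF True]] unfolding mvec_gsp_Suc w_def by simp
  next
    case False
    then have k: "k = d" using Suc.prems by simp
    have "ip m (c d) w = ip m (\<lambda>i. w i + mvec m (gsp m c d) (c d) i) w"
      by (simp add: w_def residual_def)
    also have "\<dots> = ip m w w"
      unfolding ip_add_left using orth[OF mvec_gsp_in_span] by simp
    finally have cw: "ip m (c d) w = ip m w w" .
    have ci: "c d i = mvec m (gsp m c d) (c d) i + w i" by (simp add: w_def residual_def)
    show ?thesis
    proof (cases "ip m w w = 0")
      case True
      then have "w i = 0" using Suc.prems by (simp add: ip_self_eq_0_iff)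
      then show ?thesis using True ci unfolding k mvec_gsp_Suc w_def[symmetric] by simp
    next
      case False
      then show ?thesis using cw ci unfolding k mvec_gsp_Suc w_def[symmetric] by simp
    qed
  qed
qed simp

lemma gsp_fixes_span:
  fixes c :: "nat \<Rightarrow> nat \<Rightarrow> 'a :: conjugatable_ordered_field"
  assumes "x \<in> fspan d c" "i < m"
  shows "mvec m (gsp m c d) x i = x i"
proof -
  obtain a where "x = (\<lambda>i. \<Sum>k<d. a k * c k i)" using assms by (auto simp: fspan_def)
  then show ?thesis using assms(2) by (simp add: mvec_sum mvec_scale gsp_fixes)
qed

lemma gsp_residual_orth:
  fixes c :: "nat \<Rightarrow> nat \<Rightarrow> 'a :: conjugatable_ordered_field"
  assumes "y \<in> fspan d c"
  shows "ip m (residual m (gsp m c d) x) y = 0"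
proof -
  have "ip m (mvec m (gsp m c d) x) y = ip m x (mvec m (gsp m c d) y)"
    by (simp add: ip_mvec gsp_hermitian)
  also have "\<dots> = ip m x y"
    unfolding ip_def using gsp_fixes_span[OF assms] by (intro sum.cong) auto
  finally show ?thesis by (simp add: residual_def ip_diff_left)
qed

text \<open>The residuals form an orthogonal family, and \<open>gsp\<close> is the sum of the rank-one projections onto them.\<close>

definition gsv :: "nat \<Rightarrow> (nat \<Rightarrow> nat \<Rightarrow> 'a :: conjugatable_field) \<Rightarrow> nat \<Rightarrow> nat \<Rightarrow> 'a"
  where "gsv m c k = residual m (gsp m c k) (c k)"

lemma gsp_eq_sum: "gsp m c d i j = (\<Sum>k<d. gsv m c k i * conjugate (gsv m c k j) / ip m (gsv m c k) (gsv m c k))"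
  by (induction d) (auto simp: gsv_def)

lemma gsv_in_span: "gsv m c k \<in> fspan (Suc k) c"
  unfolding gsv_def residual_def
  using mvec_gsp_in_span[of m c k] fspan_mono[of k "Suc k" c]
  by (intro fspan_diff fspan_member) auto

lemma gsv_orth:
  fixes c :: "nat \<Rightarrow> nat \<Rightarrow> 'a :: conjugatable_ordered_field"
  assumes "j \<noteq> k"
  shows "ip m (gsv m c j) (gsv m c k) = 0"
proof -
  have less: "ip m (gsv m c a) (gsv m c b) = 0" if "b < a" for a b
    using gsp_residual_orth[of "gsv m c b" a c m "c a"] gsv_in_span[of m c b] fspan_mono[of "Suc b" a c] that
    by (auto simp: gsv_def)
  show ?thesis
  proof (cases "k < j")
    case False
    then have "ip m (gsv m c k) (gsv m c j) = 0" using less assms by simp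
    then show ?thesis by (metis ip_conjugate conjugate_zero)
  qed (rule less)
qed

text \<open>Every projection onto a nonzero residual has trace 1, so dependent vectors only lower
  the trace below \<open>d\<close>.\<close>

lemma gsp_trace:
  fixes c :: "nat \<Rightarrow> nat \<Rightarrow> 'a :: conjugatable_ordered_field"
  shows "(\<Sum>i<m. gsp m c d i i) = of_nat (card {k. k < d \<and> ip m (gsv m c k) (gsv m c k) \<noteq> 0})"
proof -
  have "(\<Sum>i<m. gsp m c d i i) = (\<Sum>k<d. \<Sum>i<m. gsv m c k i * conjugate (gsv m c k i) / ip m (gsv m c k) (gsv m c k))"
    unfolding gsp_eq_sum by (rule sum.swap)
  also have "\<dots> = (\<Sum>k<d. ip m (gsv m c k) (gsv m c k) / ip m (gsv m c k) (gsv m c k))"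
    by (simp only: ip_def sum_divide_distrib[symmetric])
  also have "\<dots> = (\<Sum>k<d. if ip m (gsv m c k) (gsv m c k) \<noteq> 0 then 1 else 0)"
    by (intro sum.cong) auto
  also have "\<dots> = of_nat (card {k. k < d \<and> ip m (gsv m c k) (gsv m c k) \<noteq> 0})"
    by (simp add: sum.If_cases Int_def)
  finally show ?thesis .
qed

section \<open>Affinities under near-isometries\<close>

definition nrm2 :: "nat \<Rightarrow> (nat \<Rightarrow> complex) \<Rightarrow> real"
  where "nrm2 m x = (\<Sum>i<m. (cmod (x i))\<^sup>2)"

lemma nrm2_nonneg: "0 \<le> nrm2 m x"
  by (auto simp: nrm2_def intro: sum_nonneg)

lemma nrm2_cong: "(\<And>i. i < m \<Longrightarrow> x i = y i) \<Longrightarrow> nrm2 m x = nrm2 m y"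
  by (simp add: nrm2_def)

lemma ip_self: "ip m x x = complex_of_real (nrm2 m x)"
  by (simp only: ip_def nrm2_def of_real_sum complex_norm_square conjugate_complex_def)

lemma nrm2_ip: "nrm2 m x = Re (ip m x x)"
  by (simp add: ip_self)

lemma nrm2_eq_0_iff: "nrm2 m x = 0 \<longleftrightarrow> (\<forall>i<m. x i = 0)"
  unfolding nrm2_def by (subst sum_nonneg_eq_0_iff) auto

lemma nrm2_pythagoras:
  assumes "ip m x y = 0"
  shows "nrm2 m (\<lambda>i. x i + y i) = nrm2 m x + nrm2 m y"
proof -
  have "ip m y x = 0" using assms by (metis ip_conjugate conjugate_zero)
  moreover have "ip m z (\<lambda>i. x i + y i) = ip m z x + ip m z y" for z
    by (simp add: ip_def distrib_left sum.distrib)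
  ultimately show ?thesis using assms by (simp add: nrm2_ip ip_add_left)
qed

definition orthonormal :: "nat \<Rightarrow> nat \<Rightarrow> (nat \<Rightarrow> nat \<Rightarrow> complex) \<Rightarrow> bool"
  where "orthonormal m d e \<longleftrightarrow> (\<forall>j<d. \<forall>k<d. ip m (e j) (e k) = (if j = k then 1 else 0))"

lemma orthonormal_nrm2:
  assumes "orthonormal m d e"
  shows "nrm2 m (\<lambda>i. \<Sum>j<d. a j * e j i) = nrm2 d a"
proof -
  have inner: "(\<Sum>k<d. cnj (a k) * ip m (e j) (e k)) = cnj (a j)" if "j < d" for j
  proof -
    have "(\<Sum>k<d. cnj (a k) * ip m (e j) (e k)) = (\<Sum>k<d. if k = j then cnj (a j) else 0)"
      using assms that by (intro sum.cong) (auto simp: orthonormal_def)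
    then show ?thesis using that by simp
  qed
  have "ip m (\<lambda>i. \<Sum>j<d. a j * e j i) (\<lambda>i. \<Sum>j<d. a j * e j i)
      = (\<Sum>j<d. a j * (\<Sum>k<d. cnj (a k) * ip m (e j) (e k)))"
    by (simp add: ip_sum_left ip_sum_right ip_scale_left ip_scale_right)
  also have "\<dots> = (\<Sum>j<d. a j * cnj (a j))" using inner by simp
  also have "\<dots> = complex_of_real (nrm2 d a)" by (simp only: nrm2_def of_real_sum complex_norm_square)
  finally show ?thesis by (simp add: ip_self)
qed

lemma residual_best:
  assumes "y \<in> fspan d c"
  shows "nrm2 m (residual m (gsp m c d) x) \<le> nrm2 m (\<lambda>i. x i - y i)"
proof -
  have "ip m (residual m (gsp m c d) x) (\<lambda>i. mvec m (gsp m c d) x i - y i) = 0"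
    by (intro gsp_residual_orth fspan_diff mvec_gsp_in_span assms)
  from nrm2_pythagoras[OF this]
  show ?thesis using nrm2_nonneg[of m "\<lambda>i. mvec m (gsp m c d) x i - y i"]
    by (simp add: residual_def)
qed

lemma nrm2_residual: "nrm2 m (residual m (gsp m c d) x) = nrm2 m x - Re (ip m (mvec m (gsp m c d) x) x)"
proof -
  have "ip m (residual m (gsp m c d) x) (residual m (gsp m c d) x)
      = ip m (residual m (gsp m c d) x) x - ip m (residual m (gsp m c d) x) (mvec m (gsp m c d) x)"
    by (subst (2) residual_def) (simp add: ip_diff_right)
  also have "\<dots> = ip m x x - ip m (mvec m (gsp m c d) x) x"
    by (simp add: gsp_residual_orth mvec_gsp_in_span) (simp add: residual_def ip_diff_left)
  finally show ?thesis by (simp add: nrm2_ip)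
qed

lemma sum_residual_eq_trace:
  assumes "orthonormal m r e"
  shows "(\<Sum>k<r. nrm2 m (residual m (gsp m c d) (e k)))
    = real r - Re (\<Sum>i<m. \<Sum>j<m. (\<Sum>k<r. e k i * cnj (e k j)) * gsp m c d j i)"
proof -
  have "(\<Sum>i<m. \<Sum>j<m. (\<Sum>k<r. e k i * cnj (e k j)) * gsp m c d j i)
      = (\<Sum>i<m. \<Sum>k<r. \<Sum>j<m. gsp m c d j i * e k i * cnj (e k j))"
  proof (rule sum.cong[OF refl])
    fix i
    have "(\<Sum>j<m. (\<Sum>k<r. e k i * cnj (e k j)) * gsp m c d j i)
        = (\<Sum>j<m. \<Sum>k<r. gsp m c d j i * e k i * cnj (e k j))"
      by (simp add: sum_distrib_left sum_distrib_right mult_ac)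
    also have "\<dots> = (\<Sum>k<r. \<Sum>j<m. gsp m c d j i * e k i * cnj (e k j))" by (rule sum.swap)
    finally show "(\<Sum>j<m. (\<Sum>k<r. e k i * cnj (e k j)) * gsp m c d j i)
        = (\<Sum>k<r. \<Sum>j<m. gsp m c d j i * e k i * cnj (e k j))" .
  qed
  also have "\<dots> = (\<Sum>k<r. \<Sum>i<m. \<Sum>j<m. gsp m c d j i * e k i * cnj (e k j))" by (rule sum.swap)
  also have "\<dots> = (\<Sum>k<r. \<Sum>j<m. \<Sum>i<m. gsp m c d j i * e k i * cnj (e k j))"
    by (intro sum.cong sum.swap refl)
  also have "\<dots> = (\<Sum>k<r. ip m (mvec m (gsp m c d) (e k)) (e k))"
    by (simp add: ip_def mvec_def sum_distrib_right)
  finally have tr: "(\<Sum>i<m. \<Sum>j<m. (\<Sum>k<r. e k i * cnj (e k j)) * gsp m c d j i)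
      = (\<Sum>k<r. ip m (mvec m (gsp m c d) (e k)) (e k))" .
  have "nrm2 m (e k) = 1" if "k < r" for k
    using assms that by (simp add: orthonormal_def nrm2_ip)
  then show ?thesis unfolding tr by (simp add: nrm2_residual sum_subtractf)
qed

text \<open>A matrix and its transpose have the same operator norm, by duality: the squared norm of
  \<open>z\<close> is the pairing of \<open>b\<close> with \<open>w\<close>, where \<open>b\<close>
  is the transpose applied to the conjugate of \<open>z\<close>.\<close>

lemma transpose_bound:
  fixes T :: "nat \<Rightarrow> nat \<Rightarrow> complex"
  assumes c: "0 < c" and T: "\<And>a. nrm2 d (\<lambda>j. \<Sum>k<r. a k * T k j) \<le> c * nrm2 r a"
  shows "nrm2 r (\<lambda>k. \<Sum>j<d. T k j * w j) \<le> c * nrm2 d w"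
proof -
  define z where "z k = (\<Sum>j<d. T k j * w j)" for k
  define b where "b j = (\<Sum>k<r. cnj (z k) * T k j)" for j
  have "complex_of_real (nrm2 r z) = (\<Sum>k<r. cnj (z k) * z k)"
    by (simp only: nrm2_def of_real_sum complex_norm_square mult.commute)
  also have "\<dots> = (\<Sum>k<r. \<Sum>j<d. cnj (z k) * T k j * w j)"
    by (subst (2) z_def) (simp add: sum_distrib_left mult.assoc)
  also have "\<dots> = (\<Sum>j<d. b j * w j)"
    by (subst sum.swap) (simp add: b_def sum_distrib_right)
  finally have z_eq: "nrm2 r z = Re (\<Sum>j<d. b j * w j)" by (metis Re_complex_of_real)
  have "Re (\<Sum>j<d. b j * w j) \<le> (\<Sum>j<d. cmod (b j) * cmod (w j))"
    by (rule order_trans[OF complex_Re_le_cmod])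
      (use norm_sum[of "\<lambda>j. b j * w j" "{..<d}"] in \<open>simp add: norm_mult\<close>)
  also have "\<dots> \<le> (\<Sum>j<d. ((cmod (b j))\<^sup>2 / c + c * (cmod (w j))\<^sup>2) / 2)"
  proof (rule sum_mono)
    fix j
    have "0 \<le> (cmod (b j) - c * cmod (w j))\<^sup>2 / c" using c by simp
    also have "\<dots> = (cmod (b j))\<^sup>2 / c + c * (cmod (w j))\<^sup>2 - 2 * (cmod (b j) * cmod (w j))"
      using c by (simp add: power2_eq_square field_simps)
    finally show "cmod (b j) * cmod (w j) \<le> ((cmod (b j))\<^sup>2 / c + c * (cmod (w j))\<^sup>2) / 2" by simp
  qed
  also have "\<dots> = (nrm2 d b / c + c * nrm2 d w) / 2"
    by (simp add: nrm2_def sum.distrib sum_distrib_left sum_divide_distrib add_divide_distrib)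
  finally have upper: "nrm2 r z \<le> (nrm2 d b / c + c * nrm2 d w) / 2" unfolding z_eq .
  have "nrm2 d b / c \<le> nrm2 r z"
  proof -
    have "nrm2 d b \<le> c * nrm2 r (\<lambda>k. cnj (z k))" unfolding b_def by (rule T)
    also have "nrm2 r (\<lambda>k. cnj (z k)) = nrm2 r z" by (simp add: nrm2_def)
    finally show ?thesis using c by (simp add: divide_le_eq mult.commute)
  qed
  \<comment> \<open>The bound contains half of \<open>nrm2 r z\<close> itself, which is absorbed on
    the left.\<close>
  moreover have "x \<le> y" if "a \<le> x" "x \<le> (a + y) / 2" for a x y :: real
    using that by simp
  ultimately have "nrm2 r z \<le> c * nrm2 d w" using upper by blast
  then show ?thesis unfolding z_def .
qed

lemma residual_cong: "(\<And>i. i < m \<Longrightarrow> x i = y i) \<Longrightarrow> i < m \<Longrightarrow> residual m P x i = residual m P y i"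
  by (simp add: residual_def mvec_def)

lemma residual_sum:
  "residual m P (\<lambda>i. \<Sum>j<d. a j * e j i) = (\<lambda>i. \<Sum>j<d. a j * residual m P (e j) i)"
  by (intro ext) (simp add: residual_def mvec_sum mvec_scale sum_subtractf right_diff_distrib)

text \<open>Residuals are linear in the vector, so those of \<open>g\<close> arise from those of
  \<open>e\<close> through the coefficients \<open>T\<close>, in each coordinate \<open>i\<close>
  separately. This carries summed squared distances from an orthonormal family to one that is merely
  bounded.\<close>

lemma residual_frame_bound:
  assumes e: "orthonormal m d e" and c: "0 < c"
    and g: "\<And>k i. k < r \<Longrightarrow> i < m \<Longrightarrow> g k i = (\<Sum>j<d. T k j * e j i)"
    and bound: "\<And>a. nrm2 m (\<lambda>i. \<Sum>k<r. a k * g k i) \<le> c * nrm2 r a"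
  shows "(\<Sum>k<r. nrm2 m (residual m P (g k))) \<le> c * (\<Sum>j<d. nrm2 m (residual m P (e j)))"
proof -
  have T: "nrm2 d (\<lambda>j. \<Sum>k<r. a k * T k j) \<le> c * nrm2 r a" for a
  proof -
    have "nrm2 d (\<lambda>j. \<Sum>k<r. a k * T k j) = nrm2 m (\<lambda>i. \<Sum>j<d. (\<Sum>k<r. a k * T k j) * e j i)"
      by (rule orthonormal_nrm2[OF e, symmetric])
    also have "\<dots> = nrm2 m (\<lambda>i. \<Sum>k<r. a k * g k i)"
    proof (rule nrm2_cong)
      fix i assume i: "i < m"
      have "(\<Sum>j<d. (\<Sum>k<r. a k * T k j) * e j i) = (\<Sum>k<r. \<Sum>j<d. a k * T k j * e j i)"
        unfolding sum_distrib_right by (rule sum.swap)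
      also have "\<dots> = (\<Sum>k<r. a k * g k i)"
        using g i by (simp add: sum_distrib_left mult.assoc)
      finally show "(\<Sum>j<d. (\<Sum>k<r. a k * T k j) * e j i) = (\<Sum>k<r. a k * g k i)" .
    qed
    also have "\<dots> \<le> c * nrm2 r a" by (rule bound)
    finally show ?thesis .
  qed
  have "(\<Sum>k<r. nrm2 m (residual m P (g k))) = (\<Sum>k<r. \<Sum>i<m. (cmod (\<Sum>j<d. T k j * residual m P (e j) i))\<^sup>2)"
    unfolding nrm2_def
  proof (intro sum.cong refl)
    fix k i assume "k \<in> {..<r}" "i \<in> {..<m}"
    then have "residual m P (g k) i = residual m P (\<lambda>i. \<Sum>j<d. T k j * e j i) i"
      using g by (intro residual_cong) auto
    then show "(cmod (residual m P (g k) i))\<^sup>2 = (cmod (\<Sum>j<d. T k j * residual m P (e j) i))\<^sup>2"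
      by (simp add: residual_sum)
  qed
  also have "\<dots> = (\<Sum>i<m. nrm2 r (\<lambda>k. \<Sum>j<d. T k j * residual m P (e j) i))"
    unfolding nrm2_def by (rule sum.swap)
  also have "\<dots> \<le> (\<Sum>i<m. c * nrm2 d (\<lambda>j. residual m P (e j) i))"
    by (intro sum_mono transpose_bound c T)
  also have "\<dots> = c * (\<Sum>j<d. nrm2 m (residual m P (e j)))"
    unfolding nrm2_def sum_distrib_left by (rule sum.swap)
  finally show ?thesis .
qed

text \<open>The differences \<open>x - y\<close> run through the sum of both spans, and are the
  vectors whose lengths are distances from the second space. The second space is given by any
  spanning family, the first by an orthonormal basis, because the squared distances are summed over
  one.\<close>

locale near_isometry =
  fixes N n d1 d2 :: nat and u c2 F :: "nat \<Rightarrow> nat \<Rightarrow> complex" and \<delta> :: real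
  assumes u: "orthonormal N d1 u" and \<delta>: "0 \<le> \<delta>" "\<delta> < 1"
    and isometry: "\<And>x y. x \<in> fspan d1 u \<Longrightarrow> y \<in> fspan d2 c2 \<Longrightarrow>
      (1 - \<delta>) * nrm2 N (\<lambda>i. x i - y i) \<le> nrm2 n (mvec N F (\<lambda>i. x i - y i)) \<and>
      nrm2 n (mvec N F (\<lambda>i. x i - y i)) \<le> (1 + \<delta>) * nrm2 N (\<lambda>i. x i - y i)"
begin

definition "v1 = (\<lambda>k. mvec N F (u k))"
definition "v2 = (\<lambda>k. mvec N F (c2 k))"
text \<open>The normalised Gram-Schmidt vectors of the images, an orthonormal basis of the image of
  the first space.\<close>

definition "e = (\<lambda>k i. gsv n v1 k i / complex_of_real (sqrt (nrm2 n (gsv n v1 k))))"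

lemma isometry1:
  assumes "x \<in> fspan d1 u"
  shows "(1 - \<delta>) * nrm2 N x \<le> nrm2 n (mvec N F x)" "nrm2 n (mvec N F x) \<le> (1 + \<delta>) * nrm2 N x"
  using isometry[OF assms fspan_zero] by auto

lemma fspan_image:
  assumes "y \<in> fspan d (\<lambda>k. mvec N F (c k))"
  obtains x where "x \<in> fspan d c" "y = mvec N F x"
proof -
  obtain a where "y = (\<lambda>i. \<Sum>k<d. a k * mvec N F (c k) i)" using assms by (auto simp: fspan_def)
  then have "y = mvec N F (\<lambda>i. \<Sum>k<d. a k * c k i)" by (simp add: mvec_sum mvec_scale)
  then show ?thesis using that by (auto simp: fspan_def)
qed

lemma image_fspan: "x \<in> fspan d c \<Longrightarrow> mvec N F x \<in> fspan d (\<lambda>k. mvec N F (c k))"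
  by (auto simp: fspan_def mvec_sum mvec_scale)

text \<open>The lower bound makes the map injective on the first space. Its image therefore keeps
  the dimension \<open>d1\<close>, and the same \<open>d1\<close> stands in both trace
  formulas.\<close>

lemma gsv_nonzero: "k < d1 \<Longrightarrow> nrm2 n (gsv n v1 k) \<noteq> 0"
proof
  assume k: "k < d1" and 0: "nrm2 n (gsv n v1 k) = 0"
  obtain y where y: "y \<in> fspan k u" "mvec n (gsp n v1 k) (v1 k) = mvec N F y"
    using fspan_image[of "mvec n (gsp n v1 k) (v1 k)" k u] mvec_gsp_in_span[of n v1 k] by (auto simp: v1_def)
  have mem: "(\<lambda>i. u k i - y i) \<in> fspan d1 u"
    using y(1) k fspan_mono[of k d1 u] by (intro fspan_diff fspan_member) auto
  have "gsv n v1 k = mvec N F (\<lambda>i. u k i - y i)"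
    unfolding gsv_def residual_def y(2) by (simp add: v1_def mvec_diff)
  then have "(1 - \<delta>) * nrm2 N (\<lambda>i. u k i - y i) \<le> 0"
    using isometry1(1)[OF mem] 0 by simp
  then have "nrm2 N (\<lambda>i. u k i - y i) = 0"
    using \<delta> nrm2_nonneg[of N "\<lambda>i. u k i - y i"] by (simp add: mult_le_0_iff)
  then have eq: "u k i = y i" if "i < N" for i using that by (simp add: nrm2_eq_0_iff)
  obtain a where a: "y = (\<lambda>i. \<Sum>j<k. a j * u j i)" using y(1) by (auto simp: fspan_def)
  have "ip N (u k) (u k) = ip N y (u k)" unfolding ip_def using eq by (intro sum.cong) auto
  also have "\<dots> = (\<Sum>j<k. a j * ip N (u j) (u k))" unfolding a by (simp add: ip_sum_left ip_scale_left)
  also have "\<dots> = 0" using u k by (intro sum.neutral) (auto simp: orthonormal_def)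
  finally show False using u k by (simp add: orthonormal_def)
qed

lemma e_orthonormal: "orthonormal n d1 e"
  unfolding orthonormal_def
proof (intro allI impI)
  fix j k assume "j < d1" "k < d1"
  have ip_e: "ip n (e j) (e k) = ip n (gsv n v1 j) (gsv n v1 k) /
      (complex_of_real (sqrt (nrm2 n (gsv n v1 j))) * complex_of_real (sqrt (nrm2 n (gsv n v1 k))))"
    by (simp add: ip_def e_def sum_divide_distrib)
  show "ip n (e j) (e k) = (if j = k then 1 else 0)"
  proof (cases "j = k")
    case True
    then show ?thesis
      using gsv_nonzero[OF \<open>k < d1\<close>] nrm2_nonneg[of n "gsv n v1 k"]
      unfolding ip_e by (simp add: ip_self flip: of_real_mult)
  next
    case False
    then show ?thesis unfolding ip_e by (simp add: gsv_orth)
  qed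
qed

lemma gsp_v1: "gsp n v1 d1 i j = (\<Sum>k<d1. e k i * cnj (e k j))"
  unfolding gsp_eq_sum e_def
  using nrm2_nonneg by (intro sum.cong) (auto simp: ip_self simp flip: of_real_mult)

text \<open>Distances can be compared vector by vector, but an orthonormal basis is mapped only to a
  nearly orthonormal one. \<open>residual_frame_bound\<close> pays for this: in one direction for
  the preimages \<open>x\<close> of \<open>e\<close>, with bound \<open>1 / (1 - \<delta>)\<close>,
  in the other for the images \<open>v1\<close> of \<open>u\<close>, with bound
  \<open>1 + \<delta>\<close>.\<close>

lemma residual_sum_bounds:
  defines "SX \<equiv> \<Sum>k<d1. nrm2 N (residual N (gsp N c2 d2) (u k))"
    and "SY \<equiv> \<Sum>k<d1. nrm2 n (residual n (gsp n v2 d2) (e k))"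
  shows "(1 - \<delta>) * SY \<le> (1 + \<delta>) * SX" "(1 - \<delta>) * SX \<le> (1 + \<delta>) * SY"
proof -
  have "\<exists>x. x \<in> fspan d1 u \<and> e k = mvec N F x" if "k < d1" for k
  proof -
    have "gsv n v1 k \<in> fspan d1 v1" using gsv_in_span[of n v1 k] fspan_mono[of "Suc k" d1 v1] that by auto
    then have "e k \<in> fspan d1 v1"
      using fspan_scale[of "gsv n v1 k" d1 v1 "1 / complex_of_real (sqrt (nrm2 n (gsv n v1 k)))"]
      by (simp add: e_def)
    then show ?thesis using fspan_image[of "e k" d1 u] by (auto simp: v1_def)
  qed
  then obtain x where x: "\<And>k. k < d1 \<Longrightarrow> x k \<in> fspan d1 u" "\<And>k. k < d1 \<Longrightarrow> e k = mvec N F (x k)"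
    by metis
  from x(1) have "\<exists>T. \<forall>i. x k i = (\<Sum>j<d1. T j * u j i)" if "k < d1" for k
    using that by (fastforce simp: fspan_def)
  then obtain T where T: "\<And>k i. k < d1 \<Longrightarrow> x k i = (\<Sum>j<d1. T k j * u j i)" by metis
  have "(\<Sum>k<d1. nrm2 N (residual N (gsp N c2 d2) (x k))) \<le> inverse (1 - \<delta>) * SX"
    unfolding SX_def
  proof (rule residual_frame_bound[OF u])
    fix a :: "nat \<Rightarrow> complex"
    define z where "z = (\<lambda>i. \<Sum>k<d1. a k * x k i)"
    have "z \<in> fspan d1 u" unfolding z_def using x(1) by (intro fspan_sum fspan_scale) auto
    then have "(1 - \<delta>) * nrm2 N z \<le> nrm2 n (mvec N F z)" by (rule isometry1)
    also have "mvec N F z = (\<lambda>i. \<Sum>k<d1. a k * e k i)"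
      unfolding z_def by (simp add: mvec_sum mvec_scale x(2))
    also have "nrm2 n \<dots> = nrm2 d1 a" by (rule orthonormal_nrm2[OF e_orthonormal])
    finally show "nrm2 N (\<lambda>i. \<Sum>k<d1. a k * x k i) \<le> inverse (1 - \<delta>) * nrm2 d1 a"
      using \<delta> by (simp add: z_def field_simps)
  qed (use \<delta> T in auto)
  moreover have "SY \<le> (1 + \<delta>) * (\<Sum>k<d1. nrm2 N (residual N (gsp N c2 d2) (x k)))"
    unfolding SY_def sum_distrib_left
  proof (rule sum_mono)
    fix k assume "k \<in> {..<d1}"
    then have k: "k < d1" by simp
    define y where "y = mvec N (gsp N c2 d2) (x k)"
    have y: "y \<in> fspan d2 c2" unfolding y_def by (rule mvec_gsp_in_span)
    \<comment> \<open>The best approximation of \<open>x k\<close> is mapped to a competitor for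
      \<open>e k\<close>.\<close>
    have "nrm2 n (residual n (gsp n v2 d2) (e k)) \<le> nrm2 n (\<lambda>i. e k i - mvec N F y i)"
      by (rule residual_best) (use image_fspan[OF y] in \<open>simp add: v2_def\<close>)
    also have "\<dots> = nrm2 n (mvec N F (\<lambda>i. x k i - y i))" by (simp add: x(2)[OF k] mvec_diff)
    also have "\<dots> \<le> (1 + \<delta>) * nrm2 N (\<lambda>i. x k i - y i)" using isometry[OF x(1)[OF k] y] by simp
    finally show "nrm2 n (residual n (gsp n v2 d2) (e k)) \<le> (1 + \<delta>) * nrm2 N (residual N (gsp N c2 d2) (x k))"
      by (simp add: residual_def y_def)
  qed
  ultimately have "SY \<le> (1 + \<delta>) * (inverse (1 - \<delta>) * SX)"
    using \<delta> by (meson add_nonneg_nonneg mult_left_mono order_trans zero_le_one)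
  then show "(1 - \<delta>) * SY \<le> (1 + \<delta>) * SX"
    using \<delta> by (simp add: field_simps)
  have "(\<Sum>k<d1. nrm2 n (residual n (gsp n v2 d2) (v1 k))) \<le> (1 + \<delta>) * SY"
    unfolding SY_def
  proof (rule residual_frame_bound[OF e_orthonormal, where T = "\<lambda>k j. ip n (v1 k) (e j)"])
    fix k i assume "k < d1" "i < n"
    then have "v1 k i = mvec n (gsp n v1 d1) (v1 k) i" by (simp add: gsp_fixes)
    also have "\<dots> = (\<Sum>l<n. \<Sum>j<d1. v1 k l * cnj (e j l) * e j i)"
      unfolding mvec_def gsp_v1 by (simp add: sum_distrib_left sum_distrib_right mult_ac)
    also have "\<dots> = (\<Sum>j<d1. ip n (v1 k) (e j) * e j i)"
      by (subst sum.swap) (simp add: ip_def sum_distrib_right)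
    finally show "v1 k i = (\<Sum>j<d1. ip n (v1 k) (e j) * e j i)" .
  next
    fix a :: "nat \<Rightarrow> complex"
    define z where "z = (\<lambda>i. \<Sum>k<d1. a k * u k i)"
    have z: "z \<in> fspan d1 u" by (auto simp: z_def fspan_def)
    have "(\<lambda>i. \<Sum>k<d1. a k * v1 k i) = mvec N F z" by (simp add: z_def v1_def mvec_sum mvec_scale)
    moreover have "nrm2 N z = nrm2 d1 a" unfolding z_def by (rule orthonormal_nrm2[OF u])
    ultimately show "nrm2 n (\<lambda>i. \<Sum>k<d1. a k * v1 k i) \<le> (1 + \<delta>) * nrm2 d1 a"
      using isometry1(2)[OF z] by simp
  qed (use \<delta> in simp)
  moreover have "(1 - \<delta>) * SX \<le> (\<Sum>k<d1. nrm2 n (residual n (gsp n v2 d2) (v1 k)))"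
    unfolding SX_def sum_distrib_left
  proof (rule sum_mono)
    fix k assume "k \<in> {..<d1}"
    then have k: "u k \<in> fspan d1 u" by (intro fspan_member) simp
    \<comment> \<open>The best approximation of \<open>v1 k\<close> is the image of a competitor for
      \<open>u k\<close>.\<close>
    obtain y where y: "y \<in> fspan d2 c2" "mvec n (gsp n v2 d2) (v1 k) = mvec N F y"
      using fspan_image[of "mvec n (gsp n v2 d2) (v1 k)" d2 c2] mvec_gsp_in_span[of n v2 d2] by (auto simp: v2_def)
    have "(1 - \<delta>) * nrm2 N (residual N (gsp N c2 d2) (u k)) \<le> (1 - \<delta>) * nrm2 N (\<lambda>i. u k i - y i)"
      using \<delta> residual_best[OF y(1)] by (intro mult_left_mono) auto
    also have "\<dots> \<le> nrm2 n (mvec N F (\<lambda>i. u k i - y i))" using isometry[OF k y(1)] by simp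
    also have "mvec N F (\<lambda>i. u k i - y i) = residual n (gsp n v2 d2) (v1 k)"
      unfolding residual_def y(2) by (simp add: v1_def mvec_diff)
    finally show "(1 - \<delta>) * nrm2 N (residual N (gsp N c2 d2) (u k)) \<le> nrm2 n (residual n (gsp n v2 d2) (v1 k))" .
  qed
  ultimately show "(1 - \<delta>) * SX \<le> (1 + \<delta>) * SY" by linarith
qed

theorem trace_preserved:
  assumes \<epsilon>: "0 < \<epsilon>" "\<epsilon> < 1" "\<delta> = \<epsilon> / 4"
  defines "tX \<equiv> Re (\<Sum>i<N. \<Sum>j<N. (\<Sum>k<d1. u k i * cnj (u k j)) * gsp N c2 d2 j i)"
    and "tY \<equiv> Re (\<Sum>i<n. \<Sum>j<n. gsp n v1 d1 i j * gsp n v2 d2 j i)"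
  shows "\<bar>tY - tX\<bar> \<le> \<epsilon> * (real d1 - tX)"
proof -
  define SX SY where "SX = (\<Sum>k<d1. nrm2 N (residual N (gsp N c2 d2) (u k)))"
    and "SY = (\<Sum>k<d1. nrm2 n (residual n (gsp n v2 d2) (e k)))"
  have tX: "tX = real d1 - SX" unfolding tX_def SX_def sum_residual_eq_trace[OF u] by simp
  have tY: "tY = real d1 - SY" unfolding tY_def SY_def sum_residual_eq_trace[OF e_orthonormal] gsp_v1 by simp
  have b: "(1 - \<delta>) * SY \<le> (1 + \<delta>) * SX" "(1 - \<delta>) * SX \<le> (1 + \<delta>) * SY"
    unfolding SX_def SY_def by (rule residual_sum_bounds)+
  have pos: "0 \<le> SX" "0 \<le> SY" unfolding SX_def SY_def by (intro sum_nonneg nrm2_nonneg)+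
  have "(1 - \<delta>) * (SY - SX) \<le> 2 * \<delta> * SX" using b(1) by (simp add: algebra_simps)
  also have "\<dots> \<le> (1 - \<delta>) * (\<epsilon> * SX)"
  proof -
    \<comment> \<open>With \<open>\<epsilon> = 4 * \<delta>\<close> the product
      \<open>(1 - \<delta>) * \<epsilon>\<close> is even at least
      \<open>3 * \<delta>\<close>.\<close>
    have "\<delta> * \<epsilon> \<le> \<delta>" using \<delta> \<epsilon> by (simp add: mult_left_le)
    moreover have "(1 - \<delta>) * \<epsilon> = \<epsilon> - \<delta> * \<epsilon>" by (simp add: left_diff_distrib)
    ultimately have "2 * \<delta> \<le> (1 - \<delta>) * \<epsilon>" using \<delta>(1) \<epsilon>(3) by linarith
    from mult_right_mono[OF this pos(1)] show ?thesis by (simp add: mult.assoc)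
  qed
  finally have 1: "SY - SX \<le> \<epsilon> * SX" using \<delta> by simp
  have "(1 + \<delta>) * (SX - SY) \<le> 2 * \<delta> * SX" using b(2) by (simp add: algebra_simps)
  also have "\<dots> \<le> (1 + \<delta>) * (\<epsilon> * SX)"
  proof -
    have "(1 + \<delta>) * \<epsilon> = \<epsilon> + \<delta> * \<epsilon>" by (simp add: distrib_right)
    moreover have "0 \<le> \<delta> * \<epsilon>" using \<delta>(1) \<epsilon>(1) by simp
    ultimately have "2 * \<delta> \<le> (1 + \<delta>) * \<epsilon>" using \<delta>(1) \<epsilon>(3) by linarith
    from mult_right_mono[OF this pos(1)] show ?thesis by (simp add: mult.assoc)
  qed
  finally have 2: "SX - SY \<le> \<epsilon> * SX" using \<delta> by simp
  show ?thesis unfolding tX tY using 1 2 by simp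
qed

end

section \<open>Moments of a Rademacher chaos\<close>

text \<open>Sign vectors are set to \<open>0\<close> from index \<open>N\<close> on, which makes the set of them finite.\<close>

definition signs :: "nat \<Rightarrow> (nat \<Rightarrow> real) set"
  where "signs N = {s. (\<forall>k<N. s k = 1 \<or> s k = -1) \<and> (\<forall>k\<ge>N. s k = 0)}"

lemma finite_signs: "finite (signs N)"
proof -
  have "signs N \<subseteq> {s. \<forall>k. (k \<in> {..<N} \<longrightarrow> s k \<in> {1, -1}) \<and> (k \<notin> {..<N} \<longrightarrow> s k = 0)}"
    by (auto simp: signs_def)
  then show ?thesis
    by (rule finite_subset) (rule finite_set_of_finite_funs, auto)
qed

lemma card_signs: "card (signs N) = 2 ^ N"
proof (induction N)
  case 0
  have "signs 0 = {\<lambda>_. 0}" by (auto simp: signs_def)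
  then show ?case by simp
next
  case (Suc N)
  have "bij_betw (\<lambda>(s, b). s(N := b)) (signs N \<times> {1, -1 :: real}) (signs (Suc N))"
  proof (rule bij_betwI[where g = "\<lambda>s. (s(N := 0), s N)"])
    show "(\<lambda>(s, b). s(N := b)) \<in> signs N \<times> {1, - 1} \<rightarrow> signs (Suc N)"
      by (auto simp: signs_def less_Suc_eq)
    show "(\<lambda>s. (s(N := 0), s N)) \<in> signs (Suc N) \<rightarrow> signs N \<times> {1, -1}"
      by (auto simp: signs_def less_Suc_eq)
  qed (auto simp: signs_def fun_eq_iff)
  then have "card (signs (Suc N)) = card (signs N \<times> {1, -1 :: real})"
    by (simp add: bij_betw_same_card)
  then show ?case by (simp add: card_cartesian_product Suc finite_signs)
qed

definition flip_sign :: "nat \<Rightarrow> (nat \<Rightarrow> real) \<Rightarrow> nat \<Rightarrow> real"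
  where "flip_sign j s = s(j := - s j)"

lemma sum_flip_sign:
  assumes "j < N"
  shows "(\<Sum>s\<in>signs N. f (flip_sign j s)) = (\<Sum>s\<in>signs N. f s)"
  using assms
  by (intro sum.reindex_bij_witness[of _ "flip_sign j" "flip_sign j"])
    (auto simp: signs_def flip_sign_def fun_eq_iff)

section \<open>Quadratic forms averaged over sign vectors\<close>

definition qform :: "nat \<Rightarrow> (nat \<Rightarrow> nat \<Rightarrow> real) \<Rightarrow> (nat \<Rightarrow> real) \<Rightarrow> real"
  where "qform N M s = (\<Sum>j<N. \<Sum>k<N. s j * s k * M j k)"

definition savg :: "nat \<Rightarrow> ((nat \<Rightarrow> real) \<Rightarrow> real) \<Rightarrow> real"
  where "savg N f = (\<Sum>s\<in>signs N. f s) / 2 ^ N"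

lemma savg_mono: "(\<And>s. s \<in> signs N \<Longrightarrow> f s \<le> g s) \<Longrightarrow> savg N f \<le> savg N g"
  unfolding savg_def by (intro divide_right_mono sum_mono) auto

lemma savg_add: "savg N (\<lambda>s. f s + g s) = savg N f + savg N g"
  by (simp add: savg_def sum.distrib add_divide_distrib)

lemma savg_cmult: "savg N (\<lambda>s. c * f s) = c * savg N f"
  by (simp add: savg_def sum_distrib_left)

lemma savg_sum: "savg N (\<lambda>s. \<Sum>j\<in>J. f j s) = (\<Sum>j\<in>J. savg N (f j))"
  unfolding savg_def by (simp add: sum.swap[of _ J] sum_divide_distrib)

lemma savg_flip: "j < N \<Longrightarrow> savg N (\<lambda>s. f (flip_sign j s)) = savg N f"
  by (simp add: savg_def sum_flip_sign)

lemma savg_cong: "(\<And>s. s \<in> signs N \<Longrightarrow> f s = g s) \<Longrightarrow> savg N f = savg N g"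
  by (simp add: savg_def)

lemma savg_const: "savg N (\<lambda>_. c) = c"
  by (simp add: savg_def card_signs)

text \<open>The scalar counterpart of \<open>hs_odd_pow_diff\<close>; for nonnegative numbers it
  holds for every exponent.\<close>

lemma power_diff_bound:
  fixes x y :: real
  assumes "0 \<le> x" "0 \<le> y"
  shows "(x - y) * (x ^ Suc r - y ^ Suc r) \<le> (real r + 1) * ((x - y)\<^sup>2 * (x ^ r + y ^ r))"
proof -
  have "x ^ Suc r - y ^ Suc r = (x - y) * (\<Sum>i<Suc r. x ^ i * y ^ (r - i))"
    by (subst power_diff_sumr2) (simp add: mult.commute del: power_Suc sum.lessThan_Suc)
  then have "(x - y) * (x ^ Suc r - y ^ Suc r) = (x - y)\<^sup>2 * (\<Sum>i<Suc r. x ^ i * y ^ (r - i))"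
    by (simp add: power2_eq_square mult.assoc)
  also have "\<dots> \<le> (x - y)\<^sup>2 * (\<Sum>i<Suc r. x ^ r + y ^ r)"
  proof (intro mult_left_mono sum_mono)
    fix i assume "i \<in> {..<Suc r}"
    then have i: "i + (r - i) = r" by simp
    define z where "z = max x y"
    have "x ^ i * y ^ (r - i) \<le> z ^ i * z ^ (r - i)"
      unfolding z_def using assms by (intro mult_mono power_mono) auto
    also have "\<dots> = z ^ r" using i by (simp flip: power_add)
    also have "\<dots> \<le> x ^ r + y ^ r" using assms by (auto simp: z_def max_def)
    finally show "x ^ i * y ^ (r - i) \<le> x ^ r + y ^ r" .
  qed simp
  also have "(\<Sum>i<Suc r. x ^ r + y ^ r) = (real r + 1) * (x ^ r + y ^ r)" by simp
  finally show ?thesis by (simp add: algebra_simps)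
qed

text \<open>The form is self-bounding: the row sums in \<open>gradient\<close> are half its partial
  derivatives, so the squared gradient is at most \<open>4 * \<kappa>\<close> times the form. The
  trace is its mean over the signs.\<close>

locale sign_chaos =
  fixes N :: nat and M :: "nat \<Rightarrow> nat \<Rightarrow> real" and \<kappa> D :: real
  assumes sym: "\<And>j k. M j k = M k j"
    and nonneg: "\<And>s. s \<in> signs N \<Longrightarrow> 0 \<le> qform N M s"
    and gradient: "\<And>s. s \<in> signs N \<Longrightarrow> (\<Sum>j<N. (\<Sum>k<N. M j k * s k)\<^sup>2) \<le> \<kappa> * qform N M s"
    and diag: "\<And>j. j < N \<Longrightarrow> 0 \<le> M j j" "\<And>j. j < N \<Longrightarrow> M j j \<le> \<kappa>"
    and trace: "(\<Sum>j<N. M j j) \<le> \<kappa> * D" and \<kappa>: "0 \<le> \<kappa>" and D: "0 \<le> D"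
begin

abbreviation "f \<equiv> qform N M"

text \<open>Half the partial derivative in direction \<open>j\<close> without the diagonal term, and
  so independent of \<open>s j\<close>.\<close>

definition off :: "nat \<Rightarrow> (nat \<Rightarrow> real) \<Rightarrow> real"
  where "off j s = (\<Sum>k\<in>{..<N} - {j}. M j k * s k)"

lemma off_flip: "off j (flip_sign j s) = off j s"
  unfolding off_def flip_sign_def by (intro sum.cong) auto

lemma flip_signs: "s \<in> signs N \<Longrightarrow> j < N \<Longrightarrow> flip_sign j s \<in> signs N"
  by (auto simp: signs_def flip_sign_def)

lemma row_split: "j < N \<Longrightarrow> (\<Sum>k<N. M j k * s k) = M j j * s j + off j s"
  unfolding off_def by (subst sum.remove[of _ j]) auto

lemma f_split: "f s = (\<Sum>j<N. s j * (\<Sum>k<N. M j k * s k))"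
  unfolding qform_def by (simp add: sum_distrib_left mult_ac)

lemma f_flip:
  assumes s: "s \<in> signs N" and j: "j < N"
  shows "f s - f (flip_sign j s) = 4 * (s j * off j s)"
proof -
  define I where "I = {..<N} - {j}"
  define r where "r = (\<Sum>i\<in>I. \<Sum>k\<in>I. s i * s k * M i k)"
  have ins: "{..<N} = insert j I" "finite I" "j \<notin> I" using j by (auto simp: I_def)
  have gen: "f t = t j * t j * M j j + 2 * (t j * off j t) + (\<Sum>i\<in>I. \<Sum>k\<in>I. t i * t k * M i k)" for t
  proof -
    have "off j t = (\<Sum>k\<in>I. M j k * t k)" by (simp add: off_def I_def)
    moreover have "f t = (t j * t j * M j j + (\<Sum>k\<in>I. t j * t k * M j k))
        + ((\<Sum>i\<in>I. t i * t j * M i j) + (\<Sum>i\<in>I. \<Sum>k\<in>I. t i * t k * M i k))"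
      unfolding qform_def ins(1) using ins(2,3) by (simp add: sum.distrib)
    moreover have "(\<Sum>i\<in>I. t i * t j * M i j) = (\<Sum>k\<in>I. t j * t k * M j k)"
      by (intro sum.cong) (auto simp: sym mult_ac)
    ultimately show ?thesis by (simp add: sum_distrib_left mult_ac)
  qed
  have "(\<Sum>i\<in>I. \<Sum>k\<in>I. flip_sign j s i * flip_sign j s k * M i k) = (\<Sum>i\<in>I. \<Sum>k\<in>I. s i * s k * M i k)"
    using ins(3) by (intro sum.cong) (auto simp: flip_sign_def)
  then show ?thesis
    unfolding gen[of s] gen[of "flip_sign j s"] off_flip by (simp add: flip_sign_def)
qed

text \<open>The gradient condition controls full row sums. Removing the diagonal term costs
  \<open>(M j j)^2\<close>, at most \<open>\<kappa> * M j j\<close>, and these sum up to the trace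
  bound.\<close>

lemma off_square_sum:
  assumes s: "s \<in> signs N"
  shows "(\<Sum>j<N. (off j s)\<^sup>2) \<le> 2 * \<kappa> * f s + 2 * \<kappa> * (\<kappa> * D)"
proof -
  have "(off j s)\<^sup>2 \<le> 2 * (\<Sum>k<N. M j k * s k)\<^sup>2 + 2 * (\<kappa> * M j j)" if j: "j < N" for j
  proof -
    define a where "a = (\<Sum>k<N. M j k * s k)"
    define b where "b = M j j * s j"
    have "off j s = a - b" using row_split[OF j, of s] by (simp add: a_def b_def)
    moreover have "(a - b)\<^sup>2 \<le> 2 * a\<^sup>2 + 2 * b\<^sup>2"
      using zero_le_power2[of "a + b"] by (simp add: power2_eq_square algebra_simps)
    moreover have "b\<^sup>2 = M j j * M j j"
      using s j by (auto simp: b_def signs_def power2_eq_square)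
    moreover have "M j j * M j j \<le> \<kappa> * M j j" using diag[OF j] by (intro mult_right_mono)
    ultimately show ?thesis by (simp add: a_def)
  qed
  then have "(\<Sum>j<N. (off j s)\<^sup>2) \<le> (\<Sum>j<N. 2 * (\<Sum>k<N. M j k * s k)\<^sup>2 + 2 * (\<kappa> * M j j))"
    by (intro sum_mono) auto
  also have "\<dots> = 2 * (\<Sum>j<N. (\<Sum>k<N. M j k * s k)\<^sup>2) + 2 * (\<kappa> * (\<Sum>j<N. M j j))"
    by (simp add: sum.distrib sum_distrib_left)
  also have "\<dots> \<le> 2 * (\<kappa> * f s) + 2 * (\<kappa> * (\<kappa> * D))"
    using gradient[OF s] mult_left_mono[OF trace \<kappa>] by simp
  finally show ?thesis by simp
qed

definition mom :: "nat \<Rightarrow> real"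
  where "mom q = savg N (\<lambda>s. f s ^ q)"

lemma mom_nonneg: "0 \<le> mom q"
  unfolding mom_def savg_def using nonneg by (intro divide_nonneg_nonneg sum_nonneg) auto

text \<open>One factor of the power is expanded: the diagonal yields the mean, and every other term
  has a factor that is odd in \<open>s j\<close>.\<close>

lemma mom_Suc_split: "mom (Suc q) = (\<Sum>j<N. M j j) * mom q + (\<Sum>j<N. savg N (\<lambda>s. s j * off j s * f s ^ q))"
proof -
  have "f s ^ Suc q = (\<Sum>j<N. M j j * f s ^ q + s j * off j s * f s ^ q)" if s: "s \<in> signs N" for s
  proof -
    have "f s = (\<Sum>j<N. M j j + s j * off j s)"
      unfolding f_split[of s]
    proof (rule sum.cong[OF refl])
      fix j assume "j \<in> {..<N}"
      then show "s j * (\<Sum>k<N. M j k * s k) = M j j + s j * off j s"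
        using s row_split[of j s] by (auto simp: signs_def algebra_simps)
    qed
    then have "f s ^ Suc q = (\<Sum>j<N. M j j + s j * off j s) * f s ^ q" by simp
    then show ?thesis by (simp add: sum_distrib_right distrib_right)
  qed
  then have "mom (Suc q) = savg N (\<lambda>s. \<Sum>j<N. M j j * f s ^ q + s j * off j s * f s ^ q)"
    unfolding mom_def by (rule savg_cong)
  then show ?thesis
    by (simp add: savg_sum savg_add savg_cmult mom_def sum.distrib sum_distrib_right)
qed

lemma off_term_0: "j < N \<Longrightarrow> savg N (\<lambda>s. s j * off j s) = 0"
  using savg_flip[of j N "\<lambda>s. s j * off j s"] savg_cmult[of N "-1" "\<lambda>s. s j * off j s"]
  unfolding off_flip by (simp add: flip_sign_def)

text \<open>Averaging with the flipped vector turns the odd factor into a difference of powers, as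
  in \<open>resample_identity\<close>. By \<open>f_flip\<close> the increment of \<open>f\<close> is
  four times the odd factor itself, which produces a square.\<close>

lemma off_term_Suc:
  assumes j: "j < N"
  shows "savg N (\<lambda>s. s j * off j s * f s ^ Suc r) \<le> 4 * (real r + 1) * savg N (\<lambda>s. (off j s)\<^sup>2 * f s ^ r)"
proof -
  define g where "g s = s j * off j s" for s
  have gf: "g (flip_sign j s) = - g s" for s by (simp add: g_def off_flip) (simp add: flip_sign_def)
  have "savg N (\<lambda>s. g s * f s ^ Suc r) = savg N (\<lambda>s. g (flip_sign j s) * f (flip_sign j s) ^ Suc r)"
    by (rule savg_flip[OF j, symmetric])
  then have "2 * savg N (\<lambda>s. g s * f s ^ Suc r)
      = savg N (\<lambda>s. g s * f s ^ Suc r) + savg N (\<lambda>s. - g s * f (flip_sign j s) ^ Suc r)"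
    unfolding gf by simp
  also have "\<dots> = savg N (\<lambda>s. g s * f s ^ Suc r + - g s * f (flip_sign j s) ^ Suc r)"
    by (rule savg_add[symmetric])
  also have "\<dots> \<le> savg N (\<lambda>s. 4 * (real r + 1) * ((off j s)\<^sup>2 * f s ^ r + (off j (flip_sign j s))\<^sup>2 * f (flip_sign j s) ^ r))"
  proof (rule savg_mono)
    fix s assume s: "s \<in> signs N"
    define x y where "x = f s" and "y = f (flip_sign j s)"
    have xy: "x - y = 4 * g s" unfolding x_def y_def g_def by (rule f_flip[OF s j])
    have g2: "(g s)\<^sup>2 = (off j s)\<^sup>2" using s j by (auto simp: g_def signs_def power_mult_distrib)
    have "(x - y) * (x ^ Suc r - y ^ Suc r) \<le> (real r + 1) * ((x - y)\<^sup>2 * (x ^ r + y ^ r))"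
      by (rule power_diff_bound) (use s j nonneg flip_signs in \<open>auto simp: x_def y_def\<close>)
    then have "4 * (g s * (x ^ Suc r - y ^ Suc r)) \<le> 4 * (4 * (real r + 1) * ((off j s)\<^sup>2 * (x ^ r + y ^ r)))"
      unfolding xy power_mult_distrib g2 by (simp add: algebra_simps)
    then show "g s * f s ^ Suc r + - g s * f (flip_sign j s) ^ Suc r
        \<le> 4 * (real r + 1) * ((off j s)\<^sup>2 * f s ^ r + (off j (flip_sign j s))\<^sup>2 * f (flip_sign j s) ^ r)"
      unfolding off_flip x_def y_def by (simp add: right_diff_distrib distrib_left)
  qed
  also have "\<dots> = 4 * (real r + 1) * (savg N (\<lambda>s. (off j s)\<^sup>2 * f s ^ r)
      + savg N (\<lambda>s. (off j (flip_sign j s))\<^sup>2 * f (flip_sign j s) ^ r))"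
    by (simp only: savg_cmult savg_add)
  also have "savg N (\<lambda>s. (off j (flip_sign j s))\<^sup>2 * f (flip_sign j s) ^ r) = savg N (\<lambda>s. (off j s)\<^sup>2 * f s ^ r)"
    by (rule savg_flip[OF j])
  finally show ?thesis by (simp add: g_def)
qed

text \<open>The squares sum up to a multiple of the form plus a constant by
  \<open>off_square_sum\<close>, so the recursion closes with the two preceding moments.\<close>

lemma mom_Suc_Suc:
  "mom (Suc (Suc r)) \<le> \<kappa> * D * mom (Suc r) + 8 * (real r + 1) * \<kappa> * (mom (Suc r) + \<kappa> * D * mom r)"
proof -
  have "(\<Sum>j<N. savg N (\<lambda>s. s j * off j s * f s ^ Suc r))
      \<le> (\<Sum>j<N. 4 * (real r + 1) * savg N (\<lambda>s. (off j s)\<^sup>2 * f s ^ r))"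
    by (intro sum_mono off_term_Suc) simp
  also have "\<dots> = 4 * (real r + 1) * savg N (\<lambda>s. (\<Sum>j<N. (off j s)\<^sup>2) * f s ^ r)"
    by (simp add: sum_distrib_right savg_sum sum_distrib_left)
  also have "savg N (\<lambda>s. (\<Sum>j<N. (off j s)\<^sup>2) * f s ^ r)
      \<le> savg N (\<lambda>s. 2 * \<kappa> * f s ^ Suc r + 2 * \<kappa> * (\<kappa> * D) * f s ^ r)"
  proof (rule savg_mono)
    fix s assume s: "s \<in> signs N"
    from mult_right_mono[OF off_square_sum[OF s], of "f s ^ r"] nonneg[OF s]
    show "(\<Sum>j<N. (off j s)\<^sup>2) * f s ^ r \<le> 2 * \<kappa> * f s ^ Suc r + 2 * \<kappa> * (\<kappa> * D) * f s ^ r"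
      by (simp add: distrib_right mult.assoc)
  qed
  also have "\<dots> = 2 * \<kappa> * mom (Suc r) + 2 * \<kappa> * (\<kappa> * D) * mom r"
    by (simp only: savg_add savg_cmult mom_def)
  finally have "(\<Sum>j<N. savg N (\<lambda>s. s j * off j s * f s ^ Suc r))
      \<le> 4 * (real r + 1) * (2 * \<kappa> * mom (Suc r) + 2 * \<kappa> * (\<kappa> * D) * mom r)" by simp
  moreover have "(\<Sum>j<N. M j j) * mom (Suc r) \<le> \<kappa> * D * mom (Suc r)"
    by (intro mult_right_mono trace mom_nonneg)
  ultimately show ?thesis unfolding mom_Suc_split[of "Suc r"] by (simp add: algebra_simps)
qed

lemma mom_Suc_0_le: "mom (Suc 0) \<le> \<kappa> * D"
  using mom_Suc_split[of 0] trace off_term_0 by (simp add: mom_def savg_const)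

text \<open>As in \<open>moment_bound\<close>, \<open>p\<close> is fixed to have one base for all
  \<open>q\<close>. With \<open>h = \<kappa> * (D + 8 * p)\<close> the recursion asks for a base
  \<open>b\<close> with \<open>h * b + h^2 \<le> b^2\<close>, and \<open>b = 2 * h\<close> satisfies
  it.\<close>

theorem chaos_moment_bound: "q \<le> p \<Longrightarrow> mom q \<le> (2 * \<kappa> * (D + 8 * real p)) ^ q"
proof (induction q rule: less_induct)
  case (less q)
  define b where "b = 2 * \<kappa> * (D + 8 * real p)"
  have b: "0 \<le> b" using \<kappa> D by (simp add: b_def)
  consider "q = 0" | "q = Suc 0" | r where "q = Suc (Suc r)" by (metis nat.exhaust)
  then show ?case
  proof cases
    case 1
    then show ?thesis by (simp add: mom_def savg_const)
  next
    case 2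
    have "\<kappa> * D \<le> b" using \<kappa> D by (auto simp: b_def algebra_simps intro!: add_nonneg_nonneg mult_nonneg_nonneg)
    then show ?thesis using mom_Suc_0_le by (simp add: 2 b_def)
  next
    case (3 r)
    have r: "8 * (real r + 1) \<le> 8 * real p" using less.prems 3 by simp
    have IH: "mom (Suc r) \<le> b ^ Suc r" "mom r \<le> b ^ r" using less.IH[of "Suc r"] less.IH[of r] less.prems 3
      unfolding b_def by (simp_all del: power_Suc)
    have "mom q \<le> \<kappa> * D * mom (Suc r) + 8 * (real r + 1) * \<kappa> * (mom (Suc r) + \<kappa> * D * mom r)"
      unfolding 3 by (rule mom_Suc_Suc)
    also have "\<dots> \<le> \<kappa> * D * b ^ Suc r + 8 * real p * \<kappa> * (b ^ Suc r + \<kappa> * D * b ^ r)"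
      using IH r \<kappa> D mom_nonneg b by (intro add_mono mult_mono mult_left_mono mult_right_mono add_nonneg_nonneg mult_nonneg_nonneg) auto
    also have "\<dots> = b ^ r * ((\<kappa> * (D + 8 * real p)) * b + 8 * real p * D * \<kappa>\<^sup>2)"
      by (simp add: algebra_simps power2_eq_square)
    also have "\<dots> \<le> b ^ r * (b * b)"
    proof (rule mult_left_mono)
      define h where "h = \<kappa> * (D + 8 * real p)"
      have "8 * real p * D \<le> (D + 8 * real p)\<^sup>2" using D by (simp add: power2_eq_square algebra_simps)
      then have "8 * real p * D * \<kappa>\<^sup>2 \<le> h * h"
        unfolding h_def using mult_right_mono[of "8 * real p * D" "(D + 8 * real p)\<^sup>2" "\<kappa>\<^sup>2"]
        by (simp add: power2_eq_square algebra_simps)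
      moreover have "b = 2 * h" by (simp add: b_def h_def)
      moreover have "h * b + y \<le> b * b" if "y \<le> h * h" "b = 2 * h" for y
      proof -
        have "0 \<le> h * h" by simp
        moreover have "h * b = 2 * (h * h)" "b * b = 4 * (h * h)" using that(2) by simp_all
        ultimately show ?thesis using that(1) by linarith
      qed
      ultimately show "(\<kappa> * (D + 8 * real p)) * b + 8 * real p * D * \<kappa>\<^sup>2 \<le> b * b"
        unfolding h_def by blast
    qed (use b in simp)
    finally show ?thesis by (simp add: 3 b_def mult_ac)
  qed
qed

end

section \<open>Near-isometry of the sampled map on a fixed subspace\<close>

definition qf :: "nat \<Rightarrow> (nat \<Rightarrow> nat \<Rightarrow> complex) \<Rightarrow> (nat \<Rightarrow> complex) \<Rightarrow> real"
  where "qf N A x = Re (ip N (mvec N A x) x)"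

lemma mvec_mm: "mvec N (mm N A B) x = mvec N A (mvec N B x)"
proof
  fix i
  have "mvec N (mm N A B) x i = (\<Sum>j<N. \<Sum>k<N. A i k * B k j * x j)"
    by (simp add: mvec_def mm_def sum_distrib_right)
  also have "\<dots> = (\<Sum>k<N. \<Sum>j<N. A i k * B k j * x j)" by (rule sum.swap)
  also have "\<dots> = mvec N A (mvec N B x) i"
    by (simp add: mvec_def sum_distrib_left mult.assoc)
  finally show "mvec N (mm N A B) x i = mvec N A (mvec N B x) i" .
qed

lemma Re_cnj_mult_self: "Re (cnj a * a) = (cmod a)\<^sup>2"
  by (subst cmod_power2) (simp add: power2_eq_square)

lemma hs_self: "hs N A A = (\<Sum>i<N. \<Sum>j<N. (cmod (A i j))\<^sup>2)"
  unfolding hs_def by (simp only: Re_cnj_mult_self)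

lemma nrm2_mvec_le: "nrm2 N (mvec N A x) \<le> hs N A A * nrm2 N x"
proof -
  have "(cmod (mvec N A x i))\<^sup>2 \<le> (\<Sum>j<N. (cmod (A i j))\<^sup>2) * nrm2 N x" for i
  proof -
    have "cmod (mvec N A x i) \<le> (\<Sum>j<N. cmod (A i j) * cmod (x j))"
      unfolding mvec_def by (rule order_trans[OF norm_sum]) (simp add: norm_mult)
    then have "(cmod (mvec N A x i))\<^sup>2 \<le> (\<Sum>j<N. cmod (A i j) * cmod (x j))\<^sup>2"
      by (intro power_mono) auto
    also have "\<dots> \<le> (\<Sum>j<N. (cmod (A i j))\<^sup>2) * (\<Sum>j<N. (cmod (x j))\<^sup>2)"
      by (rule Cauchy_Schwarz_ineq_sum)
    finally show ?thesis by (simp add: nrm2_def)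
  qed
  then show ?thesis
    unfolding nrm2_def[of N "mvec N A x"] hs_self sum_distrib_right by (intro sum_mono) auto
qed

text \<open>The squared norms of the iterates \<open>X\<^sup>k x\<close> are log-convex in \<open>k\<close>, so the growth rate of the
  first step is a lower bound for the growth rate of all steps.\<close>

lemma qf_le_of_power:
  assumes X: "msupp N X" "madj X = X" and c: "0 < c" and q: "1 \<le> q"
    and bound: "hs N (mpow N X q) (mpow N X q) \<le> c ^ (2 * q)"
  shows "\<bar>qf N X x\<bar> \<le> c * nrm2 N x"
proof -
  define v where "v k = (mvec N X ^^ k) x" for k
  define e where "e k = nrm2 N (v k)" for k
  have vS: "v (Suc k) = mvec N X (v k)" for k by (simp add: v_def)
  have adj: "conjugate (X j i) = X i j" for i j using X(2) by (metis madj_def conjugate_complex_def)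
  have v_pow: "i < N \<Longrightarrow> v k i = mvec N (mpow N X k) x i" for k i
  proof (induction k arbitrary: i)
    case 0
    then show ?case
      by (simp add: v_def mpow_def mvec_def mone_def if_distrib[of "\<lambda>a. a * _"] cong: if_cong)
  next
    case (Suc k)
    then show ?case unfolding vS mpow_Suc mvec_mm using mvec_cong[of N "v k" "mvec N (mpow N X k) x" X] by simp
  qed
  \<comment> \<open>The squared norm of \<open>v (k + 2) - m * v k\<close> is nonnegative; its cross
    term is \<open>e (k + 1)\<close> because \<open>X\<close> is self-adjoint.\<close>
  have conv: "2 * m * e (Suc k) \<le> e (Suc (Suc k)) + m\<^sup>2 * e k" for m k
  proof -
    define y where "y = (\<lambda>i. v (Suc (Suc k)) i - complex_of_real m * v k i)"
    have a: "ip N (v (Suc (Suc k))) (v k) = complex_of_real (e (Suc k))"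
      using ip_mvec[of X N "v (Suc k)" "v k", OF adj] by (simp add: vS e_def ip_self)
    then have b: "ip N (v k) (v (Suc (Suc k))) = complex_of_real (e (Suc k))"
      using ip_conjugate[of N "v (Suc (Suc k))" "v k"] by simp
    have "ip N y y = complex_of_real (e (Suc (Suc k)) + m\<^sup>2 * e k - 2 * m * e (Suc k))"
      unfolding y_def ip_diff_left ip_diff_right ip_scale_left ip_scale_right a b
      by (simp add: ip_self e_def power2_eq_square algebra_simps)
    then have "nrm2 N y = e (Suc (Suc k)) + m\<^sup>2 * e k - 2 * m * e (Suc k)"
      unfolding nrm2_ip by simp
    then show ?thesis using nrm2_nonneg[of N y] by linarith
  qed
  show ?thesis
  proof (cases "e 0 = 0")
    case True
    then have "qf N X x = 0" by (auto simp: e_def v_def nrm2_eq_0_iff qf_def ip_def)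
    then show ?thesis using c nrm2_nonneg[of N x] by simp
  next
    case False
    then have e0: "0 < e 0" using nrm2_nonneg[of N "v 0"] by (simp add: e_def)
    define m where "m = e 1 / e 0"
    have m: "0 \<le> m" using e0 nrm2_nonneg[of N "v 1"] by (simp add: m_def e_def)
    have step: "m * e k \<le> e (Suc k)" for k
    proof (induction k)
      case 0
      then show ?case using e0 by (simp add: m_def)
    next
      case (Suc k)
      have "m\<^sup>2 * e k \<le> m * e (Suc k)"
        using mult_left_mono[OF Suc m] by (simp add: power2_eq_square mult.assoc)
      then show ?case using conv[of m k] by linarith
    qed
    have pow: "m ^ k * e 0 \<le> e k" for k
    proof (induction k)
      case (Suc k)
      then show ?case using mult_left_mono[OF Suc m] step[of k] by (simp add: mult.assoc)
    qed simp
    \<comment> \<open>The Hilbert-Schmidt norm dominates the operator norm of \<open>X^q\<close>,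
      and the \<open>q\<close>-th root then gives the growth rate of one step.\<close>
    have "e q = nrm2 N (mvec N (mpow N X q) x)"
      unfolding e_def using v_pow by (intro nrm2_cong) auto
    also have "\<dots> \<le> hs N (mpow N X q) (mpow N X q) * nrm2 N x" by (rule nrm2_mvec_le)
    also have "\<dots> \<le> c ^ (2 * q) * e 0"
      unfolding e_def v_def using bound by (intro mult_mono) (auto simp: nrm2_nonneg)
    finally have "m ^ q * e 0 \<le> (c\<^sup>2) ^ q * e 0" using pow[of q] by (simp add: power_mult)
    then have "m ^ q \<le> (c\<^sup>2) ^ q" using e0 by simp
    then have "m \<le> c\<^sup>2" using m q by (metis power_mono_iff not_one_le_zero zero_le_power2 gr0I)
    then have e1: "e 1 \<le> c\<^sup>2 * e 0" using e0 by (simp add: m_def divide_le_eq)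
    have am: "\<bar>Re (ip N y x)\<bar> \<le> (nrm2 N y / c + c * nrm2 N x) / 2" for y
    proof -
      have E: "Re (ip N (\<lambda>i. y i - complex_of_real t * x i) (\<lambda>i. y i - complex_of_real t * x i))
          = nrm2 N y + t\<^sup>2 * nrm2 N x - 2 * t * Re (ip N y x)" for t
      proof -
        have "Re (ip N x y) = Re (cnj (ip N y x))" using ip_conjugate[of N y x] by simp
        then have "Re (ip N x y) = Re (ip N y x)" by simp
        then show ?thesis
          unfolding ip_diff_left ip_diff_right ip_scale_left ip_scale_right
          by (simp add: ip_self power2_eq_square algebra_simps)
      qed
      have key: "2 * t * Re (ip N y x) \<le> nrm2 N y + t\<^sup>2 * nrm2 N x" for t
      proof -
        have "0 \<le> Re (ip N (\<lambda>i. y i - complex_of_real t * x i) (\<lambda>i. y i - complex_of_real t * x i))"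
          unfolding nrm2_ip[symmetric] by (rule nrm2_nonneg)
        then show ?thesis unfolding E by linarith
      qed
      have "2 * c * Re (ip N y x) \<le> nrm2 N y + c\<^sup>2 * nrm2 N x"
        "2 * c * (- Re (ip N y x)) \<le> nrm2 N y + c\<^sup>2 * nrm2 N x"
        using key[of c] key[of "- c"] by simp_all
      then have "2 * c * \<bar>Re (ip N y x)\<bar> \<le> nrm2 N y + c\<^sup>2 * nrm2 N x" by (simp only: abs_if split: if_split) simp
      then have "\<bar>Re (ip N y x)\<bar> \<le> (nrm2 N y + c\<^sup>2 * nrm2 N x) / (2 * c)"
        using c by (simp add: pos_le_divide_eq mult.commute)
      also have "\<dots> = (nrm2 N y / c + c * nrm2 N x) / 2"
        using c by (simp add: power2_eq_square add_divide_distrib)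
      finally show ?thesis .
    qed
    have "nrm2 N (mvec N X x) \<le> c\<^sup>2 * nrm2 N x" using e1 by (simp add: e_def v_def)
    then have "nrm2 N (mvec N X x) / c \<le> c * nrm2 N x"
      using c by (simp add: pos_divide_le_eq power2_eq_square mult_ac)
    then have "(nrm2 N (mvec N X x) / c + c * nrm2 N x) / 2 \<le> c * nrm2 N x" by simp
    with am[of "mvec N X x"] show ?thesis unfolding qf_def by (rule order_trans)
  qed
qed

lemma hs_outer_one: "hs N (\<lambda>i j. cnj (w i) * w j) (mone N) = nrm2 N w"
proof -
  have "hs N (\<lambda>i j. cnj (w i) * w j) (mone N) = (\<Sum>i<N. \<Sum>j<N. if j = i then (cmod (w i))\<^sup>2 else 0)"
    unfolding hs_def mone_def
    by (intro sum.cong) (auto simp: Re_cnj_mult_self[of "w _", simplified] mult.commute)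
  then show ?thesis by (simp add: nrm2_def)
qed

lemma hs_outer_square:
  assumes "madj A = A"
  shows "hs N (\<lambda>i j. cnj (w i) * w j) (mm N A A) = nrm2 N (\<lambda>k. \<Sum>i<N. w i * A i k)"
proof -
  have adj: "A k j = cnj (A j k)" for j k using assms by (metis madj_def)
  have "(\<Sum>i<N. \<Sum>j<N. cnj (cnj (w i) * w j) * mm N A A i j)
      = (\<Sum>i<N. \<Sum>j<N. \<Sum>k<N. (w i * A i k) * cnj (w j * A j k))"
    unfolding mm_def
  proof (intro sum.cong refl)
    fix i j
    have "cnj (cnj (w i) * w j) * (\<Sum>k<N. A i k * A k j) = (\<Sum>k<N. w i * cnj (w j) * (A i k * A k j))"
      by (simp add: sum_distrib_left)
    also have "\<dots> = (\<Sum>k<N. (w i * A i k) * cnj (w j * A j k))"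
      by (intro sum.cong refl) (subst adj, simp add: mult_ac)
    finally show "cnj (cnj (w i) * w j) * (\<Sum>k<N. A i k * A k j) = (\<Sum>k<N. (w i * A i k) * cnj (w j * A j k))" .
  qed
  also have "\<dots> = (\<Sum>i<N. \<Sum>k<N. \<Sum>j<N. (w i * A i k) * cnj (w j * A j k))"
    by (intro sum.cong sum.swap refl)
  also have "\<dots> = (\<Sum>k<N. \<Sum>i<N. \<Sum>j<N. (w i * A i k) * cnj (w j * A j k))" by (rule sum.swap)
  also have "\<dots> = (\<Sum>k<N. (\<Sum>i<N. w i * A i k) * cnj (\<Sum>j<N. w j * A j k))"
    by (simp only: cnj_sum sum_product)
  also have "\<dots> = complex_of_real (nrm2 N (\<lambda>k. \<Sum>i<N. w i * A i k))"
    by (simp only: nrm2_def of_real_sum complex_norm_square)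
  finally have "Re (\<Sum>i<N. \<Sum>j<N. cnj (cnj (w i) * w j) * mm N A A i j)
      = nrm2 N (\<lambda>k. \<Sum>i<N. w i * A i k)" by (simp only: Re_complex_of_real)
  then show ?thesis by (simp only: hs_def Re_sum)
qed

text \<open>A projection is at most the identity: the left side is both the inner product of
  \<open>A\<close> with \<open>A P\<close> and the squared norm of \<open>A P\<close>.\<close>

lemma hs_proj_square_le:
  assumes P: "madj P = P" "mm N P P = P" and A: "madj A = A"
  shows "hs N P (mm N A A) \<le> hs N A A"
proof -
  have 1: "hs N P (mm N A A) = hs N (mm N A P) A" using hs_mm_left[of N A P A] A by simp
  have 2: "hs N (mm N A P) (mm N A P) = hs N A (mm N A P)"
    using hs_mm_right[of N A P "mm N A P"] P by (simp add: mm_assoc)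
  show ?thesis using hs_am[of N A "mm N A P"] 1 2 hs_sym[of N A "mm N A P"] by linarith
qed

lemma bmeas_if:
  assumes "bmeas M f" "Measurable.pred M P"
  shows "bmeas M (\<lambda>x. if P x then f x else 0)"
proof -
  obtain B where "\<And>x. x \<in> space M \<Longrightarrow> norm (f x) \<le> B" using assms(1) by (auto simp: bmeas_def)
  then have "norm (if P x then f x else 0) \<le> max B 0" if "x \<in> space M" for x
    using that by (auto simp: le_max_iff_disj)
  moreover have "(\<lambda>x. if P x then f x else 0) \<in> borel_measurable M"
    using assms unfolding bmeas_def by (intro measurable_If) (auto simp: pred_def)
  ultimately show ?thesis unfolding bmeas_def by blast
qed

lemma bmeas_power: "bmeas M f \<Longrightarrow> bmeas M (\<lambda>x. f x ^ k)"
  by (induction k) (auto intro: bmeas_const bmeas_mult)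

lemma bmeas_nrm2:
  assumes "\<And>i. bmeas M (\<lambda>x. w x i)"
  shows "bmeas M (\<lambda>x. nrm2 N (w x))"
proof -
  have "bmeas M (\<lambda>x. \<Sum>i<N. Re (cnj (w x i) * w x i))"
    by (intro bmeas_sum bmeas_Re bmeas_mult bmeas_cnj assms)
  then show ?thesis by (simp only: Re_cnj_mult_self nrm2_def)
qed

lemma hs_mean:
  assumes "\<And>i j. integrable M (\<lambda>x. Z x i j)"
  shows "hs N (\<lambda>i j. \<integral>x. Z x i j \<partial>M) B = (\<integral>x. hs N (Z x) B \<partial>M)"
proof -
  have 1: "integrable M (\<lambda>x. cnj (Z x i j) * B i j)" for i j
    using assms[of i j] by simp
  have "(\<integral>x. cnj (Z x i j) * B i j \<partial>M) = cnj (\<integral>x. Z x i j \<partial>M) * B i j" for i j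
    by simp
  then show ?thesis unfolding integral_hs[OF 1] by (simp only: hs_def)
qed

text \<open>For a sign vector \<open>s\<close> and a row \<open>a\<close> of the sampling matrix, \<open>wv s a\<close> is the signed row projected
  by \<open>p\<close>; it represents the functional \<open>x \<mapsto> \<Sum>k<N. a k * s k * x k\<close> on the range of \<open>p\<close>.\<close>

locale bos_frame = prob_space \<nu> for \<nu> :: "'d measure" +
  fixes N :: nat and \<phi> :: "nat \<Rightarrow> 'd \<Rightarrow> complex" and K D :: real and p :: "nat \<Rightarrow> nat \<Rightarrow> real"
  assumes \<phi>_meas: "\<And>k. k < N \<Longrightarrow> \<phi> k \<in> borel_measurable \<nu>"
    and \<phi>_orth: "\<And>j k. j < N \<Longrightarrow> k < N \<Longrightarrow> (\<integral>x. \<phi> j x * cnj (\<phi> k x) \<partial>\<nu>) = (if j = k then 1 else 0)"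
    and \<phi>_bound: "\<And>k x. k < N \<Longrightarrow> x \<in> space \<nu> \<Longrightarrow> cmod (\<phi> k x) \<le> K"
    and p_sym: "\<And>i j. p i j = p j i"
    and p_idem: "\<And>i j. (\<Sum>k<N. p i k * p k j) = p i j"
    and p_supp: "\<And>i j. N \<le> i \<Longrightarrow> p i j = 0"
    and p_trace: "(\<Sum>i<N. p i i) \<le> D" and K: "0 \<le> K" and D: "0 \<le> D"
begin

definition wv :: "(nat \<Rightarrow> real) \<Rightarrow> (nat \<Rightarrow> complex) \<Rightarrow> nat \<Rightarrow> complex"
  where "wv s a i = (\<Sum>k<N. complex_of_real (p i k * s k) * a k)"

definition outer :: "(nat \<Rightarrow> real) \<Rightarrow> (nat \<Rightarrow> complex) \<Rightarrow> nat \<Rightarrow> nat \<Rightarrow> complex"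
  where "outer s a = (\<lambda>i j. cnj (wv s a i) * wv s a j)"

abbreviation row :: "'d \<Rightarrow> nat \<Rightarrow> complex"
  where "row x \<equiv> (\<lambda>k. \<phi> k x)"

lemma wv_supp: "N \<le> i \<Longrightarrow> wv s a i = 0"
  by (simp add: wv_def p_supp)

lemma bmeas_\<phi>: "k < N \<Longrightarrow> bmeas \<nu> (\<phi> k)"
  using \<phi>_meas \<phi>_bound by (auto simp: bmeas_def)

lemma bmeas_wv: "bmeas \<nu> (\<lambda>x. wv s (row x) i)"
  unfolding wv_def by (intro bmeas_sum bmeas_mult bmeas_const bmeas_\<phi>) auto

lemma bmeas_outer: "bmeas \<nu> (\<lambda>x. outer s (row x) i j)"
  unfolding outer_def by (intro bmeas_mult bmeas_cnj bmeas_wv)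

lemma bmeas_nrm2_wv: "bmeas \<nu> (\<lambda>x. nrm2 N (wv s (row x)))"
  by (rule bmeas_nrm2[OF bmeas_wv])

text \<open>Orthonormality leaves only diagonal terms, where the signs occur squared; so the mean is
  the projection for every choice of signs.\<close>

lemma outer_mean:
  assumes s: "s \<in> signs N"
  shows "(\<integral>x. outer s (row x) i j \<partial>\<nu>) = complex_of_real (p i j)"
proof -
  have int: "integrable \<nu> (\<lambda>x. \<phi> l x * cnj (\<phi> k x))" if "k < N" "l < N" for k l
    using that by (intro bmeas_integrable bmeas_mult bmeas_cnj bmeas_\<phi>)
  define c where "c k l = complex_of_real (p i k * s k * (p j l * s l))" for k l
  have "outer s (row x) i j = (\<Sum>k<N. \<Sum>l<N. c k l * (\<phi> l x * cnj (\<phi> k x)))" for x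
    unfolding outer_def wv_def cnj_sum sum_product c_def by (intro sum.cong refl) (simp add: mult_ac)
  then have "(\<integral>x. outer s (row x) i j \<partial>\<nu>) = (\<integral>x. (\<Sum>k<N. \<Sum>l<N. c k l * (\<phi> l x * cnj (\<phi> k x))) \<partial>\<nu>)"
    by simp
  also have "\<dots> = (\<Sum>k<N. \<Sum>l<N. c k l * (\<integral>x. \<phi> l x * cnj (\<phi> k x) \<partial>\<nu>))"
  proof -
    have int': "integrable \<nu> (\<lambda>x. c k l * (\<phi> l x * cnj (\<phi> k x)))" if "k < N" "l < N" for k l
      using int[OF that] by (rule integrable_mult_right)
    have "(\<integral>x. (\<Sum>k<N. \<Sum>l<N. c k l * (\<phi> l x * cnj (\<phi> k x))) \<partial>\<nu>)
        = (\<Sum>k<N. \<integral>x. (\<Sum>l<N. c k l * (\<phi> l x * cnj (\<phi> k x))) \<partial>\<nu>)"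
      using int' by (intro Bochner_Integration.integral_sum Bochner_Integration.integrable_sum) auto
    also have "\<dots> = (\<Sum>k<N. \<Sum>l<N. \<integral>x. c k l * (\<phi> l x * cnj (\<phi> k x)) \<partial>\<nu>)"
      using int' by (intro sum.cong refl Bochner_Integration.integral_sum) auto
    finally show ?thesis by simp
  qed
  also have "\<dots> = (\<Sum>k<N. \<Sum>l<N. if l = k then c k k else 0)"
    using \<phi>_orth by (intro sum.cong) auto
  also have "\<dots> = (\<Sum>k<N. c k k)" by simp
  also have "\<dots> = complex_of_real (\<Sum>k<N. p i k * p k j)"
    unfolding of_real_sum
  proof (rule sum.cong[OF refl])
    fix k assume "k \<in> {..<N}"
    then have "s k * s k = 1" using s by (auto simp: signs_def)
    moreover have "p i k * s k * (p j k * s k) = (p i k * p k j) * (s k * s k)" by (simp add: p_sym[of j k])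
    ultimately show "c k k = complex_of_real (p i k * p k j)" by (simp only: c_def mult_1_right)
  qed
  finally show ?thesis by (simp only: p_idem)
qed

lemma wv_repr:
  assumes "\<And>i. i < N \<Longrightarrow> mvec N (\<lambda>i j. complex_of_real (p i j)) x i = x i"
  shows "(\<Sum>k<N. a k * complex_of_real (s k) * x k) = (\<Sum>j<N. wv s a j * x j)"
proof -
  have "(\<Sum>k<N. a k * complex_of_real (s k) * x k)
      = (\<Sum>k<N. \<Sum>j<N. complex_of_real (p j k * s k) * a k * x j)"
  proof (rule sum.cong[OF refl])
    fix k assume "k \<in> {..<N}"
    then have "x k = (\<Sum>j<N. complex_of_real (p j k) * x j)"
      using assms[of k] by (simp add: mvec_def p_sym[of k])
    then have "a k * complex_of_real (s k) * x k
        = a k * complex_of_real (s k) * (\<Sum>j<N. complex_of_real (p j k) * x j)" by simp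
    then show "a k * complex_of_real (s k) * x k = (\<Sum>j<N. complex_of_real (p j k * s k) * a k * x j)"
      by (simp add: sum_distrib_left mult_ac)
  qed
  also have "\<dots> = (\<Sum>j<N. wv s a j * x j)"
    by (subst sum.swap) (simp add: wv_def sum_distrib_right)
  finally show ?thesis .
qed

lemma qf_outer: "qf N (outer s a) x = (cmod (\<Sum>j<N. wv s a j * x j))\<^sup>2"
proof -
  have "ip N (mvec N (outer s a) x) x = (\<Sum>i<N. \<Sum>j<N. cnj (wv s a i * x i) * (wv s a j * x j))"
    by (simp add: ip_def mvec_def outer_def sum_distrib_left sum_distrib_right mult_ac)
  also have "\<dots> = cnj (\<Sum>i<N. wv s a i * x i) * (\<Sum>j<N. wv s a j * x j)"
    by (simp only: cnj_sum sum_product)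
  finally show ?thesis by (simp only: qf_def Re_cnj_mult_self)
qed

lemma p_diag: "0 \<le> p j j" "p j j \<le> 1"
proof -
  have eq: "p j j = (\<Sum>k<N. (p j k)\<^sup>2)"
  proof -
    have "(p j k)\<^sup>2 = p j k * p k j" for k by (metis p_sym power2_eq_square)
    then show ?thesis by (simp only: p_idem)
  qed
  then show "0 \<le> p j j" by (simp add: sum_nonneg)
  show "p j j \<le> 1"
  proof (cases "j < N")
    case True
    then have "(p j j)\<^sup>2 \<le> (\<Sum>k<N. (p j k)\<^sup>2)"
      using member_le_sum[of j "{..<N}" "\<lambda>k. (p j k)\<^sup>2"] by simp
    also have "\<dots> = p j j" by (rule eq[symmetric])
    finally show ?thesis
      using \<open>0 \<le> p j j\<close> by (cases "p j j = 0") (auto simp: power2_eq_square)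
  qed (simp add: p_supp)
qed

text \<open>For a fixed row the squared norm is a quadratic form in the signs, with matrix
  \<open>M\<close> the entrywise product of \<open>p\<close> and the real part of the outer product
  of the row with itself. Its row sums against \<open>s\<close> are
  \<open>Re (cnj (a j) * wv s a j)\<close>, so the entry bound alone gives the gradient condition
  with \<open>\<kappa> = K^2\<close>.\<close>

lemma sign_moment:
  assumes a: "\<And>k. k < N \<Longrightarrow> cmod (a k) \<le> K" and q: "q \<le> q'"
  shows "savg N (\<lambda>s. nrm2 N (wv s a) ^ q) \<le> (2 * K\<^sup>2 * (D + 8 * real q')) ^ q"
proof -
  define M where "M j k = p j k * Re (cnj (a j) * a k)" for j k
  have Ms: "(\<Sum>k<N. M j k * s k) = Re (cnj (a j) * wv s a j)" for j s
    by (simp add: M_def wv_def sum_distrib_left algebra_simps)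
  have q_nrm: "qform N M s = nrm2 N (wv s a)" for s
  proof -
    have "complex_of_real (nrm2 N (wv s a)) = (\<Sum>i<N. wv s a i * cnj (wv s a i))"
      by (simp only: nrm2_def of_real_sum complex_norm_square)
    also have "\<dots> = (\<Sum>i<N. \<Sum>k<N. \<Sum>l<N. complex_of_real (s k * s l * (p i k * p i l)) * (a k * cnj (a l)))"
      unfolding wv_def cnj_sum sum_product by (intro sum.cong refl) (simp add: mult_ac)
    also have "\<dots> = (\<Sum>k<N. \<Sum>i<N. \<Sum>l<N. complex_of_real (s k * s l * (p i k * p i l)) * (a k * cnj (a l)))"
      by (rule sum.swap)
    also have "\<dots> = (\<Sum>k<N. \<Sum>l<N. \<Sum>i<N. complex_of_real (s k * s l * (p i k * p i l)) * (a k * cnj (a l)))"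
      by (intro sum.cong sum.swap refl)
    also have "\<dots> = (\<Sum>k<N. \<Sum>l<N. complex_of_real (s k * s l * p k l) * (a k * cnj (a l)))"
    proof (intro sum.cong refl)
      fix k l
      have "(\<Sum>i<N. p i k * p i l) = p k l" using p_idem[of k l] by (simp add: p_sym[of k])
      then show "(\<Sum>i<N. complex_of_real (s k * s l * (p i k * p i l)) * (a k * cnj (a l)))
          = complex_of_real (s k * s l * p k l) * (a k * cnj (a l))"
        by (simp flip: sum_distrib_right sum_distrib_left of_real_sum of_real_mult)
    qed
    finally have "nrm2 N (wv s a) = Re (\<Sum>k<N. \<Sum>l<N. complex_of_real (s k * s l * p k l) * (a k * cnj (a l)))"
      by (metis Re_complex_of_real)
    also have "\<dots> = (\<Sum>k<N. \<Sum>l<N. s k * s l * (p k l * Re (a k * cnj (a l))))"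
    proof -
      have "Re (complex_of_real u * z) = u * Re z" for u z by simp
      then show ?thesis by (simp only: Re_sum mult.assoc)
    qed
    also have "\<dots> = qform N M s"
      by (simp add: qform_def M_def mult_ac)
    finally show ?thesis ..
  qed
  have aK: "(cmod (a j))\<^sup>2 \<le> K\<^sup>2" if "j < N" for j using a[OF that] by (intro power_mono) auto
  have M_diag: "M j j = p j j * (cmod (a j))\<^sup>2" for j by (simp only: M_def Re_cnj_mult_self)
  interpret sign_chaos N M "K\<^sup>2" D
  proof
    show "M j k = M k j" for j k by (simp add: M_def p_sym[of j k] mult_ac)
    show "0 \<le> qform N M s" for s by (simp add: q_nrm nrm2_nonneg)
    show "(\<Sum>j<N. (\<Sum>k<N. M j k * s k)\<^sup>2) \<le> K\<^sup>2 * qform N M s" for s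
      unfolding q_nrm nrm2_def sum_distrib_left Ms
    proof (rule sum_mono)
      fix j assume "j \<in> {..<N}"
      then have "(cmod (a j))\<^sup>2 \<le> K\<^sup>2" by (intro aK) simp
      have "(Re (cnj (a j) * wv s a j))\<^sup>2 \<le> (cmod (cnj (a j) * wv s a j))\<^sup>2"
        by (simp only: cmod_power2) simp
      also have "\<dots> = (cmod (a j))\<^sup>2 * (cmod (wv s a j))\<^sup>2" by (simp add: norm_mult power_mult_distrib)
      also have "\<dots> \<le> K\<^sup>2 * (cmod (wv s a j))\<^sup>2" using \<open>(cmod (a j))\<^sup>2 \<le> K\<^sup>2\<close> by (intro mult_right_mono) auto
      finally show "(Re (cnj (a j) * wv s a j))\<^sup>2 \<le> K\<^sup>2 * (cmod (wv s a j))\<^sup>2" .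
    qed
    show "0 \<le> M j j" for j using p_diag(1)[of j] by (simp add: M_diag)
    show "M j j \<le> K\<^sup>2" if "j < N" for j
      using mult_mono[OF p_diag(2)[of j] aK[OF that]] by (simp add: M_diag)
    have "(\<Sum>j<N. M j j) \<le> (\<Sum>j<N. p j j * K\<^sup>2)"
      unfolding M_diag using p_diag(1) aK by (intro sum_mono mult_left_mono) auto
    also have "\<dots> = (\<Sum>j<N. p j j) * K\<^sup>2" by (simp add: sum_distrib_right)
    also have "\<dots> \<le> D * K\<^sup>2" using p_trace by (intro mult_right_mono) auto
    finally show "(\<Sum>j<N. M j j) \<le> K\<^sup>2 * D" by (simp add: mult.commute)
  qed (use D in auto)
  show ?thesis using chaos_moment_bound[OF q] by (simp add: mom_def q_nrm)
qed

end

lemma qf_eq_hs: "qf N A x = hs N A (\<lambda>i j. x i * cnj (x j))"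
proof -
  have "qf N A x = (\<Sum>i<N. \<Sum>j<N. Re (A i j * x j * cnj (x i)))"
    by (simp add: qf_def ip_def mvec_def sum_distrib_right del: times_complex.sel)
  also have "\<dots> = (\<Sum>i<N. \<Sum>j<N. Re (cnj (A i j * x j * cnj (x i))))" by (simp only: cnj.sel)
  also have "\<dots> = hs N A (\<lambda>i j. x i * cnj (x j))"
    unfolding hs_def by (intro sum.cong refl arg_cong[where f = Re]) simp
  finally show ?thesis .
qed

locale bos_sample = bos_frame +
  fixes n q :: nat and R \<delta> :: real
  assumes R: "0 < R" and \<delta>: "0 < \<delta>" and n: "0 < n" and q: "1 \<le> q"
begin

definition Z_trunc :: "(nat \<Rightarrow> real) \<Rightarrow> (nat \<Rightarrow> complex) \<Rightarrow> nat \<Rightarrow> nat \<Rightarrow> complex"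
  where "Z_trunc s a = (\<lambda>i j. if nrm2 N (wv s a) \<le> R then outer s a i j else 0)"

definition tail :: "(nat \<Rightarrow> real) \<Rightarrow> real"
  where "tail s = (\<integral>x. (if nrm2 N (wv s (row x)) > R then nrm2 N (wv s (row x)) else 0) \<partial>\<nu>)"

definition X_trunc :: "(nat \<Rightarrow> real) \<Rightarrow> (nat \<Rightarrow> nat \<Rightarrow> complex) \<Rightarrow> nat \<Rightarrow> nat \<Rightarrow> complex"
  where "X_trunc s r = (\<lambda>i j. (\<Sum>l<n. Z_trunc s (r l) i j) - of_nat n * (\<integral>x. Z_trunc s (row x) i j \<partial>\<nu>))"

text \<open>By the second condition truncation does not act on the sample, so \<open>X_trunc\<close>
  is the true sum centred at the truncated mean. \<open>tail\<close> bounds the bias of that mean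
  and the last condition the fluctuation, with \<open>\<delta> / 2\<close> for each. The condition
  on \<open>tail\<close> concerns the signs alone.\<close>

definition good :: "(nat \<Rightarrow> real) \<Rightarrow> (nat \<Rightarrow> nat \<Rightarrow> complex) \<Rightarrow> bool"
  where "good s r \<longleftrightarrow> tail s \<le> \<delta> / 2 \<and> (\<forall>l<n. nrm2 N (wv s (r l)) \<le> R) \<and>
    hs N (mpow N (X_trunc s r) q) (mpow N (X_trunc s r) q) \<le> (\<delta> * real n / 2) ^ (2 * q)"

lemma pred_nrm2_wv: "Measurable.pred \<nu> (\<lambda>x. nrm2 N (wv s (row x)) \<le> R)"
proof -
  have [measurable]: "(\<lambda>x. nrm2 N (wv s (row x))) \<in> borel_measurable \<nu>"
    using bmeas_nrm2_wv by (simp add: bmeas_def)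
  show ?thesis by measurable
qed

lemma bmeas_Z_trunc: "bmeas \<nu> (\<lambda>x. Z_trunc s (row x) i j)"
  unfolding Z_trunc_def by (rule bmeas_if[OF bmeas_outer pred_nrm2_wv])

lemma outer_supp: "msupp N (outer s a)"
  by (auto simp: msupp_def outer_def wv_supp)

lemma hs_Z_trunc: "hs N (Z_trunc s a) B = (if nrm2 N (wv s a) \<le> R then hs N (outer s a) B else 0)"
  by (auto simp: Z_trunc_def hs_def)

text \<open>By the assumption on \<open>B\<close>, truncation discards a nonnegative part of the
  integrand.\<close>

lemma hs_Z_trunc_mean_le:
  assumes s: "s \<in> signs N" and B: "\<And>a. 0 \<le> hs N (outer s a) B"
  shows "hs N (\<lambda>i j. \<integral>x. Z_trunc s (row x) i j \<partial>\<nu>) B \<le> hs N (\<lambda>i j. complex_of_real (p i j)) B"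
proof -
  have "hs N (\<lambda>i j. \<integral>x. Z_trunc s (row x) i j \<partial>\<nu>) B = (\<integral>x. hs N (Z_trunc s (row x)) B \<partial>\<nu>)"
    by (rule hs_mean[OF bmeas_integrable[OF bmeas_Z_trunc]])
  also have "\<dots> \<le> (\<integral>x. hs N (outer s (row x)) B \<partial>\<nu>)"
    using B by (intro integral_mono bmeas_integrable[OF bmeas_hs[OF bmeas_Z_trunc bmeas_const]]
        bmeas_integrable[OF bmeas_hs[OF bmeas_outer bmeas_const]]) (simp add: hs_Z_trunc)
  also have "\<dots> = hs N (\<lambda>i j. \<integral>x. outer s (row x) i j \<partial>\<nu>) B"
    by (rule hs_mean[OF bmeas_integrable[OF bmeas_outer], symmetric])
  finally show ?thesis by (simp only: outer_mean[OF s])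
qed

lemma hs_p_one: "hs N (\<lambda>i j. complex_of_real (p i j)) (mone N) \<le> D"
proof -
  have "hs N (\<lambda>i j. complex_of_real (p i j)) (mone N) = (\<Sum>i<N. \<Sum>j<N. if j = i then p i i else 0)"
    unfolding hs_def mone_def by (intro sum.cong) auto
  then show ?thesis using p_trace by simp
qed

lemma rank_one_sample:
  assumes s: "s \<in> signs N"
  shows "rank_one_sample \<nu> N (\<lambda>x. Z_trunc s (row x)) (\<lambda>x. if nrm2 N (wv s (row x)) \<le> R then nrm2 N (wv s (row x)) else 0) R D"
proof (intro_locales, rule rank_one_sample_axioms.intro)
  show "bmeas \<nu> (\<lambda>x. Z_trunc s (row x) i j)" for i j by (rule bmeas_Z_trunc)
  show "msupp N (Z_trunc s (row x))" for x using outer_supp[of s "row x"] by (auto simp: Z_trunc_def msupp_def)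
  show "madj (Z_trunc s (row x)) = Z_trunc s (row x)" for x
    by (intro ext) (simp add: madj_def Z_trunc_def outer_def mult.commute)
  show "mm N (Z_trunc s (row x)) (Z_trunc s (row x)) = (\<lambda>i j. complex_of_real
      (if nrm2 N (wv s (row x)) \<le> R then nrm2 N (wv s (row x)) else 0) * Z_trunc s (row x) i j)" for x
  proof (intro ext)
    fix i j
    define w where "w = wv s (row x)"
    have "(\<Sum>k<N. cnj (w i) * w k * (cnj (w k) * w j)) = (\<Sum>k<N. w k * cnj (w k)) * (cnj (w i) * w j)"
      by (simp add: sum_distrib_right sum_distrib_left mult_ac)
    also have "(\<Sum>k<N. w k * cnj (w k)) = complex_of_real (nrm2 N w)"
      by (simp only: nrm2_def of_real_sum complex_norm_square)
    finally show "mm N (Z_trunc s (row x)) (Z_trunc s (row x)) i j = complex_of_real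
      (if nrm2 N (wv s (row x)) \<le> R then nrm2 N (wv s (row x)) else 0) * Z_trunc s (row x) i j"
      by (simp add: mm_def Z_trunc_def outer_def w_def)
  qed
  show "Z_trunc s (row x) = (\<lambda>i j. 0)" if "(if nrm2 N (wv s (row x)) \<le> R then nrm2 N (wv s (row x)) else 0) = 0" for x
  proof (intro ext)
    fix i j
    show "Z_trunc s (row x) i j = 0"
      using that wv_supp[of i s "row x"] by (cases "i < N") (auto simp: Z_trunc_def outer_def nrm2_eq_0_iff split: if_splits)
  qed
  show "0 \<le> (if nrm2 N (wv s (row x)) \<le> R then nrm2 N (wv s (row x)) else 0)" for x by (simp add: nrm2_nonneg)
  show "(if nrm2 N (wv s (row x)) \<le> R then nrm2 N (wv s (row x)) else 0) \<le> R" for x using R by simp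
  show "hs N (\<lambda>i j. \<integral>x. Z_trunc s (row x) i j \<partial>\<nu>) (mm N A A) \<le> hs N A A" if A: "msupp N A" "madj A = A" for A
  proof -
    have "hs N (\<lambda>i j. \<integral>x. Z_trunc s (row x) i j \<partial>\<nu>) (mm N A A) \<le> hs N (\<lambda>i j. complex_of_real (p i j)) (mm N A A)"
      by (rule hs_Z_trunc_mean_le[OF s]) (simp only: outer_def hs_outer_square[OF A(2)] nrm2_nonneg)
    also have "\<dots> \<le> hs N A A"
    proof (rule hs_proj_square_le[OF _ _ A(2)])
      show "madj (\<lambda>i j. complex_of_real (p i j)) = (\<lambda>i j. complex_of_real (p i j))"
        by (intro ext) (simp add: madj_def p_sym)
      show "mm N (\<lambda>i j. complex_of_real (p i j)) (\<lambda>i j. complex_of_real (p i j)) = (\<lambda>i j. complex_of_real (p i j))"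
        by (intro ext) (simp add: mm_def p_idem flip: of_real_mult of_real_sum)
    qed
    finally show ?thesis .
  qed
  have "hs N (\<lambda>i j. \<integral>x. Z_trunc s (row x) i j \<partial>\<nu>) (mone N) \<le> hs N (\<lambda>i j. complex_of_real (p i j)) (mone N)"
    by (rule hs_Z_trunc_mean_le[OF s]) (simp only: outer_def hs_outer_one nrm2_nonneg)
  then show "hs N (\<lambda>i j. \<integral>x. Z_trunc s (row x) i j \<partial>\<nu>) (mone N) \<le> D" using hs_p_one by linarith
qed

lemma good_near_isometry:
  assumes s: "s \<in> signs N" and good: "good s r"
    and x: "\<And>i. i < N \<Longrightarrow> mvec N (\<lambda>i j. complex_of_real (p i j)) x i = x i"
  shows "\<bar>(\<Sum>l<n. (cmod (\<Sum>k<N. r l k * complex_of_real (s k) * x k))\<^sup>2) - real n * nrm2 N x\<bar> \<le> \<delta> * real n * nrm2 N x"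
proof -
  interpret S: rank_one_sample \<nu> N n "\<lambda>x. Z_trunc s (row x)"
    "\<lambda>x. if nrm2 N (wv s (row x)) \<le> R then nrm2 N (wv s (row x)) else 0" R D
    by (rule rank_one_sample[OF s])
  define E where "E = (\<lambda>i j. \<integral>x. Z_trunc s (row x) i j \<partial>\<nu>)"
  have E: "S.mean_Z = E" by (simp add: E_def S.mean_Z_def)
  have ZtE: "qf N (Z_trunc s (r l)) x = (cmod (\<Sum>k<N. r l k * complex_of_real (s k) * x k))\<^sup>2" if "l < n" for l
  proof -
    have "Z_trunc s (r l) = outer s (r l)" using good that by (auto simp: Z_trunc_def good_def)
    then show ?thesis by (simp only: qf_outer wv_repr[OF x])
  qed
  have Xsupp: "msupp N (X_trunc s r)"
  proof -
    have "msupp N (Z_trunc s (r l))" for l using outer_supp[of s "r l"] by (auto simp: Z_trunc_def msupp_def)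
    then show ?thesis using S.mean_Z_supp unfolding E by (auto simp: X_trunc_def msupp_def E_def)
  qed
  have Xadj: "madj (X_trunc s r) = X_trunc s r"
  proof (intro ext)
    fix i j
    have "cnj (Z_trunc s a j i) = Z_trunc s a i j" for a by (simp add: Z_trunc_def outer_def mult.commute)
    moreover have "cnj (E j i) = E i j" using S.mean_Z_adj unfolding E by (metis madj_def)
    ultimately show "madj (X_trunc s r) i j = X_trunc s r i j"
      unfolding madj_def X_trunc_def E_def by simp
  qed
  have c: "0 < \<delta> * real n / 2" using \<delta> n by simp
  have X_le: "\<bar>qf N (X_trunc s r) x\<bar> \<le> \<delta> * real n / 2 * nrm2 N x"
    using good by (intro qf_le_of_power[OF Xsupp Xadj c q]) (simp add: good_def)
  have qf_sum: "qf N (\<lambda>i j. (\<Sum>l<n. Z_trunc s (r l) i j) - of_nat n * E i j) x = (\<Sum>l<n. qf N (Z_trunc s (r l)) x) - real n * qf N E x"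
  proof -
    have "mvec N (\<lambda>i j. (\<Sum>l<n. Z_trunc s (r l) i j) - of_nat n * E i j) x
        = (\<lambda>i. (\<Sum>l<n. mvec N (Z_trunc s (r l)) x i) - of_nat n * mvec N E x i)"
    proof
      fix i
      have "(\<Sum>j<N. (\<Sum>l<n. Z_trunc s (r l) i j) * x j) = (\<Sum>l<n. \<Sum>j<N. Z_trunc s (r l) i j * x j)"
        unfolding sum_distrib_right by (rule sum.swap)
      then show "mvec N (\<lambda>i j. (\<Sum>l<n. Z_trunc s (r l) i j) - of_nat n * E i j) x i
          = (\<Sum>l<n. mvec N (Z_trunc s (r l)) x i) - of_nat n * mvec N E x i"
        by (simp add: mvec_def left_diff_distrib sum_subtractf sum_distrib_left mult.assoc)
    qed
    then show ?thesis
      unfolding qf_def by (simp add: ip_diff_left ip_sum_left ip_scale_left)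
  qed
  have X_eq: "qf N (X_trunc s r) x = (\<Sum>l<n. (cmod (\<Sum>k<N. r l k * complex_of_real (s k) * x k))\<^sup>2) - real n * qf N E x"
    using qf_sum ZtE unfolding X_trunc_def E_def by simp
  define e where "e = nrm2 N x"
  have e: "0 \<le> e" by (simp add: e_def nrm2_nonneg)
  define B where "B = (\<lambda>i j. x i * cnj (x j))"
  have qE: "qf N E x = (\<integral>y. qf N (Z_trunc s (row y)) x \<partial>\<nu>)"
    unfolding qf_eq_hs E_def by (rule hs_mean[OF bmeas_integrable[OF bmeas_Z_trunc]])
  have int_Z: "integrable \<nu> (\<lambda>y. qf N (Z_trunc s (row y)) x)"
    unfolding qf_eq_hs by (rule bmeas_integrable[OF bmeas_hs[OF bmeas_Z_trunc bmeas_const]])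
  have bq: "bmeas \<nu> (\<lambda>y. qf N (outer s (row y)) x)"
    unfolding qf_eq_hs by (rule bmeas_hs[OF bmeas_outer bmeas_const])
  note int_o = bmeas_integrable[OF bq]
  have "(\<integral>y. qf N (outer s (row y)) x \<partial>\<nu>) = qf N (\<lambda>i j. complex_of_real (p i j)) x"
    using hs_mean[OF bmeas_integrable[OF bmeas_outer[of s]], where B = "\<lambda>i j. x i * cnj (x j)"]
    unfolding qf_eq_hs by (simp only: outer_mean[OF s])
  also have "\<dots> = e"
    unfolding qf_def e_def nrm2_ip ip_def using x by (intro arg_cong[where f = Re] sum.cong) auto
  finally have "e - qf N E x = (\<integral>y. qf N (outer s (row y)) x - qf N (Z_trunc s (row y)) x \<partial>\<nu>)"
    unfolding qE using int_Z int_o by simp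
  moreover have "qf N (outer s a) x - qf N (Z_trunc s a) x = (if nrm2 N (wv s a) > R then qf N (outer s a) x else 0)" for a
    by (simp add: Z_trunc_def qf_def mvec_def ip_def)
  \<comment> \<open>The bias of the truncated mean on \<open>x\<close>; it lies between 0 and
    \<open>tail s\<close> times the squared norm, by Cauchy-Schwarz.\<close>
  ultimately have diff: "e - qf N E x = (\<integral>y. (if nrm2 N (wv s (row y)) > R then qf N (outer s (row y)) x else 0) \<partial>\<nu>)"
    by simp
  have lower: "0 \<le> e - qf N E x"
    unfolding diff by (intro integral_nonneg_AE AE_I2) (simp add: qf_outer)
  have gt: "Measurable.pred \<nu> (\<lambda>y. nrm2 N (wv s (row y)) > R)"
    using pred_nrm2_wv[of s] by (simp flip: not_le)
  have upper: "e - qf N E x \<le> tail s * e"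
  proof -
    have "(if nrm2 N (wv s a) > R then qf N (outer s a) x else 0)
        \<le> (if nrm2 N (wv s a) > R then nrm2 N (wv s a) else 0) * e" for a
    proof -
      have "cmod (\<Sum>j<N. wv s a j * x j) \<le> (\<Sum>j<N. cmod (wv s a j) * cmod (x j))"
        by (rule order_trans[OF norm_sum]) (simp add: norm_mult)
      then have "(cmod (\<Sum>j<N. wv s a j * x j))\<^sup>2 \<le> (\<Sum>j<N. cmod (wv s a j) * cmod (x j))\<^sup>2"
        by (intro power_mono) auto
      also have "\<dots> \<le> nrm2 N (wv s a) * e" unfolding nrm2_def e_def by (rule Cauchy_Schwarz_ineq_sum)
      finally show ?thesis by (simp add: qf_outer)
    qed
    then have "e - qf N E x \<le> (\<integral>y. (if nrm2 N (wv s (row y)) > R then nrm2 N (wv s (row y)) else 0) * e \<partial>\<nu>)"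
      unfolding diff
      by (intro integral_mono bmeas_integrable bmeas_mult bmeas_const bmeas_if gt bmeas_nrm2_wv bq) auto
    then show ?thesis by (simp add: tail_def)
  qed
  have "tail s * e \<le> \<delta> / 2 * e" using good e by (intro mult_right_mono) (simp_all add: good_def)
  then have up: "real n * (e - qf N E x) \<le> real n * (\<delta> / 2 * e)" using upper by (intro mult_left_mono) auto
  have lo: "0 \<le> real n * (e - qf N E x)" using lower by simp
  define S where "S = (\<Sum>l<n. (cmod (\<Sum>k<N. r l k * complex_of_real (s k) * x k))\<^sup>2)"
  \<comment> \<open>Fluctuation minus bias.\<close>
  have "S - real n * e = qf N (X_trunc s r) x - real n * (e - qf N E x)"
    unfolding X_eq S_def by (simp add: right_diff_distrib)
  moreover have "\<bar>qf N (X_trunc s r) x\<bar> \<le> real n * (\<delta> / 2 * e)" using X_le by (simp add: e_def mult_ac)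
  moreover have "\<delta> * real n * e = real n * (\<delta> / 2 * e) + real n * (\<delta> / 2 * e)" by simp
  ultimately have "\<bar>S - real n * e\<bar> \<le> \<delta> * real n * e" using up lo by linarith
  then show ?thesis by (simp only: S_def e_def)
qed

section \<open>Failure probability for fixed signs\<close>

definition row_moment :: "(nat \<Rightarrow> real) \<Rightarrow> real"
  where "row_moment s = (\<integral>x. nrm2 N (wv s (row x)) ^ q \<partial>\<nu>)"

lemma row_moment_int: "integrable \<nu> (\<lambda>x. nrm2 N (wv s (row x)) ^ q)"
  by (intro bmeas_integrable bmeas_power bmeas_nrm2_wv)

lemma row_moment_nonneg: "0 \<le> row_moment s"
  unfolding row_moment_def by (intro integral_nonneg_AE AE_I2) (simp add: nrm2_nonneg)

lemma tail_le: "tail s \<le> row_moment s / R ^ (q - 1)"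
proof -
  have gt: "Measurable.pred \<nu> (\<lambda>y. nrm2 N (wv s (row y)) > R)"
    using pred_nrm2_wv[of s] by (simp flip: not_le)
  have "(if u > R then u else 0) \<le> u ^ q / R ^ (q - 1)" if "0 \<le> u" for u
  proof (cases "u > R")
    case True
    have "u * R ^ (q - 1) \<le> u * u ^ (q - 1)"
      using True R that by (intro mult_left_mono power_mono) auto
    also have "\<dots> = u ^ q" using q by (simp flip: power_Suc)
    finally show ?thesis using True R by (simp add: pos_le_divide_eq)
  qed (use that R in simp)
  then have "tail s \<le> (\<integral>x. nrm2 N (wv s (row x)) ^ q / R ^ (q - 1) \<partial>\<nu>)"
    unfolding tail_def
    by (intro integral_mono bmeas_integrable[OF bmeas_if[OF bmeas_nrm2_wv gt]] integrable_divide_zero row_moment_int)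
      (auto simp: nrm2_nonneg)
  then show ?thesis by (simp add: row_moment_def)
qed

lemma exceed_le: "measure \<nu> {x \<in> space \<nu>. nrm2 N (wv s (row x)) > R} \<le> row_moment s / R ^ q"
proof -
  have [measurable]: "(\<lambda>x. nrm2 N (wv s (row x))) \<in> borel_measurable \<nu>"
    using bmeas_nrm2_wv by (simp add: bmeas_def)
  have "measure \<nu> {x \<in> space \<nu>. nrm2 N (wv s (row x)) > R}
      \<le> measure \<nu> {x \<in> space \<nu>. R ^ q \<le> nrm2 N (wv s (row x)) ^ q}"
    using R by (intro finite_measure_mono) (auto intro!: power_mono)
  also have "\<dots> \<le> row_moment s / R ^ q"
    unfolding row_moment_def using R row_moment_int
    by (intro integral_Markov_inequality_measure[of _ _ "{}"]) (auto simp: nrm2_nonneg)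
  finally show ?thesis .
qed

text \<open>Interchanging the finite sign average with the integral leaves a single fixed row, to
  which \<open>sign_moment\<close> applies.\<close>

lemma savg_row_moment: "savg N row_moment \<le> (2 * K\<^sup>2 * (D + 8 * real q)) ^ q"
proof -
  have "savg N row_moment = (\<integral>x. savg N (\<lambda>s. nrm2 N (wv s (row x)) ^ q) \<partial>\<nu>)"
    unfolding savg_def row_moment_def using row_moment_int by simp
  also have "\<dots> \<le> (\<integral>x. (2 * K\<^sup>2 * (D + 8 * real q)) ^ q \<partial>\<nu>)"
  proof (rule integral_mono)
    show "integrable \<nu> (\<lambda>x. savg N (\<lambda>s. nrm2 N (wv s (row x)) ^ q))"
      unfolding savg_def using row_moment_int by simp
  qed (use sign_moment \<phi>_bound in auto)
  finally show ?thesis by (simp add: prob_space)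
qed

abbreviation T :: "(nat \<Rightarrow> 'a) measure"
  where "T \<equiv> Pi\<^sub>M {..<n} (\<lambda>_. \<nu>)"

lemma row_measurable: "l < n \<Longrightarrow> bmeas \<nu> f \<Longrightarrow> (\<lambda>t. f (t l)) \<in> borel_measurable T"
  unfolding bmeas_def by (auto intro: measurable_compose[OF measurable_component_singleton])

lemma moment_event:
  assumes s: "s \<in> signs N" and size: "2 * real q * R \<le> real n"
  defines "h \<equiv> \<lambda>t. hs N (mpow N (X_trunc s (\<lambda>l. row (t l))) q) (mpow N (X_trunc s (\<lambda>l. row (t l))) q)"
  shows "h \<in> borel_measurable T"
    and "measure T {t \<in> space T. (\<delta> * real n / 2) ^ (2 * q) \<le> h t} \<le> D * (40 * real q * R / (\<delta>\<^sup>2 * real n)) ^ q"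
proof -
  interpret S: rank_one_sample \<nu> N n "\<lambda>x. Z_trunc s (row x)"
    "\<lambda>x. if nrm2 N (wv s (row x)) \<le> R then nrm2 N (wv s (row x)) else 0" R D
    by (rule rank_one_sample[OF s])
  have SX: "S.X t = X_trunc s (\<lambda>l. row (t l))" for t
    by (simp add: S.X_def X_trunc_def S.mean_Z_def)
  \<comment> \<open>\<open>rs\<close> forgets the spare coordinate: \<open>S.moment\<close> is an
    integral over \<open>n + 1\<close> samples, while the event concerns \<open>n\<close>.\<close>
  define rs where "rs = (\<lambda>\<omega> :: nat \<Rightarrow> 'a. \<lambda>i\<in>{..<n}. \<omega> i)"
  have distr: "distr S.Q T rs = T"
    unfolding rs_def using distr_PiM_reindex[of "{..n}" "\<lambda>_. \<nu>" "\<lambda>i. i" "{..<n}"] prob_space_axioms by auto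
  have rs: "rs \<in> measurable S.Q T"
    unfolding rs_def by (intro measurable_restrict measurable_component_singleton) auto
  have h_rs: "h (rs t) = h t" for t by (simp add: h_def rs_def X_trunc_def)
  have X_meas: "(\<lambda>t. X_trunc s (\<lambda>l. row (t l)) i j) \<in> borel_measurable T" for i j
    unfolding X_trunc_def by (intro borel_measurable_diff borel_measurable_sum borel_measurable_const row_measurable[OF _ bmeas_Z_trunc]) simp
  have mm_meas: "(\<lambda>t. mm N (A t) (B t) i j) \<in> borel_measurable T"
    if "\<And>i j. (\<lambda>t. A t i j) \<in> borel_measurable T" "\<And>i j. (\<lambda>t. B t i j) \<in> borel_measurable T" for A B i j
    unfolding mm_def by (intro borel_measurable_sum borel_measurable_times that)
  have pow_meas: "(\<lambda>t. mpow N (X_trunc s (\<lambda>l. row (t l))) k i j) \<in> borel_measurable T" for k i j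
  proof (induction k arbitrary: i j)
    case (Suc k)
    then show ?case unfolding mpow_Suc by (intro mm_meas X_meas)
  qed (simp add: mpow_def)
  have cnj_meas: "(\<lambda>t. cnj (g t)) \<in> borel_measurable T" if "g \<in> borel_measurable T" for g
    using borel_measurable_continuous_on[of cnj g T] that by (auto intro: continuous_on_cnj continuous_on_id)
  show h: "h \<in> borel_measurable T"
    unfolding h_def hs_def
    by (intro borel_measurable_sum measurable_compose[OF _ borel_measurable_Re] borel_measurable_times cnj_meas pow_meas)
  have int_Q: "integrable S.Q h"
  proof -
    interpret Q: prob_space S.Q by (rule S.prob_space_Q)
    show ?thesis unfolding h_def SX[symmetric]
      by (rule Q.bmeas_integrable[OF bmeas_hs[OF S.mpow_X_bmeas S.mpow_X_bmeas]])
  qed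
  have "integrable (distr S.Q T rs) h"
    using int_Q by (subst integrable_distr_eq[OF rs h]) (simp add: h_rs)
  then have int_T: "integrable T h" by (simp only: distr)
  have "(\<integral>t. h t \<partial>T) = (\<integral>t. h (rs t) \<partial>S.Q)"
    by (subst distr[symmetric]) (rule integral_distr[OF rs h])
  also have "\<dots> = S.moment q" by (simp add: h_rs S.moment_def SX) (simp add: h_def)
  also have "\<dots> \<le> D * (10 * real q * R * real n) ^ q"
    by (rule S.moment_bound[OF q size D])
  finally have bound: "(\<integral>t. h t \<partial>T) \<le> D * (10 * real q * R * real n) ^ q" .
  define c where "c = \<delta> * real n / 2"
  have c: "0 < c" using \<delta> n by (simp add: c_def)
  have "measure T {t \<in> space T. c ^ (2 * q) \<le> h t} \<le> (\<integral>t. h t \<partial>T) / c ^ (2 * q)"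
    using c by (intro integral_Markov_inequality_measure[OF int_T, of "{}"]) (auto simp: h_def hs_self_nonneg)
  also have "\<dots> \<le> D * (10 * real q * R * real n) ^ q / c ^ (2 * q)"
    using bound c by (intro divide_right_mono) auto
  also have "\<dots> = D * (10 * real q * R * real n / c\<^sup>2) ^ q"
    by (simp add: power_divide power_mult)
  \<comment> \<open>\<open>c^2\<close> is a quarter of \<open>\<delta>^2 n^2\<close>, which turns 10
    into 40.\<close>
  also have "10 * real q * R * real n / c\<^sup>2 = 40 * real q * R / (\<delta>\<^sup>2 * real n)"
    using n \<delta> by (simp add: c_def power2_eq_square field_simps)
  finally show "measure T {t \<in> space T. (\<delta> * real n / 2) ^ (2 * q) \<le> h t} \<le> D * (40 * real q * R / (\<delta>\<^sup>2 * real n)) ^ q"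
    by (simp only: c_def)
qed

theorem bad_prob:
  assumes s: "s \<in> signs N" and size: "2 * real q * R \<le> real n"
  shows "measure T {t \<in> space T. \<not> good s (\<lambda>l. row (t l))}
    \<le> (2 * R / \<delta> + real n) * row_moment s / R ^ q + D * (40 * real q * R / (\<delta>\<^sup>2 * real n)) ^ q"
proof -
  interpret T: prob_space T by (intro prob_space_PiM prob_space_axioms)
  have pos: "0 \<le> row_moment s / R ^ q" "0 \<le> D * (40 * real q * R / (\<delta>\<^sup>2 * real n)) ^ q"
    using row_moment_nonneg R D by auto
  define y1 where "y1 = 2 * R / \<delta> * (row_moment s / R ^ q)"
  define y2 where "y2 = real n * (row_moment s / R ^ q)"
  define z where "z = D * (40 * real q * R / (\<delta>\<^sup>2 * real n)) ^ q"
  have rhs: "(2 * R / \<delta> + real n) * row_moment s / R ^ q = y1 + y2"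
    by (simp add: y1_def y2_def distrib_right add_divide_distrib)
  have nn: "0 \<le> y1" "0 \<le> y2" "0 \<le> z"
    unfolding y1_def y2_def z_def using R \<delta> by (intro mult_nonneg_nonneg pos; simp)+
  show ?thesis
    unfolding rhs z_def[symmetric]
  \<comment> \<open>\<open>tail s\<close> does not depend on the sample. If it is too large,
    \<open>tail_le\<close> forces \<open>1 \<le> y1\<close> and the claim is trivial.\<close>
  proof (cases "tail s \<le> \<delta> / 2")
    case False
    then have "\<delta> / 2 < row_moment s / R ^ (q - 1)" using tail_le[of s] by linarith
    also have "\<dots> = R * (row_moment s / R ^ q)" using q R by (cases q) auto
    finally have "\<delta> \<le> 2 * R * (row_moment s / R ^ q)" by linarith
    then have "1 \<le> 2 * R * (row_moment s / R ^ q) / \<delta>" using \<delta> by (subst le_divide_eq_1_pos) auto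
    then have "1 \<le> y1" unfolding y1_def by (simp add: mult.commute)
    moreover have "measure T {t \<in> space T. \<not> good s (\<lambda>l. row (t l))} \<le> 1" by (rule T.prob_le_1)
    ultimately show "measure T {t \<in> space T. \<not> good s (\<lambda>l. row (t l))} \<le> y1 + y2 + z" using nn by linarith
  next
    case True
    define h where "h = (\<lambda>t. hs N (mpow N (X_trunc s (\<lambda>l. row (t l))) q) (mpow N (X_trunc s (\<lambda>l. row (t l))) q))"
    define A where "A l = {t \<in> space T. nrm2 N (wv s (row (t l))) > R}" for l
    define B where "B = {t \<in> space T. (\<delta> * real n / 2) ^ (2 * q) \<le> h t}"
    have [measurable]: "h \<in> borel_measurable T" unfolding h_def by (rule moment_event(1)[OF s size])
    have wm: "(\<lambda>t. nrm2 N (wv s (row (t l)))) \<in> borel_measurable T" if "l < n" for l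
      by (rule row_measurable[OF that bmeas_nrm2_wv])
    have B_meas: "B \<in> sets T" unfolding B_def by measurable
    have A_meas: "A l \<in> sets T" if "l < n" for l
      unfolding A_def using wm[OF that] by measurable
    have wn: "(\<lambda>x. nrm2 N (wv s (row x))) \<in> borel_measurable \<nu>"
      using bmeas_nrm2_wv by (simp add: bmeas_def)
    have A_le: "measure T (A l) \<le> row_moment s / R ^ q" if l: "l < n" for l
    proof -
      have "distr T \<nu> (\<lambda>t. t l) = \<nu>"
        by (rule distr_PiM_component) (use l prob_space_axioms in auto)
      moreover have "measure (distr T \<nu> (\<lambda>t. t l)) {x \<in> space \<nu>. nrm2 N (wv s (row x)) > R}
          = measure T ((\<lambda>t. t l) -` {x \<in> space \<nu>. nrm2 N (wv s (row x)) > R} \<inter> space T)"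
        using l wn by (intro measure_distr measurable_component_singleton) (auto intro!: borel_measurable_less simp: pred_def)
      moreover have "(\<lambda>t. t l) -` {x \<in> space \<nu>. nrm2 N (wv s (row x)) > R} \<inter> space T = A l"
        using l by (auto simp: A_def space_PiM PiE_def Pi_def)
      ultimately show ?thesis using exceed_le[of s] by simp
    qed
    have "measure T {t \<in> space T. \<not> good s (\<lambda>l. row (t l))} \<le> measure T ((\<Union>l<n. A l) \<union> B)"
    proof (rule T.finite_measure_mono)
      show "{t \<in> space T. \<not> good s (\<lambda>l. row (t l))} \<subseteq> (\<Union>l<n. A l) \<union> B"
        using True by (auto simp: good_def A_def B_def h_def)
      show "(\<Union>l<n. A l) \<union> B \<in> sets T" using A_meas B_meas by auto
    qed
    also have "\<dots> \<le> measure T (\<Union>l<n. A l) + measure T B"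
      using A_meas B_meas by (intro measure_Un_le) auto
    also have "measure T (\<Union>l<n. A l) \<le> (\<Sum>l<n. measure T (A l))"
      using A_meas by (intro T.finite_measure_subadditive_finite) auto
    also have "\<dots> \<le> (\<Sum>l<n. row_moment s / R ^ q)" using A_le by (intro sum_mono) auto
    also have "\<dots> = y2" by (simp add: y2_def)
    also have "measure T B \<le> z"
      unfolding B_def h_def z_def by (rule moment_event(2)[OF s size])
    finally show "measure T {t \<in> space T. \<not> good s (\<lambda>l. row (t l))} \<le> y1 + y2 + z" using nn by simp
  qed
qed

end

section \<open>Affinities of subspaces of \<open>carrier_vec m\<close>\<close>

text \<open>The bridge from functions on indices, in which the estimates are made, to vectors with
  explicit carriers.\<close>

definition vspan :: "nat \<Rightarrow> nat \<Rightarrow> (nat \<Rightarrow> nat \<Rightarrow> 'a :: comm_ring_1) \<Rightarrow> 'a vec set"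
  where "vspan m d c = {vec m f | f. f \<in> fspan d c}"

unbundle no vec_syntax

lemma vspanI: "vec m (\<lambda>i. \<Sum>k<d. a k * c k i) \<in> vspan m d c"
  unfolding vspan_def fspan_def by auto

lemma vspanE:
  assumes "v \<in> vspan m d c"
  obtains a where "v = vec m (\<lambda>i. \<Sum>k<d. a k * c k i)"
  using assms unfolding vspan_def fspan_def by auto

lemma mult_mat_vec_fun:
  assumes "x \<in> carrier_vec m" "i < k"
  shows "(Matrix.mat k m (\<lambda>(i, j). p i j) *\<^sub>v x) $ i = mvec m p (\<lambda>j. x $ j) i"
  using assms by (simp add: mult_mat_vec_def scalar_prod_def mvec_def lessThan_atLeast0)

lemma cscalar_prod_fun:
  assumes "x \<in> carrier_vec m" "y \<in> carrier_vec m"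
  shows "x \<bullet>c y = ip m (\<lambda>j. x $ j) (\<lambda>j. y $ j)"
  using assms by (simp add: scalar_prod_def ip_def lessThan_atLeast0)

text \<open>A definite description also needs uniqueness: the difference of two candidates for the
  projection of \<open>x\<close> lies in the span and is orthogonal to it.\<close>

lemma orth_proj_vspan:
  fixes c :: "nat \<Rightarrow> nat \<Rightarrow> 'a :: conjugatable_ordered_field"
  shows "orth_proj m (vspan m d c) = Matrix.mat m m (\<lambda>(i, j). gsp m c d i j)"
proof -
  define P where "P = Matrix.mat m m (\<lambda>(i, j). gsp m c d i j)"
  define ok where "ok Q \<longleftrightarrow> Q \<in> carrier_mat m m \<and>
     (\<forall>x\<in>carrier_vec m. Q *\<^sub>v x \<in> vspan m d c \<and> (\<forall>w\<in>vspan m d c. (x - Q *\<^sub>v x) \<bullet>c w = 0))" for Q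
  have okP: "ok P"
    unfolding ok_def
  proof (intro conjI ballI)
    show P: "P \<in> carrier_mat m m" by (simp add: P_def)
    fix x :: "'a vec" assume x: "x \<in> carrier_vec m"
    have Px: "P *\<^sub>v x = vec m (mvec m (gsp m c d) (\<lambda>j. x $ j))"
      using mult_mat_vec_fun[OF x, of _ m "gsp m c d"] by (intro eq_vecI) (auto simp: P_def)
    show "P *\<^sub>v x \<in> vspan m d c"
      unfolding Px vspan_def using mvec_gsp_in_span by blast
    fix w assume "w \<in> vspan m d c"
    then obtain f where f: "f \<in> fspan d c" "w = vec m f" by (auto simp: vspan_def)
    have "(x - P *\<^sub>v x) \<bullet>c w = ip m (\<lambda>j. (x - P *\<^sub>v x) $ j) (\<lambda>j. w $ j)"
      using x P f by (intro cscalar_prod_fun) auto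
    also have "\<dots> = ip m (residual m (gsp m c d) (\<lambda>j. x $ j)) f"
      unfolding ip_def residual_def using x f(2) by (intro sum.cong) (auto simp: Px)
    finally show "(x - P *\<^sub>v x) \<bullet>c w = 0" by (simp add: gsp_residual_orth[OF f(1)])
  qed
  have uniq: "Q = P" if "ok Q" for Q
  proof -
    have Q: "Q \<in> carrier_mat m m" and P: "P \<in> carrier_mat m m" using that okP by (auto simp: ok_def)
    have eq: "(Q *\<^sub>v x) $ i = (P *\<^sub>v x) $ i" if x: "x \<in> carrier_vec m" and i: "i < m" for x i
    proof -
      have mem: "Q *\<^sub>v x \<in> vspan m d c" "P *\<^sub>v x \<in> vspan m d c" using \<open>ok Q\<close> okP x by (auto simp: ok_def)
      obtain f where f: "f \<in> fspan d c" "Q *\<^sub>v x = vec m f" using mem(1) by (auto simp: vspan_def)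
      obtain g where g: "g \<in> fspan d c" "P *\<^sub>v x = vec m g" using mem(2) by (auto simp: vspan_def)
      define w where "w = (\<lambda>i. f i - g i)"
      have w: "vec m w \<in> vspan m d c" unfolding w_def vspan_def using fspan_diff[OF f(1) g(1)] by blast
      have prod: "(x - A *\<^sub>v x) \<bullet>c vec m w = ip m (\<lambda>j. x $ j - (A *\<^sub>v x) $ j) w" if "A \<in> carrier_mat m m" for A
      proof -
        have "(x - A *\<^sub>v x) \<bullet>c vec m w = ip m (\<lambda>j. (x - A *\<^sub>v x) $ j) (\<lambda>j. vec m w $ j)"
          using x that by (intro cscalar_prod_fun) auto
        then show ?thesis unfolding ip_def using x that by (auto intro!: sum.cong)
      qed
      have "ip m (\<lambda>j. x $ j - (Q *\<^sub>v x) $ j) w = 0" "ip m (\<lambda>j. x $ j - (P *\<^sub>v x) $ j) w = 0"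
        using prod[OF Q] prod[OF P] \<open>ok Q\<close> okP x w by (auto simp: ok_def)
      then have "ip m (\<lambda>j. (x $ j - (P *\<^sub>v x) $ j) - (x $ j - (Q *\<^sub>v x) $ j)) w = 0"
        unfolding ip_diff_left by simp
      moreover have "ip m (\<lambda>j. (x $ j - (P *\<^sub>v x) $ j) - (x $ j - (Q *\<^sub>v x) $ j)) w = ip m w w"
        unfolding ip_def f(2) g(2) by (intro sum.cong) (auto simp: w_def)
      ultimately have "w i = 0" using i by (simp add: ip_self_eq_0_iff)
      then show ?thesis using i by (simp add: f(2) g(2) w_def)
    qed
    show ?thesis
    proof (rule eq_matI)
      fix i j assume ij: "i < dim_row P" "j < dim_col P"
      then have ij': "i < m" "j < m" using P by auto
      have "(A *\<^sub>v unit_vec m j) $ i = A $$ (i, j)" if "A \<in> carrier_mat m m" for A :: "'a mat"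
        using that ij' by (simp add: mult_mat_vec_def scalar_prod_right_unit)
      then show "Q $$ (i, j) = P $$ (i, j)" using eq[of "unit_vec m j" i] ij' Q P by simp
    qed (use Q P in auto)
  qed
  have "orth_proj m (vspan m d c) = (THE Q. ok Q)" by (simp add: orth_proj_def ok_def)
  also have "\<dots> = P" using okP uniq by (rule the_equality)
  finally show ?thesis by (simp add: P_def)
qed

lemma mat_trace_mult:
  "mat_trace (Matrix.mat m m (\<lambda>(i, j). f i j) * Matrix.mat m m (\<lambda>(i, j). g i j)) = (\<Sum>i<m. \<Sum>j<m. f i j * (g j i :: 'a :: comm_ring_1))"
  by (simp add: mat_trace_def scalar_prod_def lessThan_atLeast0)

text \<open>The dimension is that of a restricted structure. An independent subset of largest size
  exists because sizes are bounded by the ambient dimension, and it is a basis of this structure.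
  Independence is passed on as nonzero Gram-Schmidt residuals, ready to be normalised.\<close>

lemma is_subspace_basis:
  fixes W :: "'a :: conjugatable_ordered_field vec set"
  assumes "is_subspace m W"
  obtains b where "W = vspan m (subspace_dim m W) b" "\<And>k i. m \<le> i \<Longrightarrow> b k i = 0"
    "\<And>k. k < subspace_dim m W \<Longrightarrow> ip m (gsv m b k) (gsv m b k) \<noteq> 0"
proof -
  interpret V: vec_space "TYPE('a)" m .
  have sub: "VectorSpace.subspace class_ring W (module_vec TYPE('a) m)" using assms by (simp add: is_subspace_def)
  then have submod: "submodule class_ring W (module_vec TYPE('a) m)" by (simp add: VectorSpace.subspace_def)
  have W_carrier: "W \<subseteq> carrier_vec m" using submod by (auto simp: submodule_def module_vec_simps)
  define d where "d = subspace_dim m W"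
  interpret W: vectorspace class_ring "V.vs W" by (rule V.subspace_is_vs[OF sub])
  have d: "d = W.dim" by (simp add: d_def subspace_dim_def)
  have li: "W.lin_dep S = V.lin_dep S" "W.span S = V.span S" if "S \<subseteq> W" for S
    using V.span_li_not_depend[OF that submod] by auto
  define indep where "indep S \<longleftrightarrow> S \<subseteq> W \<and> \<not> V.lin_dep S" for S
  have indep_card: "finite S \<and> card S \<le> V.dim" if "indep S" for S
    using that W_carrier V.li_le_dim[of S] by (auto simp: indep_def)
  have "indep {}" by (auto simp: indep_def V.lin_dep_def)
  define k where "k = Max (card ` {S. indep S})"
  have fin: "finite (card ` {S. indep S})"
    by (rule finite_subset[of _ "{..V.dim}"]) (use indep_card in auto)
  have "k \<in> card ` {S. indep S}"
    unfolding k_def using fin \<open>indep {}\<close> by (intro Max_in) auto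
  then obtain B where B: "indep B" "card B = k" by auto
  have Bfin: "finite B" using B(1) indep_card by blast
  have Bsub: "B \<subseteq> W" "B \<subseteq> carrier_vec m" using B(1) W_carrier by (auto simp: indep_def)
  have "maximal B (\<lambda>S. S \<subseteq> carrier (V.vs W) \<and> W.lin_indpt S)"
    unfolding maximal_def
  proof (intro conjI allI impI; (elim conjE)?)
    show "B \<subseteq> carrier (V.vs W)" "W.lin_indpt B" using B(1) li(1)[OF Bsub(1)] by (auto simp: indep_def)
    fix S assume S: "B \<subseteq> S" "S \<subseteq> carrier (V.vs W)" "W.lin_indpt S"
    then have "indep S" using li(1)[of S] by (auto simp: indep_def)
    then have "finite S" "card S \<le> card B" using indep_card fin B(2) by (auto simp: k_def)
    then show "S = B" using S(1) card_seteq by blast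
  qed
  then have basis: "W.basis B" by (rule W.max_li_is_basis)
  then have dB: "d = card B" using W.dim_basis[OF Bfin] d by simp
  have W_eq: "W = {V.lincomb a B | a. True}"
  proof -
    have "W = W.span B" using basis by (simp add: W.basis_def)
    also have "\<dots> = {V.lincomb a B | a. True}"
      unfolding li(2)[OF Bsub(1)] using V.finite_span[OF Bfin] Bsub(2) by (auto simp: module_vec_simps)
    finally show ?thesis .
  qed
  obtain h where h: "bij_betw h {..<d} B"
    using ex_bij_betw_nat_finite[OF Bfin] dB by (auto simp: lessThan_atLeast0)
  have h_in: "h j \<in> B" if "j < d" for j using h that by (auto simp: bij_betw_def)
  define b where "b = (\<lambda>j i. if i < m then h j $ i else 0)"
  have lincomb: "V.lincomb a B $ i = (\<Sum>j<d. a (h j) * b j i)" if "i < m" for a i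
  proof -
    have "V.lincomb a B $ i = (\<Sum>x\<in>B. a x * x $ i)" by (rule V.lincomb_index[OF that Bsub(2)])
    also have "\<dots> = (\<Sum>j<d. a (h j) * h j $ i)" by (rule sum.reindex_bij_betw[OF h, symmetric])
    finally show ?thesis using that by (simp add: b_def)
  qed
  have lincomb_dim: "V.lincomb a B \<in> carrier_vec m" for a
    using V.lincomb_closed[of B a] Bsub(2) by (auto simp: module_vec_simps)
  have lincomb_vec: "V.lincomb a B = vec m (\<lambda>i. \<Sum>j<d. a (h j) * b j i)" for a
    using lincomb lincomb_dim[of a] by (intro eq_vecI) auto
  define g where "g = the_inv_into {..<d} h"
  have g: "g (h j) = j" if "j < d" for j
    using h that by (auto simp: g_def bij_betw_def the_inv_into_f_f)
  have lincomb_coeff: "V.lincomb (\<lambda>x. a (g x)) B = vec m (\<lambda>i. \<Sum>j<d. a j * b j i)" for a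
    unfolding lincomb_vec using g by (intro arg_cong[where f = "vec m"] ext sum.cong) auto
  show thesis
  proof (rule that)
    show "W = vspan m (subspace_dim m W) b"
    proof (intro equalityI subsetI)
      fix v assume "v \<in> W"
      then obtain a where "v = V.lincomb a B" using W_eq by auto
      then show "v \<in> vspan m (subspace_dim m W) b"
        using vspanI[where m = m and d = d and a = "\<lambda>j. a (h j)" and c = b] by (simp only: lincomb_vec d_def)
    next
      fix v assume "v \<in> vspan m (subspace_dim m W) b"
      then obtain a where "v = vec m (\<lambda>i. \<Sum>j<d. a j * b j i)"
        unfolding d_def by (rule vspanE)
      then have "v = V.lincomb (\<lambda>x. a (g x)) B" by (simp only: lincomb_coeff)
      then show "v \<in> W" by (subst W_eq) blast
    qed
    show "b j i = 0" if "m \<le> i" for j i using that by (simp add: b_def)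
    fix j assume "j < subspace_dim m W"
    then have j: "j < d" by (simp add: d_def)
    show "ip m (gsv m b j) (gsv m b j) \<noteq> 0"
    proof
      assume "ip m (gsv m b j) (gsv m b j) = 0"
      then have z: "b j i = mvec m (gsp m b j) (b j) i" if "i < m" for i
        using that by (simp add: ip_self_eq_0_iff gsv_def residual_def)
      obtain a where a: "mvec m (gsp m b j) (b j) = (\<lambda>i. \<Sum>k<j. a k * b k i)"
        using mvec_gsp_in_span[of m b j "b j"] by (auto simp: fspan_def)
      \<comment> \<open>A zero residual would express \<open>b j\<close> by the earlier vectors;
        these are the coefficients of that relation.\<close>
      define c where "c k = (if k < j then a k else if k = j then - 1 else 0)" for k
      have sum_c: "(\<Sum>k<d. c k * b k i) = 0" if "i < m" for i
      proof -
        have "(\<Sum>k<d. c k * b k i) = (\<Sum>k<Suc j. c k * b k i)"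
          using j by (intro sum.mono_neutral_right) (auto simp: c_def)
        also have "\<dots> = (\<Sum>k<j. a k * b k i) - b j i" by (simp add: c_def)
        finally show ?thesis using z[OF that] by (simp add: a)
      qed
      then have "V.lincomb (\<lambda>x. c (g x)) B = 0\<^sub>v m"
        unfolding lincomb_coeff by (intro eq_vecI) auto
      moreover have "c (g (h j)) \<noteq> 0" using g[OF j] by (simp add: c_def)
      ultimately have "V.lin_dep B"
        unfolding V.lin_dep_def using Bfin h_in[OF j]
        by (intro exI[of _ B] exI[of _ "\<lambda>x. c (g x)"] exI[of _ "h j"]) (auto simp: module_vec_simps)
      then show False using B(1) by (simp add: indep_def)
    qed
  qed
qed

text \<open>The image of a real subspace consists of real combinations only, but it contains the
  images of the \<open>b k\<close>, and these span the same complex space.\<close>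

lemma image_span_vspan:
  fixes b :: "nat \<Rightarrow> nat \<Rightarrow> real"
  assumes \<Phi>: "\<Phi> \<in> carrier_mat n N"
  shows "image_span n \<Phi> (vspan N d b) = vspan n d (\<lambda>k. mvec N (\<lambda>i j. \<Phi> $$ (i, j)) (\<lambda>i. complex_of_real (b k i)))"
proof -
  interpret V: vec_space "TYPE(complex)" n .
  define F where "F = (\<lambda>i j. \<Phi> $$ (i, j))"
  define c where "c = (\<lambda>k. mvec N F (\<lambda>i. complex_of_real (b k i)))"
  define S where "S = (\<lambda>x. \<Phi> *\<^sub>v map_vec complex_of_real x) ` vspan N d b"
  have S_eq: "S = {vec n (\<lambda>i. \<Sum>k<d. complex_of_real (a k) * c k i) | a. True}"
  proof -
    have img: "\<Phi> *\<^sub>v map_vec complex_of_real (vec N (\<lambda>i. \<Sum>k<d. a k * b k i))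
        = vec n (\<lambda>i. \<Sum>k<d. complex_of_real (a k) * c k i)" for a
    proof (rule eq_vecI)
      fix i assume "i < dim_vec (vec n (\<lambda>i. \<Sum>k<d. complex_of_real (a k) * c k i))"
      then have i: "i < n" by simp
      have "(\<Phi> *\<^sub>v map_vec complex_of_real (vec N (\<lambda>i. \<Sum>k<d. a k * b k i))) $ i
          = mvec N F (\<lambda>j. \<Sum>k<d. complex_of_real (a k) * complex_of_real (b k j)) i"
        using i \<Phi> by (simp add: mult_mat_vec_def scalar_prod_def mvec_def F_def lessThan_atLeast0)
      also have "\<dots> = (\<Sum>k<d. complex_of_real (a k) * c k i)"
        by (simp add: mvec_sum mvec_scale c_def)
      finally show "(\<Phi> *\<^sub>v map_vec complex_of_real (vec N (\<lambda>i. \<Sum>k<d. a k * b k i))) $ i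
          = vec n (\<lambda>i. \<Sum>k<d. complex_of_real (a k) * c k i) $ i" using i by simp
    qed (use \<Phi> in auto)
    have "vspan N d b = {vec N (\<lambda>i. \<Sum>k<d. a k * b k i) | a. True}"
      by (auto simp: vspan_def fspan_def)
    then show ?thesis unfolding S_def by (auto simp: img intro!: image_eqI)
  qed
  have S_mem: "vec n (\<lambda>i. \<Sum>k<d. complex_of_real (a k) * c k i) \<in> S" for a
    unfolding S_eq by auto
  have S_sub: "S \<subseteq> carrier_vec n" by (auto simp: S_eq)
  have submod: "submodule class_ring (V.span S) V.V" using S_sub by (intro V.span_is_submodule) (simp add: module_vec_simps)
  have "V.span S = vspan n d c"
  proof (intro equalityI subsetI)
    fix v assume "v \<in> V.span S"
    then obtain a A where A: "finite A" "A \<subseteq> S" "v = V.lincomb a A" by (auto simp: V.span_def)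
    have "\<exists>r. \<forall>x\<in>A. \<forall>i<n. x $ i = (\<Sum>k<d. complex_of_real (r x k) * c k i)"
    proof -
      have "\<forall>x\<in>A. \<exists>r. \<forall>i<n. x $ i = (\<Sum>k<d. complex_of_real (r k) * c k i)"
        using A(2) by (fastforce simp: S_eq)
      then show ?thesis by (rule bchoice)
    qed
    then obtain r where r: "\<And>x i. x \<in> A \<Longrightarrow> i < n \<Longrightarrow> x $ i = (\<Sum>k<d. complex_of_real (r x k) * c k i)" by blast
    have A_sub: "A \<subseteq> carrier_vec n" using A(2) S_sub by auto
    have "v = vec n (\<lambda>i. \<Sum>k<d. (\<Sum>x\<in>A. a x * complex_of_real (r x k)) * c k i)"
    proof (rule eq_vecI)
      show "dim_vec v = dim_vec (vec n (\<lambda>i. \<Sum>k<d. (\<Sum>x\<in>A. a x * complex_of_real (r x k)) * c k i))"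
        using V.lincomb_closed[of A a] A_sub A(3) by (auto simp: module_vec_simps)
      fix i assume "i < dim_vec (vec n (\<lambda>i. \<Sum>k<d. (\<Sum>x\<in>A. a x * complex_of_real (r x k)) * c k i))"
      then have i: "i < n" by simp
      have "v $ i = (\<Sum>x\<in>A. a x * x $ i)" unfolding A(3) by (rule V.lincomb_index[OF i A_sub])
      also have "\<dots> = (\<Sum>x\<in>A. \<Sum>k<d. a x * complex_of_real (r x k) * c k i)"
        using r i by (simp add: sum_distrib_left mult.assoc)
      also have "\<dots> = (\<Sum>k<d. (\<Sum>x\<in>A. a x * complex_of_real (r x k)) * c k i)"
        by (subst sum.swap) (simp add: sum_distrib_right)
      finally show "v $ i = vec n (\<lambda>i. \<Sum>k<d. (\<Sum>x\<in>A. a x * complex_of_real (r x k)) * c k i) $ i" using i by simp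
    qed
    then show "v \<in> vspan n d c" by (simp only: vspanI)
  next
    fix v assume "v \<in> vspan n d c"
    then obtain a where v: "v = vec n (\<lambda>i. \<Sum>k<d. a k * c k i)" by (rule vspanE)
    have "vec n (\<lambda>i. \<Sum>k<e. a k * c k i) \<in> V.span S" if "e \<le> d" for e
      using that
    proof (induction e)
      case 0
      have "vec n (\<lambda>i. \<Sum>k<0. a k * c k i) = 0\<^sub>v n" by (intro eq_vecI) auto
      then show ?case using V.span_zero[of S] by (simp add: module_vec_simps)
    next
      case (Suc e)
      have "vec n (c e) \<in> S"
      proof -
        have "vec n (c e) = vec n (\<lambda>i. \<Sum>k<d. complex_of_real (if k = e then 1 else 0) * c k i)"
          using Suc.prems by (intro eq_vecI) (auto simp: if_distrib[of complex_of_real] if_distrib[of "\<lambda>x. x * _"] cong: if_cong)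
        then show ?thesis by (simp only: S_mem)
      qed
      then have "vec n (c e) \<in> V.span S" using V.in_own_span[of S] S_sub by (auto simp: module_vec_simps)
      then have "a e \<cdot>\<^sub>v vec n (c e) \<in> V.span S"
        using submod by (auto simp: submodule_def module_vec_simps)
      then have "vec n (\<lambda>i. \<Sum>k<e. a k * c k i) + a e \<cdot>\<^sub>v vec n (c e) \<in> V.span S"
        using submod Suc by (auto simp: submodule_def module_vec_simps)
      moreover have "vec n (\<lambda>i. \<Sum>k<e. a k * c k i) + a e \<cdot>\<^sub>v vec n (c e) = vec n (\<lambda>i. \<Sum>k<Suc e. a k * c k i)"
        by (intro eq_vecI) auto
      ultimately show ?case by simp
    qed
    then show "v \<in> V.span S" unfolding v by simp
  qed
  then show ?thesis by (simp add: image_span_def S_def c_def F_def)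
qed

section \<open>Orthonormal bases and affinities as traces\<close>

lemma fspan_subset:
  assumes "\<And>k. k < d \<Longrightarrow> c k \<in> fspan e b"
  shows "fspan d c \<subseteq> fspan e b"
proof
  fix x assume "x \<in> fspan d c"
  then obtain a where "x = (\<lambda>i. \<Sum>k<d. a k * c k i)" by (auto simp: fspan_def)
  then show "x \<in> fspan e b" using assms by (auto intro!: fspan_sum fspan_scale)
qed

lemma mvec_gsp_expand:
  "mvec m (gsp m c d) x = (\<lambda>i. \<Sum>k<d. (ip m x (gsv m c k) / ip m (gsv m c k) (gsv m c k)) * gsv m c k i)"
proof
  fix i
  have "mvec m (gsp m c d) x i = (\<Sum>j<m. \<Sum>k<d. (x j * conjugate (gsv m c k j)) * gsv m c k i / ip m (gsv m c k) (gsv m c k))"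
    unfolding mvec_def gsp_eq_sum by (simp add: sum_distrib_right sum_distrib_left mult_ac)
  also have "\<dots> = (\<Sum>k<d. \<Sum>j<m. (x j * conjugate (gsv m c k j)) * gsv m c k i / ip m (gsv m c k) (gsv m c k))"
    by (rule sum.swap)
  also have "\<dots> = (\<Sum>k<d. (ip m x (gsv m c k) / ip m (gsv m c k) (gsv m c k)) * gsv m c k i)"
    unfolding ip_def[of m x] by (simp add: sum_distrib_right sum_divide_distrib)
  finally show "mvec m (gsp m c d) x i = (\<Sum>k<d. (ip m x (gsv m c k) / ip m (gsv m c k) (gsv m c k)) * gsv m c k i)" .
qed

text \<open>The form of \<open>orthonormal\<close> for any field with conjugation, needed for real
  bases before \<open>cfun\<close> makes them complex.\<close>

definition onb :: "nat \<Rightarrow> nat \<Rightarrow> (nat \<Rightarrow> nat \<Rightarrow> 'a :: conjugatable_field) \<Rightarrow> bool"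
  where "onb m d b \<longleftrightarrow> (\<forall>j<d. \<forall>k<d. ip m (b j) (b k) = (if j = k then 1 else 0))"

lemma gsp_onb:
  fixes b :: "nat \<Rightarrow> nat \<Rightarrow> 'a :: conjugatable_field"
  assumes "onb m d b" "e \<le> d"
  shows "gsp m b e = (\<lambda>i j. \<Sum>k<e. b k i * conjugate (b k j))"
  using assms(2)
proof (induction e)
  case (Suc e)
  have "mvec m (gsp m b e) (b e) = (\<lambda>i. 0)"
  proof
    fix i
    have "mvec m (gsp m b e) (b e) i = (\<Sum>j<m. \<Sum>k<e. b k i * (b e j * conjugate (b k j)))"
      using Suc by (simp add: mvec_def sum_distrib_right sum_distrib_left mult_ac)
    also have "\<dots> = (\<Sum>k<e. b k i * ip m (b e) (b k))"
      unfolding ip_def sum_distrib_left by (rule sum.swap)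
    also have "\<dots> = 0" using assms(1) Suc.prems by (intro sum.neutral) (auto simp: onb_def)
    finally show "mvec m (gsp m b e) (b e) i = 0" .
  qed
  then have "residual m (gsp m b e) (b e) = b e" by (simp add: residual_def)
  moreover have "ip m (b e) (b e) = 1" using assms(1) Suc.prems by (simp add: onb_def)
  ultimately show ?case using Suc by simp
qed simp

text \<open>Over the reals the nonzero Gram-Schmidt vectors can be divided by the square roots of
  their squared norms.\<close>

lemma is_subspace_onb:
  fixes W :: "real vec set"
  assumes "is_subspace m W"
  obtains b where "W = vspan m (subspace_dim m W) b" "\<And>k i. m \<le> i \<Longrightarrow> b k i = 0"
    "onb m (subspace_dim m W) b"
proof -
  define d where "d = subspace_dim m W"
  obtain c where c: "W = vspan m d c" "\<And>k i. m \<le> i \<Longrightarrow> c k i = 0"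
    "\<And>k. k < d \<Longrightarrow> ip m (gsv m c k) (gsv m c k) \<noteq> 0"
    using is_subspace_basis[OF assms] unfolding d_def by blast
  define r where "r k = sqrt (ip m (gsv m c k) (gsv m c k))" for k
  have r2: "r k * r k = ip m (gsv m c k) (gsv m c k)" for k
    by (simp add: r_def ip_def sum_nonneg)
  have r0: "r k \<noteq> 0" if "k < d" for k using c(3)[OF that] by (simp add: r_def)
  define b where "b k = (\<lambda>i. (1 / r k) * gsv m c k i)" for k
  have "fspan d c = fspan d b"
  proof (intro equalityI fspan_subset)
    fix k assume k: "k < d"
    have g: "gsv m c j \<in> fspan d b" if "j < d" for j
    proof -
      have "gsv m c j = (\<lambda>i. r j * b j i)" using r0[OF that] by (simp add: b_def)
      then show ?thesis using fspan_scale[OF fspan_member[OF that]] by metis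
    qed
    have "mvec m (gsp m c k) (c k) \<in> fspan d b"
      unfolding mvec_gsp_expand by (intro fspan_sum fspan_scale g) (use k in auto)
    moreover have "c k = (\<lambda>i. gsv m c k i + mvec m (gsp m c k) (c k) i)"
      by (simp add: gsv_def residual_def)
    ultimately show "c k \<in> fspan d b" using fspan_add[OF g[OF k]] by metis
    show "b k \<in> fspan d c"
      unfolding b_def using gsv_in_span[of m c k] fspan_mono[of "Suc k" d c] k by (intro fspan_scale) auto
  qed
  then have "W = vspan m d b" using c(1) by (simp add: vspan_def)
  moreover have "b k i = 0" if "m \<le> i" for k i
  proof -
    have "x i = 0" if "x \<in> fspan e c" for x e
      using that c(2)[OF \<open>m \<le> i\<close>] by (auto simp: fspan_def)
    then show ?thesis using gsv_in_span[of m c k] by (auto simp: b_def)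
  qed
  moreover have "onb m d b"
    unfolding onb_def
  proof (intro allI impI)
    fix j k assume jk: "j < d" "k < d"
    have eq: "ip m (b j) (b k) = (1 / r j) * ((1 / r k) * ip m (gsv m c j) (gsv m c k))"
      unfolding b_def ip_scale_left ip_scale_right by simp
    show "ip m (b j) (b k) = (if j = k then 1 else 0)"
    proof (cases "j = k")
      case True
      then show ?thesis using r0[OF jk(2)] unfolding eq by (simp flip: r2)
    next
      case False
      then show ?thesis unfolding eq by (simp add: gsv_orth)
    qed
  qed
  ultimately show thesis using that by (simp add: d_def)
qed

abbreviation cfun :: "(nat \<Rightarrow> nat \<Rightarrow> real) \<Rightarrow> nat \<Rightarrow> nat \<Rightarrow> complex"
  where "cfun b \<equiv> (\<lambda>k i. complex_of_real (b k i))"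

lemma gsp_cfun: "gsp m (cfun b) d = (\<lambda>i j. complex_of_real (gsp m b d i j))"
proof (induction d)
  case (Suc d)
  have "residual m (gsp m (cfun b) d) (cfun b d) = (\<lambda>i. complex_of_real (residual m (gsp m b d) (b d) i))"
    unfolding Suc by (intro ext) (simp add: residual_def mvec_def)
  then show ?case using Suc by (simp add: ip_def)
qed simp

lemma onb_cfun: "onb m d b \<Longrightarrow> orthonormal m d (cfun b)"
  by (auto simp: onb_def orthonormal_def ip_def simp flip: of_real_mult of_real_sum)

lemma aff_real_vspan:
  "aff_real m (vspan m d b) (vspan m e c) = sqrt (\<Sum>i<m. \<Sum>j<m. gsp m b d i j * gsp m c e j i)"
  by (simp add: aff_real_def orth_proj_vspan mat_trace_mult)

lemma aff_complex_vspan: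
  "aff_complex m (vspan m d b) (vspan m e c) = sqrt (Re (\<Sum>i<m. \<Sum>j<m. gsp m b d i j * gsp m c e j i))"
  by (simp only: aff_complex_def orth_proj_vspan mat_trace_mult)

text \<open>Squaring an affinity undoes the square root only if the trace is nonnegative. It is,
  since the residual of a unit vector has norm at most 1.\<close>

lemma gsp_trace_product_nonneg:
  assumes "orthonormal m d e"
  shows "0 \<le> Re (\<Sum>i<m. \<Sum>j<m. (\<Sum>k<d. e k i * cnj (e k j)) * gsp m c r j i)"
proof -
  have "(\<Sum>k<d. nrm2 m (residual m (gsp m c r) (e k))) \<le> (\<Sum>k<d. 1)"
  proof (rule sum_mono)
    fix k assume "k \<in> {..<d}"
    then have "nrm2 m (e k) = 1" using assms by (simp add: orthonormal_def nrm2_ip)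
    then show "nrm2 m (residual m (gsp m c r) (e k)) \<le> 1"
      using residual_best[OF fspan_zero[of r c], of m "e k"] by simp
  qed
  then show ?thesis unfolding sum_residual_eq_trace[OF assms] by simp
qed

lemma aff_preserved_half:
  assumes \<Phi>: "\<Phi> \<in> carrier_mat n N" and b1: "onb N d1 b1" and \<epsilon>: "0 < \<epsilon>" "\<epsilon> < 1"
    and iso: "\<And>x y. x \<in> fspan d1 (cfun b1) \<Longrightarrow> y \<in> fspan d2 (cfun b2) \<Longrightarrow>
      \<bar>nrm2 n (mvec N (\<lambda>i j. \<Phi> $$ (i, j)) (\<lambda>i. x i + y i)) - nrm2 N (\<lambda>i. x i + y i)\<bar> \<le> \<epsilon> / 4 * nrm2 N (\<lambda>i. x i + y i)"
  defines "X1 \<equiv> vspan N d1 b1" and "X2 \<equiv> vspan N d2 b2"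
  shows "\<bar>(aff_complex n (image_span n \<Phi> X1) (image_span n \<Phi> X2))\<^sup>2 - (aff_real N X1 X2)\<^sup>2\<bar>
    \<le> \<epsilon> * (real d1 - (aff_real N X1 X2)\<^sup>2)"
proof -
  define F where "F = (\<lambda>i j. \<Phi> $$ (i, j))"
  interpret near_isometry N n d1 d2 "cfun b1" "cfun b2" F "\<epsilon> / 4"
  proof
    show "orthonormal N d1 (cfun b1)" by (rule onb_cfun[OF b1])
    fix x y assume x: "x \<in> fspan d1 (cfun b1)" and y: "y \<in> fspan d2 (cfun b2)"
    have "(\<lambda>i. x i + (-1) * y i) = (\<lambda>i. x i - y i)" by simp
    then have "\<bar>nrm2 n (mvec N F (\<lambda>i. x i - y i)) - nrm2 N (\<lambda>i. x i - y i)\<bar> \<le> \<epsilon> / 4 * nrm2 N (\<lambda>i. x i - y i)"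
      using iso[OF x fspan_scale[OF y, of "-1"]] unfolding F_def by simp
    then show "(1 - \<epsilon> / 4) * nrm2 N (\<lambda>i. x i - y i) \<le> nrm2 n (mvec N F (\<lambda>i. x i - y i)) \<and>
      nrm2 n (mvec N F (\<lambda>i. x i - y i)) \<le> (1 + \<epsilon> / 4) * nrm2 N (\<lambda>i. x i - y i)"
      unfolding left_diff_distrib distrib_right by linarith
  qed (use \<epsilon> in auto)
  define tX where "tX = (\<Sum>i<N. \<Sum>j<N. gsp N b1 d1 i j * gsp N b2 d2 j i)"
  define tY where "tY = Re (\<Sum>i<n. \<Sum>j<n. gsp n v1 d1 i j * gsp n v2 d2 j i)"
  have tX_eq: "Re (\<Sum>i<N. \<Sum>j<N. (\<Sum>k<d1. cfun b1 k i * cnj (cfun b1 k j)) * gsp N (cfun b2) d2 j i) = tX"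
    unfolding tX_def gsp_onb[OF b1 order_refl] gsp_cfun by (simp flip: of_real_mult of_real_sum)
  have tX0: "0 \<le> tX" using gsp_trace_product_nonneg[OF u, of "cfun b2" d2] unfolding tX_eq .
  have tY0: "0 \<le> tY" using gsp_trace_product_nonneg[OF e_orthonormal, of v2 d2] unfolding tY_def gsp_v1 .
  have "\<bar>tY - tX\<bar> \<le> \<epsilon> * (real d1 - tX)"
    using trace_preserved[OF \<epsilon> refl] unfolding tX_eq tY_def .
  moreover have "(aff_real N X1 X2)\<^sup>2 = tX"
    unfolding X1_def X2_def aff_real_vspan tX_def[symmetric] using tX0 by simp
  moreover have "(aff_complex n (image_span n \<Phi> X1) (image_span n \<Phi> X2))\<^sup>2 = tY"
    unfolding X1_def X2_def image_span_vspan[OF \<Phi>] aff_complex_vspan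
      F_def[symmetric] v1_def[symmetric] v2_def[symmetric] tY_def[symmetric] using tY0 by simp
  ultimately show ?thesis by simp
qed

lemma aff_real_commute: "aff_real m (vspan m d b) (vspan m e c) = aff_real m (vspan m e c) (vspan m d b)"
  unfolding aff_real_vspan by (subst sum.swap) (simp add: mult.commute)

lemma aff_complex_commute: "aff_complex m (vspan m d b) (vspan m e c) = aff_complex m (vspan m e c) (vspan m d b)"
  unfolding aff_complex_vspan by (subst sum.swap) (simp add: mult.commute)

text \<open>The estimate by distances yields \<open>d1\<close>, and with the spaces exchanged
  \<open>d2\<close>; the affinities are symmetric.\<close>

theorem aff_preserved:
  assumes \<Phi>: "\<Phi> \<in> carrier_mat n N" and b1: "onb N d1 b1" and b2: "onb N d2 b2" and \<epsilon>: "0 < \<epsilon>" "\<epsilon> < 1"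
    and iso: "\<And>x y. x \<in> fspan d1 (cfun b1) \<Longrightarrow> y \<in> fspan d2 (cfun b2) \<Longrightarrow>
      \<bar>nrm2 n (mvec N (\<lambda>i j. \<Phi> $$ (i, j)) (\<lambda>i. x i + y i)) - nrm2 N (\<lambda>i. x i + y i)\<bar> \<le> \<epsilon> / 4 * nrm2 N (\<lambda>i. x i + y i)"
  defines "X1 \<equiv> vspan N d1 b1" and "X2 \<equiv> vspan N d2 b2"
  shows "\<bar>(aff_complex n (image_span n \<Phi> X1) (image_span n \<Phi> X2))\<^sup>2 - (aff_real N X1 X2)\<^sup>2\<bar>
    \<le> \<epsilon> * (real (min d1 d2) - (aff_real N X1 X2)\<^sup>2)"
proof -
  have 1: "\<bar>(aff_complex n (image_span n \<Phi> X1) (image_span n \<Phi> X2))\<^sup>2 - (aff_real N X1 X2)\<^sup>2\<bar>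
    \<le> \<epsilon> * (real d1 - (aff_real N X1 X2)\<^sup>2)"
    unfolding X1_def X2_def by (rule aff_preserved_half[OF \<Phi> b1 \<epsilon> iso])
  have iso': "\<bar>nrm2 n (mvec N (\<lambda>i j. \<Phi> $$ (i, j)) (\<lambda>i. y i + x i)) - nrm2 N (\<lambda>i. y i + x i)\<bar> \<le> \<epsilon> / 4 * nrm2 N (\<lambda>i. y i + x i)"
    if "y \<in> fspan d2 (cfun b2)" "x \<in> fspan d1 (cfun b1)" for x y
    using iso[OF that(2,1)] by (simp add: add.commute)
  have 2: "\<bar>(aff_complex n (image_span n \<Phi> X2) (image_span n \<Phi> X1))\<^sup>2 - (aff_real N X2 X1)\<^sup>2\<bar>
    \<le> \<epsilon> * (real d2 - (aff_real N X2 X1)\<^sup>2)"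
    unfolding X1_def X2_def by (rule aff_preserved_half[OF \<Phi> b2 \<epsilon> iso'])
  have c: "aff_real N X2 X1 = aff_real N X1 X2"
    "aff_complex n (image_span n \<Phi> X2) (image_span n \<Phi> X1) = aff_complex n (image_span n \<Phi> X1) (image_span n \<Phi> X2)"
    unfolding X1_def X2_def image_span_vspan[OF \<Phi>] by (rule aff_real_commute aff_complex_commute)+
  show ?thesis using 1 2 unfolding c by (simp add: min_def)
qed

section \<open>Measurability\<close>

lemma borel_measurable_cnj_comp: "f \<in> borel_measurable M \<Longrightarrow> (\<lambda>x. cnj (f x)) \<in> borel_measurable M"
  using borel_measurable_continuous_on[of cnj f M] by (auto intro: continuous_on_cnj continuous_on_id)

text \<open>Gram-Schmidt uses only field operations and conjugation, and division stays Borel with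
  the value 0 at 0, so no case distinction on the rank is needed.\<close>

lemma gsp_measurable:
  fixes c :: "'w \<Rightarrow> nat \<Rightarrow> nat \<Rightarrow> complex"
  assumes c: "\<And>k i. k < d \<Longrightarrow> i < m \<Longrightarrow> (\<lambda>\<omega>. c \<omega> k i) \<in> borel_measurable M"
  shows "i < m \<Longrightarrow> j < m \<Longrightarrow> (\<lambda>\<omega>. gsp m (c \<omega>) d i j) \<in> borel_measurable M"
  using c
proof (induction d arbitrary: i j)
  case (Suc d)
  have IH: "(\<lambda>\<omega>. gsp m (c \<omega>) d i j) \<in> borel_measurable M" if "i < m" "j < m" for i j
    using Suc.IH[OF that] Suc.prems(3) by simp
  have cd: "(\<lambda>\<omega>. c \<omega> d i) \<in> borel_measurable M" if "i < m" for i
    using Suc.prems(3)[of d i] that by simp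
  have r: "(\<lambda>\<omega>. residual m (gsp m (c \<omega>) d) (c \<omega> d) i) \<in> borel_measurable M" if "i < m" for i
    unfolding residual_def mvec_def using that
    by (intro borel_measurable_diff borel_measurable_sum borel_measurable_times IH cd) auto
  have "(\<lambda>\<omega>. ip m (residual m (gsp m (c \<omega>) d) (c \<omega> d)) (residual m (gsp m (c \<omega>) d) (c \<omega> d))) \<in> borel_measurable M"
    unfolding ip_def conjugate_complex_def
    by (intro borel_measurable_sum borel_measurable_times borel_measurable_cnj_comp r) auto
  then show ?case
    unfolding gsp.simps conjugate_complex_def using Suc.prems(1,2)
    by (intro borel_measurable_add IH borel_measurable_divide borel_measurable_times borel_measurable_cnj_comp r)
qed simp

lemma aff_complex_measurable:
  assumes "\<And>k i. k < d \<Longrightarrow> i < m \<Longrightarrow> (\<lambda>\<omega>. b \<omega> k i) \<in> borel_measurable M"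
    and "\<And>k i. k < e \<Longrightarrow> i < m \<Longrightarrow> (\<lambda>\<omega>. c \<omega> k i) \<in> borel_measurable M"
  shows "(\<lambda>\<omega>. aff_complex m (vspan m d (b \<omega>)) (vspan m e (c \<omega>))) \<in> borel_measurable M"
  unfolding aff_complex_vspan
  by (intro measurable_compose[OF _ borel_measurable_sqrt] measurable_compose[OF _ borel_measurable_Re] borel_measurable_sum
      borel_measurable_times gsp_measurable assms) auto

text \<open>Allows rows that come from restricted functions or from the entries of the sampling
  matrix.\<close>

lemma (in bos_sample) good_cong:
  assumes "\<And>l k. l < n \<Longrightarrow> k < N \<Longrightarrow> r l k = r' l k"
  shows "good s r = good s r'"
proof -
  have w: "wv s (r l) = wv s (r' l)" if "l < n" for l
    using assms[OF that] by (intro ext) (simp add: wv_def)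
  then have "Z_trunc s (r l) = Z_trunc s (r' l)" if "l < n" for l
    using w[OF that] by (simp only: Z_trunc_def outer_def)
  then have "X_trunc s r = X_trunc s r'" by (simp add: X_trunc_def)
  then show ?thesis using w by (simp add: good_def)
qed

text \<open>Stated for an arbitrary measurable family of rows because the event occurs on three
  spaces: the product \<open>T\<close> of samples, the probability space itself, and the product of
  matrix entries.\<close>

lemma (in bos_sample) good_measurable:
  assumes r: "\<And>l k. l < n \<Longrightarrow> k < N \<Longrightarrow> (\<lambda>\<omega>. r \<omega> l k) \<in> borel_measurable M"
  shows "{\<omega> \<in> space M. good s (r \<omega>)} \<in> sets M"
proof -
  have w: "(\<lambda>\<omega>. wv s (r \<omega> l) i) \<in> borel_measurable M" if "l < n" for l i
    unfolding wv_def using that by (intro borel_measurable_sum borel_measurable_times borel_measurable_const r) auto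
  have nw: "(\<lambda>\<omega>. nrm2 N (wv s (r \<omega> l))) \<in> borel_measurable M" if "l < n" for l
    unfolding nrm2_def by (intro borel_measurable_sum borel_measurable_power measurable_compose[OF _ borel_measurable_norm] w that)
  then have nw_le: "{\<omega> \<in> space M. nrm2 N (wv s (r \<omega> l)) \<le> R} \<in> sets M" if "l < n" for l
    using that by (intro borel_measurable_le borel_measurable_const)
  have Z: "(\<lambda>\<omega>. Z_trunc s (r \<omega> l) i j) \<in> borel_measurable M" if "l < n" for l i j
    unfolding Z_trunc_def if_distrib outer_def if_distribR
    by (intro measurable_If borel_measurable_times borel_measurable_cnj_comp w that borel_measurable_const nw_le)
  have X: "(\<lambda>\<omega>. X_trunc s (r \<omega>) i j) \<in> borel_measurable M" for i j
    unfolding X_trunc_def by (intro borel_measurable_diff borel_measurable_sum Z borel_measurable_const) auto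
  have pow: "(\<lambda>\<omega>. mpow N (X_trunc s (r \<omega>)) k i j) \<in> borel_measurable M" for k i j
  proof (induction k arbitrary: i j)
    case (Suc k)
    then show ?case unfolding mpow_Suc mm_def by (intro borel_measurable_sum borel_measurable_times X)
  qed (simp add: mpow_def)
  have "(\<lambda>\<omega>. hs N (mpow N (X_trunc s (r \<omega>)) q) (mpow N (X_trunc s (r \<omega>)) q)) \<in> borel_measurable M"
    unfolding hs_def
    by (intro borel_measurable_sum measurable_compose[OF _ borel_measurable_Re] borel_measurable_times
        borel_measurable_cnj_comp pow)
  then have "{\<omega> \<in> space M. hs N (mpow N (X_trunc s (r \<omega>)) q) (mpow N (X_trunc s (r \<omega>)) q) \<le> (\<delta> * real n / 2) ^ (2 * q)} \<in> sets M"
    by (intro borel_measurable_le borel_measurable_const)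
  moreover have "{\<omega> \<in> space M. \<forall>l<n. nrm2 N (wv s (r \<omega> l)) \<le> R} \<in> sets M"
  proof -
    have "{\<omega> \<in> space M. \<forall>l\<in>{..<n}. nrm2 N (wv s (r \<omega> l)) \<le> R} \<in> sets M"
      by (rule sets.sets_Collect_finite_All) (auto intro: nw_le)
    then show ?thesis unfolding Ball_def lessThan_iff .
  qed
  ultimately have "{\<omega> \<in> space M. (\<forall>l<n. nrm2 N (wv s (r \<omega> l)) \<le> R) \<and>
      hs N (mpow N (X_trunc s (r \<omega>)) q) (mpow N (X_trunc s (r \<omega>)) q) \<le> (\<delta> * real n / 2) ^ (2 * q)} \<in> sets M"
    by (intro sets.sets_Collect_conj)
  note core = this
  show ?thesis
  proof (cases "tail s \<le> \<delta> / 2")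
    case True
    show ?thesis using core by (simp only: good_def True simp_thms)
  next
    case False
    then have "{\<omega> \<in> space M. good s (r \<omega>)} = {}" by (simp only: good_def simp_thms) blast
    then show ?thesis by (simp only: sets.empty_sets)
  qed
qed

section \<open>Choice of the parameters\<close>

lemma cube_sum_le:
  fixes x y :: real
  assumes "0 \<le> x" "0 \<le> y"
  shows "(x + y) ^ 3 \<le> 4 * (x ^ 3 + y ^ 3)"
proof -
  have "0 \<le> 3 * ((x + y) * (x - y)\<^sup>2)" using assms by simp
  also have "\<dots> = 4 * (x ^ 3 + y ^ 3) - (x + y) ^ 3"
    by (simp add: power2_eq_square power3_eq_cube algebra_simps)
  finally show ?thesis by simp
qed

text \<open>Trades the logarithm for a small power of \<open>n\<close>. Order 6 serves for its
  square and order 4 for its product with \<open>d\<close>, both cubed later.\<close>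

lemma ln_le_root:
  fixes n :: real
  assumes "1 \<le> n" "0 < k"
  shows "3 + ln n \<le> (3 + real k) * root k n"
proof -
  have r: "1 \<le> root k n" using assms by simp
  have "ln n = ln (root k n ^ k)" using assms by (subst real_root_pow_pos) auto
  also have "\<dots> = real k * ln (root k n)" using r by (simp add: ln_realpow)
  also have "\<dots> \<le> real k * root k n"
    using ln_le_minus_one[of "root k n"] r by (intro mult_left_mono) auto
  finally show ?thesis using r by (simp add: distrib_right)
qed

text \<open>Constants: \<open>\<mu>\<close> stands for the maximum in the hypothesis on \<open>n\<close>, and \<open>\<theta> = K / \<epsilon>\<close>.
  Logarithms of \<open>n\<close> are absorbed after cubing, which is where the third powers are needed.\<close>

lemma log_terms_absorbed:
  fixes n \<theta> \<mu> C d \<kappa> :: real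
  assumes C: "1 \<le> C" and \<theta>: "1 \<le> \<theta>" and d: "1 \<le> d" and \<mu>: "d / 4 \<le> \<mu>" "d * ln d ^ 3 \<le> \<mu>"
    and n: "C * \<theta> ^ 3 * \<mu> \<le> n" "1 \<le> n" and \<kappa>: "0 \<le> \<kappa>" "10000000 \<le> \<kappa> ^ 3 * C\<^sup>2"
  shows "\<theta>\<^sup>2 * (3 + ln n)\<^sup>2 \<le> \<kappa> * n" "\<theta>\<^sup>2 * (d * (3 + ln n)) \<le> \<kappa> * n"
proof -
  define a where "a = 3 + ln n"
  have a: "0 \<le> a" using n(2) by (simp add: a_def)
  have \<mu>0: "0 < \<mu>" using d \<mu>(1) by simp
  have C\<mu>: "C * \<mu> \<le> n"
  proof -
    have "C * \<mu> * 1 \<le> C * \<mu> * \<theta> ^ 3" using C \<mu>0 \<theta> by (intro mult_left_mono) auto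
    then show ?thesis using n(1) by (simp add: mult_ac)
  qed
  have \<theta>3: "(C * \<theta> ^ 3 * \<mu>)\<^sup>2 \<le> n\<^sup>2" using n(1) C \<theta> \<mu>0 by (intro power_mono) auto
  \<comment> \<open>After cubing, \<open>\<theta>\<close> occurs to the sixth power and is paid for
    by the square of the hypothesis on \<open>n\<close>; the remaining condition on \<open>z\<close>
    is free of \<open>\<theta>\<close>.\<close>
  have key: "\<theta>\<^sup>2 * z \<le> \<kappa> * n" if z: "0 \<le> z" "z ^ 3 \<le> \<kappa> ^ 3 * C\<^sup>2 * (\<mu>\<^sup>2 * n)" for z
  proof (rule power_le_imp_le_base)
    have "(C\<^sup>2 * \<mu>\<^sup>2) * (\<theta>\<^sup>2 * z) ^ Suc 2 = (C * \<theta> ^ 3 * \<mu>)\<^sup>2 * z ^ 3"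
      by (simp add: power_mult_distrib power2_eq_square power3_eq_cube)
    also have "\<dots> \<le> n\<^sup>2 * (\<kappa> ^ 3 * C\<^sup>2 * (\<mu>\<^sup>2 * n))"
      using \<theta>3 z by (intro mult_mono) auto
    also have "\<dots> = (C\<^sup>2 * \<mu>\<^sup>2) * (\<kappa> * n) ^ Suc 2"
      by (simp add: power_mult_distrib power2_eq_square power3_eq_cube)
    finally show "(\<theta>\<^sup>2 * z) ^ Suc 2 \<le> (\<kappa> * n) ^ Suc 2"
      using C \<mu>0 by (simp only: mult_le_cancel_left_pos zero_less_power mult_pos_pos zero_less_one less_le_trans)
  qed (use \<kappa> n in auto)
  \<comment> \<open>The largest constant that arises is \<open>16 * 9^6\<close>, which is below
    \<open>10000000\<close>.\<close>
  have big: "x \<le> \<kappa> ^ 3 * C\<^sup>2 * (\<mu>\<^sup>2 * n)" if "x \<le> 10000000 * (\<mu>\<^sup>2 * n)" for x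
  proof -
    have "10000000 * (\<mu>\<^sup>2 * n) \<le> \<kappa> ^ 3 * C\<^sup>2 * (\<mu>\<^sup>2 * n)"
      using \<kappa>(2) n(2) by (intro mult_right_mono) auto
    then show ?thesis using that by linarith
  qed
  have \<mu>16: "d\<^sup>2 \<le> 16 * \<mu>\<^sup>2"
  proof -
    have "d\<^sup>2 \<le> (4 * \<mu>)\<^sup>2" using d \<mu>(1) by (intro power_mono) auto
    then show ?thesis by (simp add: power_mult_distrib)
  qed
  have "a\<^sup>2 ^ 3 \<le> 10000000 * (\<mu>\<^sup>2 * n)"
  proof -
    have "a \<le> 9 * root 6 n" using ln_le_root[OF n(2), of 6] by (simp add: a_def)
    then have "a ^ 6 \<le> (9 * root 6 n) ^ 6" using a by (intro power_mono) auto
    also have "\<dots> = 531441 * n" using n(2) by (simp add: power_mult_distrib)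
    finally have a6: "a ^ 6 \<le> 531441 * n" .
    have "1 \<le> 16 * \<mu>\<^sup>2"
      using \<mu>16 d one_le_power[of d 2] by linarith
    then have "n * 1 \<le> n * (16 * \<mu>\<^sup>2)" using n(2) by (intro mult_left_mono) auto
    then have "n \<le> 16 * (\<mu>\<^sup>2 * n)" by (simp add: mult_ac)
    moreover have "0 \<le> \<mu>\<^sup>2 * n" using n(2) by simp
    ultimately have "a ^ 6 \<le> 10000000 * (\<mu>\<^sup>2 * n)" using a6 by linarith
    then show ?thesis by (simp flip: power_mult)
  qed
  from key[OF _ big[OF this]] show "\<theta>\<^sup>2 * (3 + ln n)\<^sup>2 \<le> \<kappa> * n" by (simp add: a_def)
  have "(d * a) ^ 3 \<le> 10000000 * (\<mu>\<^sup>2 * n)"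
  \<comment> \<open>Either the logarithm of \<open>n\<close> is at most four times that of
    \<open>d\<close>, whose cube \<open>\<mu>\<close> controls, or \<open>d\<close> is at most the
    fourth root of \<open>n\<close> and three more such roots pay for the cubed logarithm.\<close>
  proof (cases "n \<le> d ^ 4")
    case True
    have "ln n \<le> ln (d ^ 4)" using True n(2) d by simp
    then have "ln n \<le> 4 * ln d" using d by (simp add: ln_realpow)
    then have "a \<le> 3 + 4 * ln d" by (simp add: a_def)
    then have "a ^ 3 \<le> (3 + 4 * ln d) ^ 3" using a by (intro power_mono) auto
    also have "\<dots> \<le> 4 * (3 ^ 3 + (4 * ln d) ^ 3)" using d by (intro cube_sum_le) auto
    finally have "d * a ^ 3 \<le> d * (108 + 256 * ln d ^ 3)"
      using d by (intro mult_left_mono) (auto simp: power_mult_distrib)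
    also have "\<dots> = 432 * (d / 4) + 256 * (d * ln d ^ 3)" by (simp add: algebra_simps)
    also have "\<dots> \<le> 688 * \<mu>" using \<mu> by linarith
    finally have da: "d * a ^ 3 \<le> 688 * \<mu>" .
    have "d\<^sup>2 * (d * a ^ 3) \<le> (16 * \<mu>\<^sup>2) * (688 * \<mu>)"
      by (rule mult_mono[OF \<mu>16 da]) (use d a in auto)
    also have "\<dots> = 11008 * \<mu>\<^sup>2 * \<mu>" by simp
    finally have d3: "d\<^sup>2 * (d * a ^ 3) \<le> 11008 * \<mu>\<^sup>2 * \<mu>" .
    have "\<mu> \<le> n" using C\<mu> mult_right_mono[OF C, of \<mu>] \<mu>0 by linarith
    then have "11008 * \<mu>\<^sup>2 * \<mu> \<le> 11008 * \<mu>\<^sup>2 * n" by (intro mult_left_mono) auto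
    note order_trans[OF d3 this]
    also have "\<dots> \<le> 10000000 * \<mu>\<^sup>2 * n" using n(2) by (intro mult_right_mono) auto
    finally show ?thesis by (simp add: power_mult_distrib power2_eq_square power3_eq_cube mult_ac)
  next
    case False
    have r: "a \<le> 7 * root 4 n" using ln_le_root[OF n(2), of 4] by (simp add: a_def)
    have "d \<le> root 4 n"
    proof -
      have "root 4 (d ^ 4) \<le> root 4 n" using False by (intro real_root_le_mono) auto
      then show ?thesis using d by (simp add: real_root_power_cancel)
    qed
    then have "d * a ^ 3 \<le> root 4 n * (7 * root 4 n) ^ 3"
      using r a d n(2) by (intro mult_mono power_mono) auto
    also have "\<dots> = 343 * root 4 n ^ 4" by (simp add: power_mult_distrib power3_eq_cube power4_eq_xxxx)
    also have "\<dots> = 343 * n" using n(2) by simp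
    finally have da: "d * a ^ 3 \<le> 343 * n" .
    have "d\<^sup>2 * (d * a ^ 3) \<le> (16 * \<mu>\<^sup>2) * (343 * n)"
      by (rule mult_mono[OF \<mu>16 da]) (use d a in auto)
    also have "\<dots> = 5488 * (\<mu>\<^sup>2 * n)" by simp
    also have "\<dots> \<le> 10000000 * (\<mu>\<^sup>2 * n)" using n(2) by (intro mult_right_mono) auto
    finally show ?thesis by (simp add: power_mult_distrib power2_eq_square power3_eq_cube mult_ac)
  qed
  from key[OF _ big[OF this]] show "\<theta>\<^sup>2 * (d * (3 + ln n)) \<le> \<kappa> * n" using d a by (simp add: a_def)
qed

text \<open>For \<open>S \<ge> 0\<close> the bound
  \<open>S + d \<le> sqrt (d^2 + n / \<theta>^2)\<close> amounts to
  \<open>S^2 + 2 * d * S \<le> n / \<theta>^2\<close>. The left side splits into squares of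
  \<open>l\<close> and of \<open>a\<close>, and their products with \<open>d\<close>: the logarithm
  of \<open>n\<close> is handled by \<open>log_terms_absorbed\<close>, \<open>l\<close> by
  \<open>\<mu>\<close>.\<close>

lemma exponent_large:
  fixes n \<theta> \<mu> d l \<Lambda> :: real
  assumes \<Lambda>: "1 \<le> \<Lambda>" and \<theta>: "1 \<le> \<theta>" and d: "1 \<le> d" and l: "0 \<le> l"
    and \<mu>: "d / 4 \<le> \<mu>" "d * ln d ^ 3 \<le> \<mu>" "d * l \<le> \<mu>" "l\<^sup>2 \<le> \<mu>"
    and n: "100000 * \<Lambda> ^ 3 * \<theta> ^ 3 * \<mu> \<le> n" "1 \<le> n"
  shows "\<Lambda> * (3 + ln n + 2 * l) \<le> sqrt (d\<^sup>2 + n / \<theta>\<^sup>2) - d"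
proof -
  define C where "C = 100000 * \<Lambda> ^ 3"
  \<comment> \<open>Chosen so that \<open>\<Lambda>\<close> cancels in
    \<open>\<kappa>^3 * C^2\<close>; this is where the cube of \<open>\<Lambda>\<close> in
    \<open>C\<close> comes from.\<close>
  define \<kappa> where "\<kappa> = 1 / (8 * \<Lambda>\<^sup>2)"
  define a where "a = 3 + ln n"
  have a: "0 \<le> a" using n(2) by (simp add: a_def)
  have \<Lambda>3: "1 \<le> \<Lambda> ^ 3" using \<Lambda> by simp
  have C: "1 \<le> C" using \<Lambda>3 by (simp add: C_def)
  have "\<kappa> ^ 3 * C\<^sup>2 = 10000000000 / 512"
    using \<Lambda> by (simp add: \<kappa>_def C_def power_mult_distrib power_divide power2_eq_square power3_eq_cube field_simps)
  then have \<kappa>: "0 \<le> \<kappa>" "10000000 \<le> \<kappa> ^ 3 * C\<^sup>2" by (simp_all add: \<kappa>_def)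
  have nC: "C * \<theta> ^ 3 * \<mu> \<le> n" using n(1) by (simp add: C_def)
  note log = log_terms_absorbed[OF C \<theta> d \<mu>(1,2) nC n(2) \<kappa>, folded a_def]
  have small: "24 * \<Lambda>\<^sup>2 * (\<theta>\<^sup>2 * z) \<le> n" if "0 \<le> z" "z \<le> \<mu>" for z
  proof -
    have c: "24 * \<Lambda>\<^sup>2 \<le> C"
    proof -
      have "24 * \<Lambda>\<^sup>2 * 1 \<le> 100000 * \<Lambda>\<^sup>2 * \<Lambda>" using \<Lambda> by (intro mult_mono) auto
      then show ?thesis by (simp add: C_def power2_eq_square power3_eq_cube)
    qed
    have t: "\<theta>\<^sup>2 * z \<le> \<theta> ^ 3 * \<mu>"
      using that \<theta> by (intro mult_mono power_increasing) auto
    have "24 * \<Lambda>\<^sup>2 * (\<theta>\<^sup>2 * z) \<le> C * (\<theta> ^ 3 * \<mu>)"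
      by (rule mult_mono[OF c t]) (use that \<theta> C in auto)
    then show ?thesis using nC by (simp add: mult.assoc)
  qed
  have s1: "24 * \<Lambda>\<^sup>2 * (\<theta>\<^sup>2 * l\<^sup>2) \<le> n" using \<mu>(4) by (intro small) auto
  have s2: "24 * \<Lambda>\<^sup>2 * (\<theta>\<^sup>2 * (d * l)) \<le> n" using \<mu>(3) d l by (intro small) auto
  have g: "8 * \<Lambda>\<^sup>2 * z \<le> n" if "z \<le> \<kappa> * n" for z
    using that \<Lambda> by (simp add: \<kappa>_def pos_le_divide_eq mult_ac)
  have s3: "8 * \<Lambda>\<^sup>2 * (\<theta>\<^sup>2 * a\<^sup>2) \<le> n" by (rule g[OF log(1)])
  have s4: "8 * \<Lambda>\<^sup>2 * (\<theta>\<^sup>2 * (d * a)) \<le> n" by (rule g[OF log(2)])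
  define S where "S = \<Lambda> * (a + 2 * l)"
  have S: "0 \<le> S" using \<Lambda> a l by (simp add: S_def)
  have "(a + 2 * l)\<^sup>2 \<le> 2 * a\<^sup>2 + 8 * l\<^sup>2"
    using zero_le_power2[of "a - 2 * l"] by (simp add: power2_eq_square algebra_simps)
  then have "S\<^sup>2 \<le> \<Lambda>\<^sup>2 * (2 * a\<^sup>2 + 8 * l\<^sup>2)"
    unfolding S_def power_mult_distrib by (intro mult_left_mono) auto
  moreover have "2 * d * S \<le> \<Lambda>\<^sup>2 * (2 * (d * a) + 4 * (d * l))"
  proof -
    have "\<Lambda> \<le> \<Lambda>\<^sup>2" using \<Lambda> by (simp add: power2_eq_square)
    then have "\<Lambda> * (2 * (d * a) + 4 * (d * l)) \<le> \<Lambda>\<^sup>2 * (2 * (d * a) + 4 * (d * l))"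
      using d a l by (intro mult_right_mono) auto
    then show ?thesis by (simp add: S_def algebra_simps)
  qed
  ultimately have "S\<^sup>2 + 2 * d * S \<le> \<Lambda>\<^sup>2 * (2 * a\<^sup>2 + 8 * l\<^sup>2) + \<Lambda>\<^sup>2 * (2 * (d * a) + 4 * (d * l))" by linarith
  then have "\<theta>\<^sup>2 * (S\<^sup>2 + 2 * d * S) \<le> \<theta>\<^sup>2 * (\<Lambda>\<^sup>2 * (2 * a\<^sup>2 + 8 * l\<^sup>2) + \<Lambda>\<^sup>2 * (2 * (d * a) + 4 * (d * l)))"
    by (intro mult_left_mono) auto
  also have "\<dots> = (8 * \<Lambda>\<^sup>2 * (\<theta>\<^sup>2 * a\<^sup>2)) / 4 + (8 * \<Lambda>\<^sup>2 * (\<theta>\<^sup>2 * (d * a))) / 4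
      + (24 * \<Lambda>\<^sup>2 * (\<theta>\<^sup>2 * l\<^sup>2)) / 3 + (24 * \<Lambda>\<^sup>2 * (\<theta>\<^sup>2 * (d * l))) / 6"
    by (simp add: algebra_simps)
  also have "\<dots> \<le> n / 4 + n / 4 + n / 3 + n / 6"
    by (intro add_mono divide_right_mono s1 s2 s3 s4) auto
  also have "\<dots> = n" by simp
  finally have "S\<^sup>2 + 2 * d * S \<le> n / \<theta>\<^sup>2" using \<theta> by (simp add: pos_le_divide_eq mult.commute)
  then have "(S + d)\<^sup>2 \<le> d\<^sup>2 + n / \<theta>\<^sup>2" by (simp add: power2_eq_square algebra_simps)
  then have "S + d \<le> sqrt (d\<^sup>2 + n / \<theta>\<^sup>2)" by (rule real_le_rsqrt)
  then show ?thesis by (simp add: S_def a_def add.assoc)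
qed

text \<open>\<open>184320\<close> is the \<open>\<Lambda>\<close> used in
  \<open>exponent_large\<close>, twice the ratio \<open>92160\<close> of the exponent to
  \<open>q\<close>: half of \<open>q\<close> beats the prefactors and the other half
  survives.\<close>

definition aff_const :: real
  where "aff_const = 100000 * 184320 ^ 3"

lemma failure_small:
  fixes d n L N :: nat and K \<epsilon> :: real
  assumes d: "1 \<le> d" and L: "1 \<le> L" and N: "2 \<le> N" and K: "1 \<le> K" and \<epsilon>: "0 < \<epsilon>" "\<epsilon> < 1"
    and n: "aff_const * K ^ 3 / \<epsilon> ^ 3 *
      Max {real d * (ln (real d) ^ 3 + ln (real L)), ln (real L) ^ 2, ln (real N) ^ 3} < real n"
  obtains q R where "1 \<le> q" "0 < R" "2 * real q * R \<le> real n" "0 < n"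
    "real L ^ 2 * ((2 * R / (\<epsilon> / 4) + real n) * (2 * K\<^sup>2 * (2 * real d + 8 * real q)) ^ q / R ^ q
      + 2 * real d * (40 * real q * R / ((\<epsilon> / 4)\<^sup>2 * real n)) ^ q)
     \<le> exp (- (1 / aff_const) * (sqrt (real d ^ 2 + \<epsilon>\<^sup>2 * real n / K\<^sup>2) - real d))"
proof -
  define \<mu> where "\<mu> = Max {real d * (ln (real d) ^ 3 + ln (real L)), ln (real L) ^ 2, ln (real N) ^ 3}"
  define \<theta> where "\<theta> = K / \<epsilon>"
  define \<Lambda> :: real where "\<Lambda> = 184320"
  have \<theta>: "1 \<le> \<theta>" using K \<epsilon> by (simp add: \<theta>_def pos_le_divide_eq)
  have ln0: "0 \<le> ln (real d)" "0 \<le> ln (real L)" using d L by auto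
  have \<mu>_ge: "real d * (ln (real d) ^ 3 + ln (real L)) \<le> \<mu>" "ln (real L) ^ 2 \<le> \<mu>" "ln (real N) ^ 3 \<le> \<mu>"
    unfolding \<mu>_def by (intro Max_ge; simp)+
  have ln2: "1 / 4 \<le> ln x ^ 3" if "2 \<le> x" for x :: real
  proof -
    have "2 / 3 \<le> ln x" using ln2_ge_two_thirds that ln_le_cancel_iff[of 2 x] by linarith
    then have "(2 / 3) ^ 3 \<le> ln x ^ 3" by (intro power_mono) auto
    then show ?thesis by (simp add: power3_eq_cube)
  qed
  have \<mu>1: "real d * ln (real d) ^ 3 \<le> \<mu>" "real d * ln (real L) \<le> \<mu>"
  proof -
    have "0 \<le> real d * ln (real d) ^ 3" "0 \<le> real d * ln (real L)" using ln0 by auto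
    then show "real d * ln (real d) ^ 3 \<le> \<mu>" "real d * ln (real L) \<le> \<mu>"
      using \<mu>_ge(1) unfolding distrib_left by linarith+
  qed
  \<comment> \<open>For \<open>d = 1\<close> the logarithm of \<open>d\<close> vanishes and the term
    with \<open>N\<close> takes over; \<open>1 / 4\<close> is below the cube of
    \<open>2 / 3\<close>.\<close>
  have \<mu>d: "real d / 4 \<le> \<mu>"
  proof (cases "d = 1")
    case True
    then show ?thesis using ln2[of "real N"] N \<mu>_ge(3) by simp
  next
    case False
    then have "2 \<le> real d" using d by simp
    then have "real d * (1 / 4) \<le> real d * ln (real d) ^ 3" by (intro mult_left_mono ln2) auto
    then show ?thesis using \<mu>1(1) by simp
  qed
  have nC: "aff_const * \<theta> ^ 3 * \<mu> < real n"
    using n by (simp add: \<mu>_def \<theta>_def power_divide)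
  have "1 \<le> real n"
  proof -
    have "4 * (1 / 4) \<le> aff_const * \<theta> ^ 3 * \<mu>"
    proof (rule mult_mono)
      have "1 \<le> \<theta> ^ 3" using \<theta> by simp
      then show "4 \<le> aff_const * \<theta> ^ 3" by (simp add: aff_const_def)
      show "1 / 4 \<le> \<mu>" using \<mu>d d by simp
    qed (use \<theta> in \<open>auto simp: aff_const_def\<close>)
    then show ?thesis using nC by simp
  qed
  have dn: "real d \<le> real n"
  proof -
    have "4 * (real d / 4) \<le> aff_const * \<theta> ^ 3 * \<mu>"
    proof (rule mult_mono)
      have "1 \<le> \<theta> ^ 3" using \<theta> by simp
      then show "4 \<le> aff_const * \<theta> ^ 3" by (simp add: aff_const_def)
    qed (use \<theta> \<mu>d in \<open>auto simp: aff_const_def\<close>)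
    then show ?thesis using nC by simp
  qed
  define m where "m = \<epsilon>\<^sup>2 * real n / K\<^sup>2"
  define T where "T = sqrt (real d ^ 2 + m) - real d"
  have m_eq: "m = real n / \<theta>\<^sup>2" by (simp add: m_def \<theta>_def power_divide)
  have m0: "0 \<le> m" by (simp add: m_def)
  have T_large: "\<Lambda> * (3 + ln (real n) + 2 * ln (real L)) \<le> T"
    unfolding T_def m_eq
    by (rule exponent_large[of \<Lambda> \<theta> "real d" "ln (real L)" \<mu>])
      (use \<theta> d ln0 \<mu>d \<mu>1 \<mu>_ge(2) nC \<open>1 \<le> real n\<close> in \<open>auto simp: \<Lambda>_def aff_const_def\<close>)
  have T0: "0 \<le> T"
  proof -
    have "0 \<le> \<Lambda> * (3 + ln (real n) + 2 * ln (real L))"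
      using ln0 \<open>1 \<le> real n\<close> by (simp add: \<Lambda>_def)
    then show ?thesis using T_large by linarith
  qed
  \<comment> \<open>Turns the exponent \<open>T\<close> into a product of the shape of
    \<open>q * R\<close>.\<close>
  have T_m: "T * (T + 2 * real d) = m"
  proof -
    have "(T + real d)\<^sup>2 = real d ^ 2 + m" using m0 by (simp add: T_def)
    then show ?thesis by (simp add: power2_eq_square algebra_simps)
  qed
  \<comment> \<open>\<open>92160 = 48 * 1920\<close>: \<open>q * R\<close> is at most
    \<open>48 * K^2 * q * (q + 2 * d)\<close>, and \<open>1920 = 3 * 40 * 16\<close> makes the base
    of the trace moment term at most \<open>1 / 3\<close>.\<close>
  define q where "q = nat \<lfloor>T / 92160\<rfloor>"
  have q_le: "real q \<le> T / 92160" using T0 of_int_floor_le[of "T / 92160"] by (simp add: q_def del: of_int_floor_le)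
  have q_ge: "T / 92160 - 1 \<le> real q" unfolding q_def by linarith
  have ln_n: "0 \<le> ln (real n)" using \<open>1 \<le> real n\<close> by simp
  have T6: "T / 92160 \<ge> 6 + 2 * ln (real n) + 4 * ln (real L)"
    using T_large by (simp add: \<Lambda>_def)
  have q1: "1 \<le> real q" using q_ge T6 ln0 ln_n by linarith
  \<comment> \<open>Three times the base of the chaos moment bound, so that the quotient is
    \<open>1 / 3\<close>, below \<open>exp (-1)\<close>.\<close>
  define R where "R = 6 * K\<^sup>2 * (2 * real d + 8 * real q)"
  have R: "0 < R" using K q1 by (auto simp: R_def intro!: mult_pos_pos add_nonneg_pos)
  have "real q * (real q + 2 * real d) \<le> T / 92160 * (T + 2 * real d)"
    using q_le T0 by (intro mult_mono add_mono) auto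
  then have "92160 * (real q * (real q + 2 * real d)) \<le> m" using T_m by simp
  then have "92160 * (K\<^sup>2 * (real q * (real q + 2 * real d))) \<le> \<epsilon>\<^sup>2 * real n"
    using K by (simp add: m_def pos_le_divide_eq mult_ac)
  moreover have "real q * R \<le> 48 * (K\<^sup>2 * (real q * (real q + 2 * real d)))"
    by (simp add: R_def algebra_simps)
  ultimately have qR: "1920 * (real q * R) \<le> \<epsilon>\<^sup>2 * real n" by linarith
  have \<epsilon>2: "\<epsilon>\<^sup>2 * real n \<le> \<epsilon> * real n" "\<epsilon> * real n \<le> real n"
    using \<epsilon> by (auto simp: power2_eq_square intro!: mult_right_mono mult_left_le_one_le)
  have size: "2 * real q * R \<le> real n"
  proof -
    have "0 \<le> real q * R" using R by simp
    then have "2 * (real q * R) \<le> real n" using qR \<epsilon>2 by linarith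
    then show ?thesis by simp
  qed
  have R_le: "2 * R / (\<epsilon> / 4) \<le> real n"
  proof -
    have "1 * R \<le> real q * R" using q1 R by (intro mult_right_mono) auto
    then have "8 * R \<le> \<epsilon> * real n" using qR \<epsilon>2 R by linarith
    then show ?thesis using \<epsilon> by (simp add: pos_divide_le_eq mult.commute)
  qed
  have third: "x ^ q \<le> exp (- real q)" if "0 \<le> x" "x \<le> 1 / 3" for x :: real
  proof -
    have "x \<le> exp (- 1)"
    proof -
      have "1 / 3 \<le> 1 / exp (1 :: real)" using exp_le by (intro divide_left_mono) auto
      also have "1 / exp (1 :: real) = exp (- 1)" by (simp only: exp_minus inverse_eq_divide)
      finally show ?thesis by (rule order_trans[OF that(2)])
    qed
    then have "x ^ q \<le> exp (- 1) ^ q" using that(1) by (intro power_mono)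
    also have "\<dots> = exp (- real q)" by (simp flip: exp_of_nat_mult)
    finally show ?thesis .
  qed
  have f1: "(2 * K\<^sup>2 * (2 * real d + 8 * real q)) ^ q / R ^ q \<le> exp (- real q)"
  proof -
    have "2 * K\<^sup>2 * (2 * real d + 8 * real q) = R / 3" by (simp add: R_def)
    then have "(2 * K\<^sup>2 * (2 * real d + 8 * real q)) ^ q / R ^ q = (R / 3) ^ q / R ^ q"
      by (simp only:)
    also have "\<dots> = (1 / 3) ^ q" using R by (simp add: power_divide)
    finally have "(2 * K\<^sup>2 * (2 * real d + 8 * real q)) ^ q / R ^ q = (1 / 3) ^ q" .
    then show ?thesis using third[of "1 / 3"] by simp
  qed
  have f2: "(40 * real q * R / ((\<epsilon> / 4)\<^sup>2 * real n)) ^ q \<le> exp (- real q)"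
  proof (rule third)
    show "0 \<le> 40 * real q * R / ((\<epsilon> / 4)\<^sup>2 * real n)" using R by simp
    have "0 < \<epsilon>\<^sup>2 * real n" using \<epsilon> \<open>1 \<le> real n\<close> by simp
    then show "40 * real q * R / ((\<epsilon> / 4)\<^sup>2 * real n) \<le> 1 / 3"
      using qR by (simp add: power_divide pos_divide_le_eq)
  qed
  have "(2 * R / (\<epsilon> / 4) + real n) * ((2 * K\<^sup>2 * (2 * real d + 8 * real q)) ^ q / R ^ q)
      \<le> (2 * real n) * exp (- real q)"
    using R_le f1 R K by (intro mult_mono) auto
  moreover have "2 * real d * (40 * real q * R / ((\<epsilon> / 4)\<^sup>2 * real n)) ^ q \<le> (2 * real n) * exp (- real q)"
    using dn f2 R by (intro mult_mono) auto
  ultimately have "(2 * R / (\<epsilon> / 4) + real n) * (2 * K\<^sup>2 * (2 * real d + 8 * real q)) ^ q / R ^ q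
      + 2 * real d * (40 * real q * R / ((\<epsilon> / 4)\<^sup>2 * real n)) ^ q \<le> 4 * real n * exp (- real q)" by simp
  then have "real L ^ 2 * ((2 * R / (\<epsilon> / 4) + real n) * (2 * K\<^sup>2 * (2 * real d + 8 * real q)) ^ q / R ^ q
      + 2 * real d * (40 * real q * R / ((\<epsilon> / 4)\<^sup>2 * real n)) ^ q) \<le> real L ^ 2 * (4 * real n * exp (- real q))"
    by (intro mult_left_mono) auto
  also have "\<dots> \<le> exp (2 * ln (real L)) * (exp 2 * exp (ln (real n)) * exp (- real q))"
  proof (rule mult_mono)
    have "exp (2 * ln (real L)) = real L ^ 2"
      using L by (simp add: exp_double power2_eq_square)
    then show "real L ^ 2 \<le> exp (2 * ln (real L))" by simp
    have "(4 :: real) \<le> exp 2"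
    proof -
      have "(1 + 1) * (1 + 1) \<le> exp 1 * exp (1 :: real)"
        using exp_ge_add_one_self[of 1] by (intro mult_mono) auto
      then show ?thesis by (simp flip: exp_add)
    qed
    moreover have "exp (ln (real n)) = real n" using \<open>1 \<le> real n\<close> by simp
    ultimately show "4 * real n * exp (- real q) \<le> exp 2 * exp (ln (real n)) * exp (- real q)" by simp
  qed auto
  also have "\<dots> = exp (2 * ln (real L) + 2 + ln (real n) - real q)"
    by (simp add: exp_add exp_diff exp_minus field_simps)
  also have "\<dots> \<le> exp (- (1 / aff_const) * T)"
  proof -
    \<comment> \<open>Half of \<open>T / 92160\<close> covers the logarithms and the loss from
      rounding \<open>q\<close> down.\<close>
    have "T / aff_const \<le> T / (2 * 92160)"
      using T0 by (intro divide_left_mono) (auto simp: aff_const_def)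
    then have "2 * ln (real L) + 2 + ln (real n) - real q \<le> - (T / aff_const)"
      using q_ge T6 ln_n ln0 by simp
    then show ?thesis by simp
  qed
  finally show thesis
    using that[of q R] q1 R size \<open>1 \<le> real n\<close> by (simp add: T_def m_def)
qed

section \<open>The success probability\<close>

lemma (in bos_sample) sampled_bad_prob:
  assumes P: "prob_space P" and t: "iid_sample P \<nu> n t"
  shows "measure P {\<omega> \<in> space P. \<not> good s (\<lambda>l. row (t l \<omega>))} = measure T {u \<in> space T. \<not> good s (\<lambda>l. row (u l))}"
proof -
  interpret P: prob_space P by (rule P)
  have t_meas: "t l \<in> measurable P \<nu>" if "l < n" for l
    using t that by (auto simp: iid_sample_def P.indep_vars_def)
  have "distr P T (\<lambda>\<omega>. \<lambda>l\<in>{..<n}. t l \<omega>) = Pi\<^sub>M {..<n} (\<lambda>l. distr P \<nu> (t l))"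
    using t n t_meas P.indep_vars_iff_distr_eq_PiM'[of "{..<n}" t "\<lambda>_. \<nu>"] by (auto simp: iid_sample_def)
  also have "\<dots> = T" using t by (intro PiM_cong) (auto simp: iid_sample_def)
  finally have law: "distr P T (\<lambda>\<omega>. \<lambda>l\<in>{..<n}. t l \<omega>) = T" .
  define B where "B = {u \<in> space T. \<not> good s (\<lambda>l. row (u l))}"
  have "{u \<in> space T. good s (\<lambda>l. row (u l))} \<in> sets T"
    by (intro good_measurable row_measurable bmeas_\<phi>)
  then have B: "B \<in> sets T" unfolding B_def by (rule sets.sets_Collect_neg)
  have R: "(\<lambda>\<omega>. \<lambda>l\<in>{..<n}. t l \<omega>) \<in> measurable P T"
    using t_meas by (intro measurable_restrict) auto
  have "measure T B = measure (distr P T (\<lambda>\<omega>. \<lambda>l\<in>{..<n}. t l \<omega>)) B" unfolding law ..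
  also have "\<dots> = measure P ((\<lambda>\<omega>. \<lambda>l\<in>{..<n}. t l \<omega>) -` B \<inter> space P)"
    by (rule measure_distr[OF R B])
  also have "(\<lambda>\<omega>. \<lambda>l\<in>{..<n}. t l \<omega>) -` B \<inter> space P = {\<omega> \<in> space P. \<not> good s (\<lambda>l. row (t l \<omega>))}"
  proof -
    have "good s (\<lambda>l. row ((\<lambda>l\<in>{..<n}. t l \<omega>) l)) = good s (\<lambda>l. row (t l \<omega>))" for \<omega>
      by (rule good_cong) simp
    then show ?thesis using measurable_space[OF R] unfolding B_def by blast
  qed
  finally show ?thesis unfolding B_def by simp
qed

lemma rademacher_prob:
  assumes P: "prob_space P" and \<sigma>: "iid_rademacher P N \<sigma>" and N: "0 < N" and s: "s \<in> signs N"
  shows "measure P {\<omega> \<in> space P. \<forall>k\<in>{..<N}. \<sigma> k \<omega> = s k} = 1 / 2 ^ N"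
proof -
  interpret P: prob_space P by (rule P)
  have "{\<omega> \<in> space P. \<forall>k\<in>{..<N}. \<sigma> k \<omega> = s k} = (\<Inter>k\<in>{..<N}. \<sigma> k -` {s k} \<inter> space P)"
    using N by auto
  also have "measure P \<dots> = (\<Prod>k\<in>{..<N}. measure P (\<sigma> k -` {s k} \<inter> space P))"
    using \<sigma> N by (intro P.indep_varsD[of "\<lambda>_. borel" _ "{..<N}"]) (auto simp: iid_rademacher_def)
  also have "\<dots> = (\<Prod>k\<in>{..<N}. 1 / 2)"
  proof (rule prod.cong[OF refl])
    fix k assume k: "k \<in> {..<N}"
    have "\<sigma> k -` {s k} \<inter> space P = {\<omega> \<in> space P. \<sigma> k \<omega> = s k}" by auto
    moreover have "s k = 1 \<or> s k = -1" using s k by (auto simp: signs_def)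
    ultimately show "measure P (\<sigma> k -` {s k} \<inter> space P) = 1 / 2"
      using \<sigma> k by (auto simp: iid_rademacher_def)
  qed
  finally show ?thesis by (simp add: power_one_over)
qed

text \<open>Conditioning on the signs as a finite sum: each sign vector has probability
  \<open>1 / 2^N\<close> and is independent of the sampling matrix, so failure is bounded by the
  sign average of \<open>bad_prob\<close>. Independence is assumed for the matrix and not for the
  sample points, so the bad event is written through matrix entries.\<close>

lemma (in bos_sample) frame_event:
  fixes P :: "'w measure"
  assumes P: "prob_space P" and t: "iid_sample P \<nu> n t" and \<sigma>: "iid_rademacher P N \<sigma>"
    and ind: "indep_of_matrix P n N \<sigma> (\<lambda>\<omega>. sampling_matrix n N \<phi> (\<lambda>l. t l \<omega>))"
    and N: "0 < N" and size: "2 * real q * R \<le> real n"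
  obtains E where "E \<in> sets P"
    "measure P (space P - E) \<le> (2 * R / \<delta> + real n) * (2 * K\<^sup>2 * (D + 8 * real q)) ^ q / R ^ q
      + D * (40 * real q * R / (\<delta>\<^sup>2 * real n)) ^ q"
    "\<And>\<omega>. \<omega> \<in> E \<Longrightarrow> (\<lambda>k. if k < N then \<sigma> k \<omega> else 0) \<in> signs N \<and>
      good (\<lambda>k. if k < N then \<sigma> k \<omega> else 0) (\<lambda>l. row (t l \<omega>))"
proof -
  interpret P: prob_space P by (rule P)
  have t_meas: "t l \<in> measurable P \<nu>" if "l < n" for l
    using t that by (auto simp: iid_sample_def P.indep_vars_def)
  have \<sigma>_meas: "\<sigma> k \<in> borel_measurable P" if "k < N" for k
    using \<sigma> that by (auto simp: iid_rademacher_def P.indep_vars_def)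
  define S where "S s = {\<omega> \<in> space P. \<forall>k\<in>{..<N}. \<sigma> k \<omega> = s k}" for s
  define Bad where "Bad s = {\<omega> \<in> space P. \<not> good s (\<lambda>l. row (t l \<omega>))}" for s
  have S_sets: "S s \<in> sets P" for s
    unfolding S_def by (rule sets.sets_Collect_finite_All) (auto intro!: borel_measurable_eq \<sigma>_meas)
  have "{\<omega> \<in> space P. good s (\<lambda>l. row (t l \<omega>))} \<in> sets P" for s
    by (rule good_measurable) (rule measurable_compose[OF t_meas \<phi>_meas])
  then have Bad_sets: "Bad s \<in> sets P" for s unfolding Bad_def by (intro sets.sets_Collect_neg)
  have indep: "measure P (S s \<inter> Bad s) = measure P (S s) * measure P (Bad s)" for s
  proof -
    let ?M = "Pi\<^sub>M ({..<n} \<times> {..<N}) (\<lambda>_. borel :: complex measure)"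
    let ?V = "Pi\<^sub>M {..<N} (\<lambda>_. borel :: real measure)"
    define f where "f \<omega> = (\<lambda>p\<in>{..<n} \<times> {..<N}. sampling_matrix n N \<phi> (\<lambda>l. t l \<omega>) $$ p)" for \<omega>
    have f_good: "good s (\<lambda>l k. f \<omega> (l, k)) = good s (\<lambda>l. row (t l \<omega>))" for \<omega>
      by (rule good_cong) (simp add: f_def sampling_matrix_def)
    have "{y \<in> space ?M. good s (\<lambda>l k. y (l, k))} \<in> sets ?M"
      by (intro good_measurable measurable_component_singleton) auto
    then have B1: "{y \<in> space ?M. \<not> good s (\<lambda>l k. y (l, k))} \<in> sets ?M"
      by (rule sets.sets_Collect_neg)
    have "Bad s = f -` {y \<in> space ?M. \<not> good s (\<lambda>l k. y (l, k))} \<inter> space P"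
      using f_good by (auto simp: Bad_def space_PiM f_def)
    then have 1: "Bad s \<in> {f -` B \<inter> space P | B. B \<in> sets ?M}" using B1 by blast
    have B2: "{y \<in> space ?V. \<forall>k\<in>{..<N}. y k = s k} \<in> sets ?V"
      by (rule sets.sets_Collect_finite_All) (auto intro!: borel_measurable_eq measurable_component_singleton)
    have "S s = (\<lambda>\<omega>. \<lambda>k\<in>{..<N}. \<sigma> k \<omega>) -` {y \<in> space ?V. \<forall>k\<in>{..<N}. y k = s k} \<inter> space P"
      by (auto simp: S_def space_PiM)
    then have 2: "S s \<in> {(\<lambda>\<omega>. \<lambda>k\<in>{..<N}. \<sigma> k \<omega>) -` B \<inter> space P | B. B \<in> sets ?V}" using B2 by blast
    have "measure P (Bad s \<inter> S s) = measure P (Bad s) * measure P (S s)"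
      using ind 1 2 unfolding indep_of_matrix_def f_def by (rule P.indep_setD)
    then show ?thesis by (simp add: Int_commute mult.commute)
  qed
  have S_prob: "measure P (S s) = 1 / 2 ^ N" if "s \<in> signs N" for s
    unfolding S_def by (rule rademacher_prob[OF P \<sigma> N that])
  have "disjoint_family_on S (signs N)"
    unfolding disjoint_family_on_def
  proof (intro ballI impI)
    fix s s' assume ss: "s \<in> signs N" "s' \<in> signs N" "s \<noteq> s'"
    have "s k = s' k" if "\<omega> \<in> S s \<inter> S s'" for \<omega> k
      using that ss(1,2) by (cases "k < N") (auto simp: S_def signs_def)
    then show "S s \<inter> S s' = {}" using ss(3) by blast
  qed
  then have "measure P (\<Union>s\<in>signs N. S s) = (\<Sum>s\<in>signs N. measure P (S s))"
    using S_sets finite_signs by (intro P.finite_measure_finite_Union) auto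
  also have "\<dots> = 1" using S_prob by (simp add: card_signs)
  finally have S_all: "measure P (\<Union>s\<in>signs N. S s) = 1" .
  have US: "(\<Union>s\<in>signs N. S s) \<in> sets P" using S_sets finite_signs by (intro sets.finite_UN) auto
  \<comment> \<open>Other values of the signs are possible, but only on a null set.\<close>
  have S_none: "measure P (space P - (\<Union>s\<in>signs N. S s)) = 0"
    using P.prob_compl[OF US] S_all by simp
  define E where "E = (\<Union>s\<in>signs N. S s - Bad s)"
  have E_sets: "E \<in> sets P" unfolding E_def using S_sets Bad_sets finite_signs by (intro sets.finite_UN) auto
  have USB: "(\<Union>s\<in>signs N. S s \<inter> Bad s) \<in> sets P"
    using S_sets Bad_sets finite_signs by (intro sets.finite_UN) auto
  have "space P - E \<subseteq> (space P - (\<Union>s\<in>signs N. S s)) \<union> (\<Union>s\<in>signs N. S s \<inter> Bad s)"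
    unfolding E_def by blast
  then have "measure P (space P - E) \<le> measure P ((space P - (\<Union>s\<in>signs N. S s)) \<union> (\<Union>s\<in>signs N. S s \<inter> Bad s))"
    using US USB by (intro P.finite_measure_mono) auto
  also have "\<dots> \<le> measure P (space P - (\<Union>s\<in>signs N. S s)) + measure P (\<Union>s\<in>signs N. S s \<inter> Bad s)"
    using US USB by (intro measure_Un_le) auto
  also have "\<dots> \<le> (\<Sum>s\<in>signs N. measure P (S s \<inter> Bad s))"
    using P.finite_measure_subadditive_finite[OF finite_signs, of "\<lambda>s. S s \<inter> Bad s"] S_sets Bad_sets
    unfolding S_none by auto
  also have "\<dots> = savg N (\<lambda>s. measure P (Bad s))"
    unfolding savg_def sum_divide_distrib by (intro sum.cong refl) (simp add: indep S_prob)
  also have "\<dots> \<le> savg N (\<lambda>s. (2 * R / \<delta> + real n) / R ^ q * row_moment s + D * (40 * real q * R / (\<delta>\<^sup>2 * real n)) ^ q)"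
  proof (rule savg_mono)
    fix s assume s: "s \<in> signs N"
    have "measure P (Bad s) \<le> (2 * R / \<delta> + real n) * row_moment s / R ^ q + D * (40 * real q * R / (\<delta>\<^sup>2 * real n)) ^ q"
      unfolding Bad_def sampled_bad_prob[OF P t] by (rule bad_prob[OF s size])
    then show "measure P (Bad s) \<le> (2 * R / \<delta> + real n) / R ^ q * row_moment s + D * (40 * real q * R / (\<delta>\<^sup>2 * real n)) ^ q"
      by simp
  qed
  also have "\<dots> = (2 * R / \<delta> + real n) / R ^ q * savg N row_moment + D * (40 * real q * R / (\<delta>\<^sup>2 * real n)) ^ q"
  proof -
    have "savg N (\<lambda>s. c) = c" for c by (simp add: savg_def card_signs)
    then show ?thesis by (simp only: savg_add savg_cmult)
  qed
  also have "\<dots> \<le> (2 * R / \<delta> + real n) / R ^ q * (2 * K\<^sup>2 * (D + 8 * real q)) ^ q + D * (40 * real q * R / (\<delta>\<^sup>2 * real n)) ^ q"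
    using R \<delta> by (intro add_right_mono mult_left_mono savg_row_moment) auto
  finally have prob: "measure P (space P - E) \<le> (2 * R / \<delta> + real n) * (2 * K\<^sup>2 * (D + 8 * real q)) ^ q / R ^ q
      + D * (40 * real q * R / (\<delta>\<^sup>2 * real n)) ^ q" by simp
  have "(\<lambda>k. if k < N then \<sigma> k \<omega> else 0) \<in> signs N \<and>
      good (\<lambda>k. if k < N then \<sigma> k \<omega> else 0) (\<lambda>l. row (t l \<omega>))" if \<omega>: "\<omega> \<in> E" for \<omega>
  proof -
    obtain s where s: "s \<in> signs N" "\<omega> \<in> S s" "\<omega> \<notin> Bad s" using \<omega> by (auto simp: E_def)
    then have "(\<lambda>k. if k < N then \<sigma> k \<omega> else 0) = s" by (auto simp: S_def signs_def)
    moreover have "good s (\<lambda>l. row (t l \<omega>))" using s by (auto simp: S_def Bad_def)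
    ultimately show ?thesis using s(1) by simp
  qed
  then show thesis using that E_sets prob by blast
qed

text \<open>\<open>gsp\<close> can be nonzero outside the \<open>N\<close> by \<open>N\<close>
  block, so it is cut off there to satisfy \<open>p_supp\<close>.\<close>

lemma bos_frame_gsp:
  fixes c :: "nat \<Rightarrow> nat \<Rightarrow> real"
  assumes bos: "bounded_orthonormal_system \<nu> N K \<phi>" and K: "0 \<le> K" and D: "real d \<le> D"
  shows "bos_frame \<nu> N \<phi> K D (\<lambda>i j. if i < N \<and> j < N then gsp N c d i j else 0)"
proof -
  interpret prob_space \<nu> using bos by (simp add: bounded_orthonormal_system_def)
  have sym: "gsp N c d i j = gsp N c d j i" for i j
    using gsp_hermitian[of N c d j i] by (simp add: conjugate_real_def)
  \<comment> \<open>Columns of the projection lie in the span, so the projection fixes them; this is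
    idempotence.\<close>
  have col: "(\<lambda>k. gsp N c d k j) \<in> fspan d c" for j
  proof -
    have "(\<lambda>i. gsv N c k i * conjugate (gsv N c k j) / ip N (gsv N c k) (gsv N c k)) \<in> fspan d c" if "k < d" for k
    proof -
      have "gsv N c k \<in> fspan d c" using gsv_in_span[of N c k] fspan_mono[of "Suc k" d c] that by auto
      then have "(\<lambda>i. (conjugate (gsv N c k j) / ip N (gsv N c k) (gsv N c k)) * gsv N c k i) \<in> fspan d c"
        by (rule fspan_scale)
      then show ?thesis by (simp add: mult.commute)
    qed
    then show ?thesis unfolding gsp_eq_sum by (intro fspan_sum) auto
  qed
  have idem: "(\<Sum>k<N. gsp N c d i k * gsp N c d k j) = gsp N c d i j" if "i < N" for i j
    using gsp_fixes_span[OF col that] by (simp add: mvec_def)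
  have "(\<Sum>i<N. gsp N c d i i) \<le> real d"
  proof -
    have "card {k. k < d \<and> ip N (gsv N c k) (gsv N c k) \<noteq> 0} \<le> card {..<d}" by (intro card_mono) auto
    then show ?thesis unfolding gsp_trace by simp
  qed
  then have trace: "(\<Sum>i<N. if i < N \<and> i < N then gsp N c d i i else 0) \<le> D" using D by simp
  show ?thesis
  proof
    show "(\<Sum>k<N. (if i < N \<and> k < N then gsp N c d i k else 0) * (if k < N \<and> j < N then gsp N c d k j else 0))
        = (if i < N \<and> j < N then gsp N c d i j else 0)" for i j
      using idem[of i j] by simp
  qed (use bos K D sym trace in \<open>auto simp: bounded_orthonormal_system_def\<close>)
qed

lemma embedding_matrix_carrier: "embedding_matrix n N (sampling_matrix n N \<phi> t) \<sigma> \<in> carrier_mat n N"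
  by (auto simp: embedding_matrix_def sampling_matrix_def mat_diag_def)

lemma embedding_matrix_index:
  assumes "l < n" "k < N"
  shows "embedding_matrix n N (sampling_matrix n N \<phi> t) \<sigma> $$ (l, k)
    = complex_of_real (1 / sqrt (real n)) * (\<phi> k (t l) * complex_of_real (\<sigma> k))"
proof -
  have "sampling_matrix n N \<phi> t \<in> carrier_mat n N" by (simp add: sampling_matrix_def)
  then show ?thesis
    unfolding embedding_matrix_def mat_diag_mult_right[OF \<open>_ \<in> carrier_mat n N\<close>]
    using assms by (simp add: sampling_matrix_def)
qed

lemma pair_event:
  fixes P :: "'w measure" and \<nu> :: "'d measure"
  assumes bos: "bounded_orthonormal_system \<nu> N K \<phi>" and K: "0 \<le> K"
    and P: "prob_space P" and t: "iid_sample P \<nu> n t" and \<sigma>: "iid_rademacher P N \<sigma>"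
    and ind: "indep_of_matrix P n N \<sigma> (\<lambda>\<omega>. sampling_matrix n N \<phi> (\<lambda>l. t l \<omega>))"
    and N: "0 < N" and n: "0 < n" and q: "1 \<le> q" and R: "0 < R" and size: "2 * real q * R \<le> real n"
    and b: "onb N d1 b1" "onb N d2 b2" and d: "d1 \<le> d" "d2 \<le> d" and \<epsilon>: "0 < \<epsilon>" "\<epsilon> < 1"
  defines "\<Phi> \<equiv> \<lambda>\<omega>. embedding_matrix n N (sampling_matrix n N \<phi> (\<lambda>l. t l \<omega>)) (\<lambda>k. \<sigma> k \<omega>)"
  obtains E where "E \<in> sets P"
    "measure P (space P - E) \<le> (2 * R / (\<epsilon> / 4) + real n) * (2 * K\<^sup>2 * (2 * real d + 8 * real q)) ^ q / R ^ q
      + 2 * real d * (40 * real q * R / ((\<epsilon> / 4)\<^sup>2 * real n)) ^ q"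
    "\<And>\<omega>. \<omega> \<in> E \<Longrightarrow>
      \<bar>(aff_complex n (image_span n (\<Phi> \<omega>) (vspan N d1 b1)) (image_span n (\<Phi> \<omega>) (vspan N d2 b2)))\<^sup>2
        - (aff_real N (vspan N d1 b1) (vspan N d2 b2))\<^sup>2\<bar>
      \<le> \<epsilon> * (real (min d1 d2) - (aff_real N (vspan N d1 b1) (vspan N d2 b2))\<^sup>2)"
proof -
  \<comment> \<open>The concatenated bases span the sum of the spaces. The spaces may intersect, and
    \<open>gsp\<close> tolerates the resulting dependence.\<close>
  define c where "c k = (if k < d1 then b1 k else b2 (k - d1))" for k
  define p where "p i j = (if i < N \<and> j < N then gsp N c (d1 + d2) i j else 0)" for i j
  have "bos_frame \<nu> N \<phi> K (2 * real d) p"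
    unfolding p_def[abs_def] using d by (intro bos_frame_gsp bos K) simp
  then interpret bos_sample \<nu> N \<phi> K "2 * real d" p n q R "\<epsilon> / 4"
    using n q R \<epsilon> by (simp add: bos_sample_def bos_sample_axioms_def)
  obtain E where E: "E \<in> sets P"
    "measure P (space P - E) \<le> (2 * R / (\<epsilon> / 4) + real n) * (2 * K\<^sup>2 * (2 * real d + 8 * real q)) ^ q / R ^ q
      + 2 * real d * (40 * real q * R / ((\<epsilon> / 4)\<^sup>2 * real n)) ^ q"
    "\<And>\<omega>. \<omega> \<in> E \<Longrightarrow> (\<lambda>k. if k < N then \<sigma> k \<omega> else 0) \<in> signs N \<and>
      good (\<lambda>k. if k < N then \<sigma> k \<omega> else 0) (\<lambda>l. row (t l \<omega>))"
    using frame_event[OF P t \<sigma> ind N size] by blast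
  have span: "(\<lambda>i. x i + y i) \<in> fspan (d1 + d2) (cfun c)"
    if x: "x \<in> fspan d1 (cfun b1)" and y: "y \<in> fspan d2 (cfun b2)" for x y
  proof (rule fspan_add)
    have "cfun b1 k \<in> fspan (d1 + d2) (cfun c)" if "k < d1" for k
      using fspan_member[of k "d1 + d2" "cfun c"] that by (simp add: c_def)
    then show "x \<in> fspan (d1 + d2) (cfun c)" using fspan_subset[of d1 "cfun b1"] x by blast
    have "cfun b2 k \<in> fspan (d1 + d2) (cfun c)" if "k < d2" for k
      using fspan_member[of "d1 + k" "d1 + d2" "cfun c"] that by (simp add: c_def)
    then show "y \<in> fspan (d1 + d2) (cfun c)" using fspan_subset[of d2 "cfun b2"] y by blast
  qed
  have fixed: "mvec N (\<lambda>i j. complex_of_real (p i j)) z i = z i"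
    if z: "z \<in> fspan (d1 + d2) (cfun c)" and i: "i < N" for z i
  proof -
    have "mvec N (\<lambda>i j. complex_of_real (p i j)) z i = mvec N (gsp N (cfun c) (d1 + d2)) z i"
      unfolding gsp_cfun mvec_def p_def using i by (intro sum.cong) auto
    then show ?thesis using gsp_fixes_span[OF z i] by simp
  qed
  have iso: "\<bar>nrm2 n (mvec N (\<lambda>i j. \<Phi> \<omega> $$ (i, j)) z) - nrm2 N z\<bar> \<le> \<epsilon> / 4 * nrm2 N z"
    if \<omega>: "\<omega> \<in> E" and z: "z \<in> fspan (d1 + d2) (cfun c)" for \<omega> z
  proof -
    define s where "s = (\<lambda>k. if k < N then \<sigma> k \<omega> else 0)"
    define V where "V = (\<Sum>l<n. (cmod (\<Sum>k<N. \<phi> k (t l \<omega>) * complex_of_real (s k) * z k))\<^sup>2)"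
    have bd: "\<bar>V - real n * nrm2 N z\<bar> \<le> \<epsilon> / 4 * real n * nrm2 N z"
      unfolding V_def using E(3)[OF \<omega>] fixed[OF z] by (intro good_near_isometry) (auto simp: s_def)
    have eq: "nrm2 n (mvec N (\<lambda>i j. \<Phi> \<omega> $$ (i, j)) z) = V / real n"
    proof -
      have "mvec N (\<lambda>i j. \<Phi> \<omega> $$ (i, j)) z l
          = complex_of_real (1 / sqrt (real n)) * (\<Sum>k<N. \<phi> k (t l \<omega>) * complex_of_real (s k) * z k)" if "l < n" for l
        unfolding mvec_def sum_distrib_left using that
        by (intro sum.cong) (auto simp: \<Phi>_def embedding_matrix_index s_def mult_ac)
      then have "(cmod (mvec N (\<lambda>i j. \<Phi> \<omega> $$ (i, j)) z l))\<^sup>2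
          = (cmod (\<Sum>k<N. \<phi> k (t l \<omega>) * complex_of_real (s k) * z k))\<^sup>2 / real n" if "l < n" for l
        using that n by (simp add: norm_mult norm_divide power_mult_distrib power_divide)
      then show ?thesis unfolding nrm2_def V_def sum_divide_distrib by simp
    qed
    have "V / real n - nrm2 N z = (V - real n * nrm2 N z) / real n" using n by (simp add: field_simps)
    then have "\<bar>V / real n - nrm2 N z\<bar> = \<bar>V - real n * nrm2 N z\<bar> / real n" by simp
    also have "\<dots> \<le> \<epsilon> / 4 * real n * nrm2 N z / real n" using bd by (rule divide_right_mono) simp
    also have "\<dots> = \<epsilon> / 4 * nrm2 N z" using n by simp
    finally show ?thesis unfolding eq .
  qed
  have "\<bar>(aff_complex n (image_span n (\<Phi> \<omega>) (vspan N d1 b1)) (image_span n (\<Phi> \<omega>) (vspan N d2 b2)))\<^sup>2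
        - (aff_real N (vspan N d1 b1) (vspan N d2 b2))\<^sup>2\<bar>
      \<le> \<epsilon> * (real (min d1 d2) - (aff_real N (vspan N d1 b1) (vspan N d2 b2))\<^sup>2)" if \<omega>: "\<omega> \<in> E" for \<omega>
    by (rule aff_preserved[OF _ b \<epsilon> iso[OF \<omega> span]]) (auto simp: \<Phi>_def embedding_matrix_carrier)
  then show thesis using that E(1,2) by blast
qed

lemma prob_space_union_bound:
  assumes P: "prob_space P" and J: "finite J" and E: "\<And>j. j \<in> J \<Longrightarrow> E j \<in> sets P"
    and p: "\<And>j. j \<in> J \<Longrightarrow> measure P (space P - E j) \<le> p" and S: "S \<in> sets P"
    and sub: "\<And>\<omega>. \<omega> \<in> space P \<Longrightarrow> (\<And>j. j \<in> J \<Longrightarrow> \<omega> \<in> E j) \<Longrightarrow> \<omega> \<in> S"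
  shows "1 - real (card J) * p \<le> measure P S"
proof -
  interpret prob_space P by (rule P)
  have C: "space P - E j \<in> sets P" if "j \<in> J" for j using E[OF that] by (rule sets.compl_sets)
  have "measure P (space P - S) \<le> measure P (\<Union>j\<in>J. space P - E j)"
    using sub C J by (intro finite_measure_mono sets.finite_UN) auto
  also have "\<dots> \<le> (\<Sum>j\<in>J. measure P (space P - E j))"
    using J C by (intro finite_measure_subadditive_finite) auto
  also have "\<dots> \<le> real (card J) * p" using p by (intro sum_bounded_above)
  finally show ?thesis using prob_compl[OF S] by simp
qed

theorem affinity_preservation_const: "affinity_preservation TYPE('d) TYPE('w) aff_const"
  unfolding affinity_preservation_def
proof (intro allI impI)
  fix N L :: nat and X :: "nat \<Rightarrow> real vec set" and d :: "nat \<Rightarrow> nat" and dmax n :: nat and K :: real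
    and \<nu> :: "'d measure" and \<phi> :: "nat \<Rightarrow> 'd \<Rightarrow> complex" and P :: "'w measure" and t \<sigma>
    and A :: "'w \<Rightarrow> complex mat" and Y :: "'w \<Rightarrow> nat \<Rightarrow> complex vec set" and \<epsilon> :: real
  assume N: "2 \<le> N" and L: "1 \<le> L"
    and X: "\<forall>i\<in>{1..L}. is_subspace N (X i) \<and> d i = subspace_dim N (X i) \<and> 1 \<le> d i"
    and dmax: "dmax = Max (d ` {1..L})" and K: "1 \<le> K" and bos: "bounded_orthonormal_system \<nu> N K \<phi>"
    and P: "prob_space P" and t: "iid_sample P \<nu> n t"
    and A: "A = (\<lambda>\<omega>. sampling_matrix n N \<phi> (\<lambda>l. t l \<omega>))"
    and \<sigma>: "iid_rademacher P N \<sigma>" and ind: "indep_of_matrix P n N \<sigma> A"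
    and Y: "Y = (\<lambda>\<omega> i. image_span n (embedding_matrix n N (A \<omega>) (\<lambda>k. \<sigma> k \<omega>)) (X i))"
    and \<epsilon>: "0 < \<epsilon>" "\<epsilon> < 1"
    and large: "aff_const * K ^ 3 / \<epsilon> ^ 3 *
      Max {real dmax * (ln (real dmax) ^ 3 + ln (real L)), ln (real L) ^ 2, ln (real N) ^ 3} < real n"
  interpret P: prob_space P by (rule P)
  let ?good = "\<lambda>\<omega> i j. \<bar>(aff_complex n (Y \<omega> i) (Y \<omega> j))\<^sup>2 - (aff_real N (X i) (X j))\<^sup>2\<bar>
            \<le> \<epsilon> * (real (min (d i) (d j)) - (aff_real N (X i) (X j))\<^sup>2)"
  define G where "G = {\<omega> \<in> space P. \<forall>i j. 1 \<le> i \<longrightarrow> i < j \<longrightarrow> j \<le> L \<longrightarrow> ?good \<omega> i j}"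
  define \<Phi> where "\<Phi> \<omega> = embedding_matrix n N (sampling_matrix n N \<phi> (\<lambda>l. t l \<omega>)) (\<lambda>k. \<sigma> k \<omega>)" for \<omega>
  have d_le: "d i \<le> dmax" if "i \<in> {1..L}" for i using that unfolding dmax by (intro Max_ge) auto
  have "1 \<le> dmax" using X d_le[of 1] L by force
  obtain q R where q: "1 \<le> q" and R: "0 < R" and size: "2 * real q * R \<le> real n" and n: "0 < n"
    and small: "real L ^ 2 * ((2 * R / (\<epsilon> / 4) + real n) * (2 * K\<^sup>2 * (2 * real dmax + 8 * real q)) ^ q / R ^ q
      + 2 * real dmax * (40 * real q * R / ((\<epsilon> / 4)\<^sup>2 * real n)) ^ q)
     \<le> exp (- (1 / aff_const) * (sqrt (real dmax ^ 2 + \<epsilon>\<^sup>2 * real n / K\<^sup>2) - real dmax))"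
    using failure_small[OF \<open>1 \<le> dmax\<close> L N K \<epsilon> large] by blast
  define \<beta> where "\<beta> = (2 * R / (\<epsilon> / 4) + real n) * (2 * K\<^sup>2 * (2 * real dmax + 8 * real q)) ^ q / R ^ q
      + 2 * real dmax * (40 * real q * R / ((\<epsilon> / 4)\<^sup>2 * real n)) ^ q"
  have "0 \<le> \<beta>" using R \<epsilon> by (simp add: \<beta>_def)
  define J where "J = {(i, j). i \<in> {1..L} \<and> j \<in> {1..L} \<and> i < j}"
  have J: "J \<subseteq> {1..L} \<times> {1..L}" by (auto simp: J_def)
  have "card J \<le> L\<^sup>2" using card_mono[OF _ J] by (simp add: card_cartesian_product power2_eq_square)
  then have card_J: "real (card J) \<le> real L ^ 2" by (simp flip: of_nat_power)
  have fin_J: "finite J" using J by (rule finite_subset) simp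
  have "\<forall>i. \<exists>b. i \<in> {1..L} \<longrightarrow> X i = vspan N (d i) b \<and> onb N (d i) b"
    using X is_subspace_onb by metis
  then obtain b where b: "\<And>i. i \<in> {1..L} \<Longrightarrow> X i = vspan N (d i) (b i)" "\<And>i. i \<in> {1..L} \<Longrightarrow> onb N (d i) (b i)"
    by metis
  have "\<exists>E\<in>sets P. measure P (space P - E) \<le> \<beta> \<and> (\<forall>\<omega>\<in>E. ?good \<omega> (fst p) (snd p))" if p: "p \<in> J" for p
  proof -
    define i j where "i = fst p" and "j = snd p"
    have ij: "i \<in> {1..L}" "j \<in> {1..L}" using p by (auto simp: J_def i_def j_def)
    note event = pair_event[OF bos _ P t \<sigma> ind[unfolded A] _ n q R size b(2)[OF ij(1)] b(2)[OF ij(2)]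
        d_le[OF ij(1)] d_le[OF ij(2)] \<epsilon>, folded \<beta>_def \<Phi>_def b(1)[OF ij(1)] b(1)[OF ij(2)]]
    have Y_eq: "Y \<omega> k = image_span n (\<Phi> \<omega>) (X k)" for \<omega> k by (simp only: Y A \<Phi>_def)
    have "0 \<le> K" "0 < N" using K N by auto
    then obtain E where "E \<in> sets P" "measure P (space P - E) \<le> \<beta>" "\<And>\<omega>. \<omega> \<in> E \<Longrightarrow> ?good \<omega> i j"
      unfolding Y_eq by (rule event) blast
    then show ?thesis unfolding i_def j_def by blast
  qed
  then obtain E where E: "\<And>p. p \<in> J \<Longrightarrow> E p \<in> sets P" "\<And>p. p \<in> J \<Longrightarrow> measure P (space P - E p) \<le> \<beta>"
    "\<And>p \<omega>. p \<in> J \<Longrightarrow> \<omega> \<in> E p \<Longrightarrow> ?good \<omega> (fst p) (snd p)"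
    by metis
  have Y_span: "Y \<omega> i = vspan n (d i) (\<lambda>k. mvec N (\<lambda>l j. \<Phi> \<omega> $$ (l, j)) (\<lambda>j. complex_of_real (b i k j)))"
    if "i \<in> {1..L}" for \<omega> i
    unfolding Y b(1)[OF that] A \<Phi>_def[symmetric]
    by (rule image_span_vspan) (simp add: \<Phi>_def embedding_matrix_carrier)
  have \<Phi>_meas: "(\<lambda>\<omega>. \<Phi> \<omega> $$ (l, k)) \<in> borel_measurable P" if "l < n" "k < N" for l k
  proof -
    have "t l \<in> measurable P \<nu>" using t that(1) by (auto simp: iid_sample_def P.indep_vars_def)
    moreover have "\<phi> k \<in> borel_measurable \<nu>" using bos that(2) by (auto simp: bounded_orthonormal_system_def)
    ultimately have "(\<lambda>\<omega>. \<phi> k (t l \<omega>)) \<in> borel_measurable P" by (rule measurable_compose)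
    moreover have "\<sigma> k \<in> borel_measurable P"
      using \<sigma> that(2) by (auto simp: iid_rademacher_def P.indep_vars_def)
    then have "(\<lambda>\<omega>. complex_of_real (\<sigma> k \<omega>)) \<in> borel_measurable P"
      by (intro borel_measurable_continuous_on[of complex_of_real] continuous_intros)
    ultimately show ?thesis
      unfolding \<Phi>_def embedding_matrix_index[OF that] by (intro borel_measurable_times borel_measurable_const)
  qed
  have aff_meas: "(\<lambda>\<omega>. aff_complex n (Y \<omega> i) (Y \<omega> j)) \<in> borel_measurable P" if "i \<in> {1..L}" "j \<in> {1..L}" for i j
    unfolding Y_span[OF that(1)] Y_span[OF that(2)] mvec_def
    by (intro aff_complex_measurable borel_measurable_sum borel_measurable_times borel_measurable_const \<Phi>_meas) auto
  \<comment> \<open>The union bound passes to the complement of the success event, which requires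
    its measurability.\<close>
  have "{\<omega> \<in> space P. \<forall>p\<in>J. ?good \<omega> (fst p) (snd p)} \<in> sets P"
  proof (rule sets.sets_Collect_finite_All[OF _ fin_J])
    fix p assume "p \<in> J"
    then have p: "fst p \<in> {1..L}" "snd p \<in> {1..L}" by (auto simp: J_def)
    show "{\<omega> \<in> space P. ?good \<omega> (fst p) (snd p)} \<in> sets P"
      by (rule borel_measurable_le)
        (intro borel_measurable_abs borel_measurable_diff borel_measurable_power aff_meas p borel_measurable_const)+
  qed
  also have "{\<omega> \<in> space P. \<forall>p\<in>J. ?good \<omega> (fst p) (snd p)} = G"
    unfolding G_def J_def by force
  finally have G: "G \<in> sets P" .
  have "1 - real (card J) * \<beta> \<le> measure P G"
  proof (rule prob_space_union_bound[OF P fin_J E(1,2) G])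
    fix \<omega> assume \<omega>: "\<omega> \<in> space P" "\<And>p. p \<in> J \<Longrightarrow> \<omega> \<in> E p"
    have "?good \<omega> i j" if "1 \<le> i" "i < j" "j \<le> L" for i j
      using E(3)[of "(i, j)" \<omega>] \<omega>(2)[of "(i, j)"] that by (simp add: J_def)
    then show "\<omega> \<in> G" using \<omega>(1) unfolding G_def by blast
  qed
  moreover have "real (card J) * \<beta> \<le> real L ^ 2 * \<beta>" using card_J \<open>0 \<le> \<beta>\<close> by (rule mult_right_mono)
  ultimately show "1 - exp (- (1 / aff_const) * (sqrt (real dmax ^ 2 + \<epsilon>\<^sup>2 * real n / K\<^sup>2) - real dmax)) \<le> measure P G"
    using small unfolding \<beta>_def[symmetric] by linarith
qed

section \<open>Transfer from the canonical sample spaces\<close>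

text \<open>For a nonempty index set independence means that the joint law is the product of the
  laws, and all these laws are unchanged by composing with \<open>h\<close>.\<close>

lemma indep_vars_distr_iff:
  assumes P: "prob_space P" and h: "h \<in> measurable P Q" and X: "\<And>i. i \<in> I \<Longrightarrow> X i \<in> measurable Q (M' i)"
    and I: "I \<noteq> {}"
  shows "prob_space.indep_vars (distr P Q h) M' X I \<longleftrightarrow> prob_space.indep_vars P M' (\<lambda>i \<omega>. X i (h \<omega>)) I"
proof -
  interpret P: prob_space P by (rule P)
  interpret Q: prob_space "distr P Q h" by (rule P.prob_space_distr[OF h])
  have X': "X i \<in> measurable (distr P Q h) (M' i)" if "i \<in> I" for i using X[OF that] by simp
  have Xh: "(\<lambda>\<omega>. X i (h \<omega>)) \<in> measurable P (M' i)" if "i \<in> I" for i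
    by (rule measurable_compose[OF h X[OF that]])
  have "distr (distr P Q h) (PiM I M') (\<lambda>x. \<lambda>i\<in>I. X i x) = distr P (PiM I M') (\<lambda>\<omega>. \<lambda>i\<in>I. X i (h \<omega>))"
    using X h by (subst distr_distr) (auto intro!: measurable_restrict simp: comp_def)
  moreover have "PiM I (\<lambda>i. distr (distr P Q h) (M' i) (X i)) = PiM I (\<lambda>i. distr P (M' i) (\<lambda>\<omega>. X i (h \<omega>)))"
    using X h by (intro PiM_cong) (auto simp: distr_distr comp_def)
  moreover have "Q.indep_vars M' X I \<longleftrightarrow>
      distr (distr P Q h) (PiM I M') (\<lambda>x. \<lambda>i\<in>I. X i x) = PiM I (\<lambda>i. distr (distr P Q h) (M' i) (X i))"
    by (rule Q.indep_vars_iff_distr_eq_PiM'[OF I X'])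
  moreover have "P.indep_vars M' (\<lambda>i \<omega>. X i (h \<omega>)) I \<longleftrightarrow>
      distr P (PiM I M') (\<lambda>\<omega>. \<lambda>i\<in>I. X i (h \<omega>)) = PiM I (\<lambda>i. distr P (M' i) (\<lambda>\<omega>. X i (h \<omega>)))"
    by (rule P.indep_vars_iff_distr_eq_PiM'[OF I Xh])
  ultimately show ?thesis by (simp only:)
qed

text \<open>Only probabilities of preimages are involved, and pulling a preimage under
  \<open>f\<close> back along \<open>h\<close> gives the one under \<open>f0\<close>.\<close>

lemma indep_preimages_distr:
  assumes P: "prob_space P" and h: "h \<in> measurable P Q" and f: "f \<in> measurable Q M1" and g: "g \<in> measurable Q M2"
    and eq: "\<And>\<omega>. \<omega> \<in> space P \<Longrightarrow> f (h \<omega>) = f0 \<omega>" "\<And>\<omega>. \<omega> \<in> space P \<Longrightarrow> g (h \<omega>) = g0 \<omega>"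
    and ind: "prob_space.indep_set P {f0 -` B \<inter> space P | B. B \<in> sets M1} {g0 -` B \<inter> space P | B. B \<in> sets M2}"
  shows "prob_space.indep_set (distr P Q h) {f -` B \<inter> space (distr P Q h) | B. B \<in> sets M1}
    {g -` B \<inter> space (distr P Q h) | B. B \<in> sets M2}"
proof -
  interpret P: prob_space P by (rule P)
  interpret Q: prob_space "distr P Q h" by (rule P.prob_space_distr[OF h])
  have fQ: "f -` B \<inter> space Q \<in> sets Q" if "B \<in> sets M1" for B by (rule measurable_sets[OF f that])
  have gQ: "g -` B \<inter> space Q \<in> sets Q" if "B \<in> sets M2" for B by (rule measurable_sets[OF g that])
  have fh: "h -` (f -` B \<inter> space Q) \<inter> space P = f0 -` B \<inter> space P" for B
    using eq(1) measurable_space[OF h] by auto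
  have gh: "h -` (g -` B \<inter> space Q) \<inter> space P = g0 -` B \<inter> space P" for B
    using eq(2) measurable_space[OF h] by auto
  have "measure (distr P Q h) ((f -` B \<inter> space Q) \<inter> (g -` C \<inter> space Q))
      = measure (distr P Q h) (f -` B \<inter> space Q) * measure (distr P Q h) (g -` C \<inter> space Q)"
    if B: "B \<in> sets M1" and C: "C \<in> sets M2" for B C
  proof -
    have "measure (distr P Q h) ((f -` B \<inter> space Q) \<inter> (g -` C \<inter> space Q))
        = measure P (h -` ((f -` B \<inter> space Q) \<inter> (g -` C \<inter> space Q)) \<inter> space P)"
      by (rule measure_distr[OF h sets.Int[OF fQ[OF B] gQ[OF C]]])
    also have "h -` ((f -` B \<inter> space Q) \<inter> (g -` C \<inter> space Q)) \<inter> space P = (f0 -` B \<inter> space P) \<inter> (g0 -` C \<inter> space P)"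
      unfolding fh[symmetric] gh[symmetric] by blast
    also have "measure P \<dots> = measure P (f0 -` B \<inter> space P) * measure P (g0 -` C \<inter> space P)"
      using B C by (intro P.indep_setD[OF ind]) blast+
    finally show ?thesis
      unfolding measure_distr[OF h fQ[OF B]] measure_distr[OF h gQ[OF C]] fh gh .
  qed
  then show ?thesis
    unfolding Q.indep_sets2_eq space_distr sets_distr using fQ gQ by blast
qed

text \<open>A point of the given space is replaced by the sequence of its values
  \<open>\<phi> k x\<close>, and a random outcome by the replaced samples together with the signs.
  The matrix and the signs are the same functions of the copy, so all hypotheses and the event carry
  over.\<close>

theorem affinity_preservation_transfer:
  assumes C: "affinity_preservation TYPE(sample_point) TYPE(sample_space) C" and C1: "1 < C"
  shows "affinity_preservation TYPE('d) TYPE('w) C"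
  unfolding affinity_preservation_def
proof (intro allI impI)
  fix N L :: nat and X :: "nat \<Rightarrow> real vec set" and d :: "nat \<Rightarrow> nat" and dmax n :: nat and K :: real
    and \<nu> :: "'d measure" and \<phi> :: "nat \<Rightarrow> 'd \<Rightarrow> complex" and P :: "'w measure" and t \<sigma>
    and A :: "'w \<Rightarrow> complex mat" and Y :: "'w \<Rightarrow> nat \<Rightarrow> complex vec set" and \<epsilon> :: real
  assume N: "2 \<le> N" and L: "1 \<le> L"
    and X: "\<forall>i\<in>{1..L}. is_subspace N (X i) \<and> d i = subspace_dim N (X i) \<and> 1 \<le> d i"
    and dmax: "dmax = Max (d ` {1..L})" and K: "1 \<le> K" and bos: "bounded_orthonormal_system \<nu> N K \<phi>"
    and P: "prob_space P" and t: "iid_sample P \<nu> n t"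
    and A: "A = (\<lambda>\<omega>. sampling_matrix n N \<phi> (\<lambda>l. t l \<omega>))"
    and \<sigma>: "iid_rademacher P N \<sigma>" and ind: "indep_of_matrix P n N \<sigma> A"
    and Y: "Y = (\<lambda>\<omega> i. image_span n (embedding_matrix n N (A \<omega>) (\<lambda>k. \<sigma> k \<omega>)) (X i))"
    and \<epsilon>: "0 < \<epsilon>" "\<epsilon> < 1"
    and large: "C * K ^ 3 / \<epsilon> ^ 3 *
      Max {real dmax * (ln (real dmax) ^ 3 + ln (real L)), ln (real L) ^ 2, ln (real N) ^ 3} < real n"
  interpret P: prob_space P by (rule P)
  interpret \<nu>: prob_space \<nu> using bos by (simp add: bounded_orthonormal_system_def)
  \<comment> \<open>\<open>indep_vars_distr_iff\<close> needs nonempty index sets.\<close>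
  have n: "0 < n"
  proof -
    have "0 \<le> ln (real N) ^ 3" using N by simp
    also have "\<dots> \<le> Max {real dmax * (ln (real dmax) ^ 3 + ln (real L)), ln (real L) ^ 2, ln (real N) ^ 3}"
      by (rule Max_ge) auto
    finally have "0 \<le> C * K ^ 3 / \<epsilon> ^ 3 * Max {real dmax * (ln (real dmax) ^ 3 + ln (real L)), ln (real L) ^ 2, ln (real N) ^ 3}"
      using C1 K \<epsilon> by (intro mult_nonneg_nonneg divide_nonneg_nonneg) auto
    then show ?thesis using large by simp
  qed
  have ne: "{..<n} \<noteq> {}" "{..<N} \<noteq> {}" using n N by (auto simp: lessThan_empty_iff)
  have \<phi>_meas: "\<phi> k \<in> borel_measurable \<nu>" if "k < N" for k
    using bos that by (simp add: bounded_orthonormal_system_def)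
  have \<phi>_bound: "cmod (\<phi> k x) \<le> K" if "k < N" "x \<in> space \<nu>" for k x
    using bos that by (simp add: bounded_orthonormal_system_def)
  have t_meas: "t l \<in> measurable P \<nu>" if "l < n" for l
    using t that by (auto simp: iid_sample_def P.indep_vars_def)
  have \<sigma>_meas: "\<sigma> k \<in> borel_measurable P" if "k < N" for k
    using \<sigma> that by (auto simp: iid_rademacher_def P.indep_vars_def)
  define V where "V = Pi\<^sub>M {..<N} (\<lambda>_. borel :: complex measure)"
  define g where "g x = (\<lambda>k\<in>{..<N}. \<phi> k x)" for x
  have g: "g \<in> measurable \<nu> V"
    unfolding g_def V_def by (rule measurable_restrict) (use \<phi>_meas in auto)
  define \<nu>' where "\<nu>' = distr \<nu> V g"
  have sets_\<nu>': "sets \<nu>' = sets V" by (simp add: \<nu>'_def)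
  have g': "g \<in> measurable \<nu> \<nu>'" using g measurable_cong_sets[OF refl sets_\<nu>'] by blast
  \<comment> \<open>The bound \<open>K\<close> must hold at every point of the copy, also outside
    the image of \<open>g\<close>, so larger coordinates are replaced by 0.\<close>
  define \<phi>' where "\<phi>' k y = (if cmod (y k) \<le> K then y k else 0)" for k and y :: sample_point
  have \<phi>'_g: "\<phi>' k (g x) = \<phi> k x" if "k < N" "x \<in> space \<nu>" for k x
    using \<phi>_bound[OF that] that by (simp add: \<phi>'_def g_def)
  have \<phi>'_meas: "\<phi>' k \<in> borel_measurable V" if "k < N" for k
  proof -
    have "(\<lambda>y. y k) \<in> borel_measurable V"
      unfolding V_def by (rule measurable_component_singleton) (use that in auto)
    moreover from this have "(\<lambda>y. cmod (y k)) \<in> borel_measurable V"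
      by (rule measurable_compose[OF _ borel_measurable_norm])
    ultimately show ?thesis
      unfolding \<phi>'_def by (intro measurable_If borel_measurable_const borel_measurable_le)
  qed
  have bos': "bounded_orthonormal_system \<nu>' N K \<phi>'"
    unfolding bounded_orthonormal_system_def
  proof (intro conjI allI impI ballI)
    show "prob_space \<nu>'" unfolding \<nu>'_def by (rule \<nu>.prob_space_distr[OF g])
    fix k assume k: "k < N"
    show "\<phi>' k \<in> borel_measurable \<nu>'" using \<phi>'_meas[OF k] measurable_cong_sets[OF sets_\<nu>' refl] by blast
    show "cmod (\<phi>' k x) \<le> K" for x using K by (simp add: \<phi>'_def)
  next
    fix j k assume jk: "j < N" "k < N"
    have "(\<lambda>x. \<phi>' j x * cnj (\<phi>' k x)) \<in> borel_measurable V"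
      by (intro borel_measurable_times borel_measurable_cnj_comp \<phi>'_meas jk)
    then have "(\<integral>x. \<phi>' j x * cnj (\<phi>' k x) \<partial>\<nu>') = (\<integral>x. \<phi>' j (g x) * cnj (\<phi>' k (g x)) \<partial>\<nu>)"
      unfolding \<nu>'_def by (rule integral_distr[OF g])
    also have "\<dots> = (\<integral>x. \<phi> j x * cnj (\<phi> k x) \<partial>\<nu>)"
      using \<phi>'_g jk by (intro Bochner_Integration.integral_cong) auto
    also have "\<dots> = (if j = k then 1 else 0)" using bos jk by (simp add: bounded_orthonormal_system_def)
    finally show "(\<integral>x. \<phi>' j x * cnj (\<phi>' k x) \<partial>\<nu>') = (if j = k then 1 else 0)" .
  qed
  define Q where "Q = Pi\<^sub>M {..<n} (\<lambda>_. \<nu>') \<Otimes>\<^sub>M Pi\<^sub>M {..<N} (\<lambda>_. borel :: real measure)"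
  define h where "h \<omega> = (\<lambda>l\<in>{..<n}. g (t l \<omega>), \<lambda>k\<in>{..<N}. \<sigma> k \<omega>)" for \<omega>
  define P' where "P' = distr P Q h"
  define t' where "t' l w = fst w l" for l and w :: sample_space
  define \<sigma>' where "\<sigma>' k w = snd w k" for k and w :: sample_space
  have h: "h \<in> measurable P Q"
    unfolding h_def Q_def
  proof (rule measurable_Pair)
    show "(\<lambda>\<omega>. \<lambda>l\<in>{..<n}. g (t l \<omega>)) \<in> measurable P (Pi\<^sub>M {..<n} (\<lambda>_. \<nu>'))"
      by (rule measurable_restrict) (use measurable_compose[OF t_meas g'] in auto)
    show "(\<lambda>\<omega>. \<lambda>k\<in>{..<N}. \<sigma> k \<omega>) \<in> measurable P (Pi\<^sub>M {..<N} (\<lambda>_. borel))"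
      by (rule measurable_restrict) (use \<sigma>_meas in auto)
  qed
  have P': "prob_space P'" unfolding P'_def by (rule P.prob_space_distr[OF h])
  have t'_h: "t' l (h \<omega>) = g (t l \<omega>)" if "l < n" for l \<omega> using that by (simp add: t'_def h_def)
  have \<sigma>'_h: "\<sigma>' k (h \<omega>) = \<sigma> k \<omega>" if "k < N" for k \<omega> using that by (simp add: \<sigma>'_def h_def)
  have t'_meas: "t' l \<in> measurable Q \<nu>'" if "l < n" for l
    unfolding t'_def Q_def
    by (rule measurable_compose[OF measurable_fst measurable_component_singleton]) (use that in auto)
  have \<sigma>'_meas: "\<sigma>' k \<in> borel_measurable Q" if "k < N" for k
    unfolding \<sigma>'_def Q_def
    by (rule measurable_compose[OF measurable_snd measurable_component_singleton]) (use that in auto)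
  have iid': "iid_sample P' \<nu>' n t'"
    unfolding iid_sample_def
  proof (intro conjI allI impI)
    have "P.indep_vars (\<lambda>_. \<nu>') (\<lambda>l \<omega>. g (t l \<omega>)) {..<n}"
    proof (rule P.indep_vars_compose2)
      show "P.indep_vars (\<lambda>_. \<nu>) t {..<n}" using t by (simp add: iid_sample_def)
    qed (rule g')
    then have "P.indep_vars (\<lambda>_. \<nu>') (\<lambda>l \<omega>. t' l (h \<omega>)) {..<n}"
      using P.indep_vars_cong[of "{..<n}" "{..<n}" "\<lambda>l \<omega>. g (t l \<omega>)" "\<lambda>l \<omega>. t' l (h \<omega>)" "\<lambda>_. \<nu>'" "\<lambda>_. \<nu>'"] t'_h by simp
    then show "prob_space.indep_vars P' (\<lambda>_. \<nu>') t' {..<n}"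
      unfolding P'_def using t'_meas ne(1) by (subst indep_vars_distr_iff[OF P h]) auto
    fix l assume l: "l < n"
    have "distr P' \<nu>' (t' l) = distr P \<nu>' (\<lambda>\<omega>. g (t l \<omega>))"
      unfolding P'_def using distr_distr[OF t'_meas[OF l] h] t'_h[OF l] by (simp add: comp_def)
    also have "\<dots> = distr (distr P \<nu> (t l)) \<nu>' g"
      using distr_distr[OF g' t_meas[OF l]] by (simp add: comp_def)
    also have "\<dots> = distr \<nu> \<nu>' g" using t l by (simp add: iid_sample_def)
    also have "\<dots> = \<nu>'" unfolding \<nu>'_def by (rule distr_cong) (auto simp: sets_distr)
    finally show "distr P' \<nu>' (t' l) = \<nu>'" .
  qed
  have rad': "iid_rademacher P' N \<sigma>'"
    unfolding iid_rademacher_def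
  proof (intro conjI allI impI)
    have "P.indep_vars (\<lambda>_. borel) \<sigma> {..<N}" using \<sigma> by (simp add: iid_rademacher_def)
    then have "P.indep_vars (\<lambda>_. borel) (\<lambda>k \<omega>. \<sigma>' k (h \<omega>)) {..<N}"
      using P.indep_vars_cong[of "{..<N}" "{..<N}" \<sigma> "\<lambda>k \<omega>. \<sigma>' k (h \<omega>)" "\<lambda>_. borel" "\<lambda>_. borel"] \<sigma>'_h by simp
    then show "prob_space.indep_vars P' (\<lambda>_. borel) \<sigma>' {..<N}"
      unfolding P'_def using \<sigma>'_meas ne(2) by (subst indep_vars_distr_iff[OF P h]) auto
    fix k assume k: "k < N"
    have "measure P' {w \<in> space P'. \<sigma>' k w = c} = measure P {\<omega> \<in> space P. \<sigma> k \<omega> = c}" for c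
    proof -
      have "{w \<in> space Q. \<sigma>' k w = c} \<in> sets Q"
        by (rule borel_measurable_eq[OF \<sigma>'_meas[OF k] borel_measurable_const])
      then have "measure P' {w \<in> space Q. \<sigma>' k w = c} = measure P (h -` {w \<in> space Q. \<sigma>' k w = c} \<inter> space P)"
        unfolding P'_def by (rule measure_distr[OF h])
      also have "h -` {w \<in> space Q. \<sigma>' k w = c} \<inter> space P = {\<omega> \<in> space P. \<sigma> k \<omega> = c}"
        using measurable_space[OF h] \<sigma>'_h[OF k] by auto
      finally show ?thesis by (simp add: P'_def)
    qed
    then show "measure P' {w \<in> space P'. \<sigma>' k w = 1} = 1 / 2" "measure P' {w \<in> space P'. \<sigma>' k w = -1} = 1 / 2"
      using \<sigma> k by (auto simp: iid_rademacher_def)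
  qed
  define A' where "A' w = sampling_matrix n N \<phi>' (\<lambda>l. t' l w)" for w
  have A'_h: "A' (h \<omega>) = A \<omega>" if "\<omega> \<in> space P" for \<omega>
    unfolding A'_def A sampling_matrix_def using measurable_space[OF t_meas that] t'_h \<phi>'_g
    by (intro cong_mat) auto
  have ind': "indep_of_matrix P' n N \<sigma>' A'"
    unfolding indep_of_matrix_def P'_def
  proof (rule indep_preimages_distr[OF P h _ _ _ _ ind[unfolded indep_of_matrix_def]])
    show "(\<lambda>w. \<lambda>p\<in>{..<n} \<times> {..<N}. A' w $$ p) \<in> measurable Q (Pi\<^sub>M ({..<n} \<times> {..<N}) (\<lambda>_. borel))"
    proof (rule measurable_restrict)
      fix p assume "p \<in> {..<n} \<times> {..<N}"
      then obtain l k where p: "p = (l, k)" "l < n" "k < N" by auto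
      have "\<phi>' k \<in> borel_measurable \<nu>'" using bos' p(3) by (simp add: bounded_orthonormal_system_def)
      then have "(\<lambda>w. \<phi>' k (t' l w)) \<in> borel_measurable Q" by (rule measurable_compose[OF t'_meas[OF p(2)]])
      then show "(\<lambda>w. A' w $$ p) \<in> borel_measurable Q" using p by (simp add: A'_def sampling_matrix_def)
    qed
    show "(\<lambda>w. \<lambda>k\<in>{..<N}. \<sigma>' k w) \<in> measurable Q (Pi\<^sub>M {..<N} (\<lambda>_. borel))"
      by (rule measurable_restrict) (use \<sigma>'_meas in auto)
    show "(\<lambda>p\<in>{..<n} \<times> {..<N}. A' (h \<omega>) $$ p) = (\<lambda>p\<in>{..<n} \<times> {..<N}. A \<omega> $$ p)" if "\<omega> \<in> space P" for \<omega>
      unfolding A'_h[OF that] ..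
    show "(\<lambda>k\<in>{..<N}. \<sigma>' k (h \<omega>)) = (\<lambda>k\<in>{..<N}. \<sigma> k \<omega>)" for \<omega>
      by (rule restrict_ext) (simp add: \<sigma>'_h)
  qed
  let ?prob = "1 - exp (- (1 / C) * (sqrt (real dmax ^ 2 + \<epsilon>\<^sup>2 * real n / K\<^sup>2) - real dmax))"
  define Y' where "Y' = (\<lambda>w i. image_span n (embedding_matrix n N (A' w) (\<lambda>k. \<sigma>' k w)) (X i))"
  have Y'_h: "Y' (h \<omega>) i = Y \<omega> i" if "\<omega> \<in> space P" for \<omega> i
  proof -
    have "mat_diag N (\<lambda>k. complex_of_real (\<sigma>' k (h \<omega>))) = mat_diag N (\<lambda>k. complex_of_real (\<sigma> k \<omega>))"
      unfolding mat_diag_def using \<sigma>'_h by (intro cong_mat) auto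
    then show ?thesis unfolding Y'_def Y A'_h[OF that] embedding_matrix_def by simp
  qed
  let ?good = "\<lambda>Y i j. \<bar>(aff_complex n (Y i) (Y j))\<^sup>2 - (aff_real N (X i) (X j))\<^sup>2\<bar>
            \<le> \<epsilon> * (real (min (d i) (d j)) - (aff_real N (X i) (X j))\<^sup>2)"
  define G where "G = {w \<in> space P'. \<forall>i j. 1 \<le> i \<longrightarrow> i < j \<longrightarrow> j \<le> L \<longrightarrow> ?good (Y' w) i j}"
  have prob: "?prob \<le> measure P' G"
    unfolding G_def
    by (rule C[unfolded affinity_preservation_def, rule_format, OF N L X[rule_format] dmax K bos' P' iid' _ rad' ind' Y'_def \<epsilon> large])
      (auto simp: A'_def fun_eq_iff)
  have "real dmax < sqrt (real dmax ^ 2 + \<epsilon>\<^sup>2 * real n / K\<^sup>2)"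
    using \<epsilon> n K by (intro real_less_rsqrt) simp
  then have "0 < ?prob" using C1 by simp
  \<comment> \<open>Sets outside the sigma-algebra have measure \<open>0\<close>, so positive probability gives measurability.\<close>
  then have "G \<in> sets P'" using prob measure_notin_sets[of G P'] by linarith
  then have "measure P' G = measure P (h -` G \<inter> space P)"
    unfolding P'_def by (intro measure_distr[OF h]) simp
  also have "h -` G \<inter> space P = {\<omega> \<in> space P. \<forall>i j. 1 \<le> i \<longrightarrow> i < j \<longrightarrow> j \<le> L \<longrightarrow> ?good (Y \<omega>) i j}"
  proof -
    have "h \<omega> \<in> G \<longleftrightarrow> (\<forall>i j. 1 \<le> i \<longrightarrow> i < j \<longrightarrow> j \<le> L \<longrightarrow> ?good (Y \<omega>) i j)" if "\<omega> \<in> space P" for \<omega>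
      using measurable_space[OF h that] unfolding G_def P'_def mem_Collect_eq Y'_h[OF that] space_distr by blast
    then show ?thesis by blast
  qed
  finally show "?prob \<le> measure P {\<omega> \<in> space P. \<forall>i j. 1 \<le> i \<longrightarrow> i < j \<longrightarrow> j \<le> L \<longrightarrow> ?good (Y \<omega>) i j}"
    using prob by simp
qed

theorem corollary2:
  shows "(\<exists>C>1. affinity_preservation TYPE(sample_point) TYPE(sample_space) C) \<and>
    (\<forall>C>1. affinity_preservation TYPE(sample_point) TYPE(sample_space) C \<longrightarrow>
       affinity_preservation TYPE('d) TYPE('w) C)"
proof (intro conjI allI impI)
  have "1 < aff_const" by (simp add: aff_const_def)
  then show "\<exists>C>1. affinity_preservation TYPE(sample_point) TYPE(sample_space) C"
    using affinity_preservation_const by blast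
  fix C :: real assume "1 < C" "affinity_preservation TYPE(sample_point) TYPE(sample_space) C"
  then show "affinity_preservation TYPE('d) TYPE('w) C" by (rule affinity_preservation_transfer[rotated])
qed

end
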